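(* Let $n\in\mathbb{N}_0$ and $\lambda,\mu,\gamma\in\Bbbk$, and let $S=S(n;\lambda,\mu,\gamma)$ be the $\mathcal{D}$-module presented by two generators $s$ and $w$ with defining relations $$g\cdot s=s,\quad g\cdot w=w+\lambda s,\quad \xi\cdot s=ns,\quad \xi\cdot w=nw+\mu s,$$ $$u\cdot s=0,\quad v\cdot s=0,\quad u\cdot w=0,\quad v\cdot w=0,$$ $$x\cdot s=0,\quad y^{n+1}\cdot s=0,\quad x\cdot w=\gamma\, y\cdot s,\quad y^{n+1}\cdot w=0.$$ (i) The module $S$ has dimension $2(n+1)$ if and only if $\lambda+\tfrac n2\gamma=0$ and $\mu=0$. (ii) Set $S_\gamma(n):=S(n;-\tfrac n2\gamma,0,\gamma)$, i.e. $S_\gamma(n)$ is $S$ when $(\lambda,\mu)=(-\tfrac n2\gamma,0)$. Then $S_\gamma(n)\simeq S_{\gamma'}(n)$ if and only if $\gamma=t\gamma'$ for some $t\in\Bbbk^\times$. (iii) For any $\gamma\in\Bbbk$, $S_\gamma(n)$ is an extension of $L(n)$ by $L(n)$. Any extension of $L(n)$ by $L(n)$ is like this, and $\dim\operatorname{Ext}^1_{\mathcal{D}}(L(n),L(n))=1$ for $n\in\mathbb{N}_0$.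
   Context: $\Bbbk$ is an algebraically closed field of characteristic $0$; $\Bbbk^\times=\Bbbk\setminus\{0\}$; $\mathbb{N}_0=\{0,1,2,\dots\}$. $\mathcal{D}$ (the double of the Jordan plane) is the $\Bbbk$-algebra presented by generators $u, v, \xi, g, g^{-1}, x, y$ and relations $g g^{-1}=g^{-1}g=1$, $\xi g=g\xi$, $gx=xg$, $gy=yg+xg$, $\xi y=y\xi-2y$, $\xi x=x\xi-2x$, $ug=gu$, $vg=gv+gu$, $v\xi=\xi v-2v$, $u\xi=\xi u-2u$, $yx=xy-\tfrac12x^2$, $vu=uv-\tfrac12u^2$, $ux=xu$, $vx=xv+(1-g)+xu$, $uy=yu+(1-g)$, $vy=yv+\tfrac12 g\xi+yu$. Modules are left modules. For $n\in\mathbb{N}_0$, $L(n)$ is the simple $\mathcal{D}$-module with basis $z_{n,0},\dots,z_{n,n}$ and action $\xi\cdot z_{n,i}=(n-2i)z_{n,i}$, $v\cdot z_{n,i}=\tfrac{i(n-i+1)}2z_{n,i-1}$, $y\cdot z_{n,i}=z_{n,i+1}$, $x\cdot z_{n,i}=0$, $u\cdot z_{n,i}=0$, $g\cdot z_{n,i}=z_{n,i}$, where $z_{n,-1}=z_{n,n+1}=0$. An extension of $L(n)$ by $L(m)$ is a short exact sequence of $\mathcal{D}$-modules $0\to L(n)\to T\to L(m)\to0$ (by abuse of language, also $T$ is called an extension), and $\operatorname{Ext}^1_{\mathcal{D}}(L(n),L(m))$ denotes the vector space of equivalence classes of such extensions.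
   Formalization: For n = 0 the claim is corrected: all modules S_γ(0) coincide, so in (ii) they are isomorphic for all γ, γ', and in (iii) dim Ext^1(L(0),L(0)) = 0 instead of 1; for n ≥ 1 everything is as stated. *)

theory Defs
  imports
    "HOL-Algebra.QuotRing"
    "HOL-Algebra.Algebraic_Closure_Type"
    "HOL-Library.Poly_Mapping"
    "Jordan_Normal_Form.Missing_VectorSpace"
begin

section \<open>Left modules over a not necessarily commutative ring\<close>

text \<open>
  The library locale \<open>module\<close> asks for a commutative ring of scalars.  The record type
  \<open>module\<close>, the set \<open>module_hom\<close>, the locale \<open>Module.submodule\<close> and the construction
  \<open>direct_sum\<close> do not depend on commutativity and are used as they are.  The ring-like fields
  \<open>mult\<close> and \<open>one\<close> of a module record carry no information.
\<close>

locale left_module = R?: ring R + M?: abelian_group M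
  for R :: "('r, 'q) ring_scheme" (structure) and M :: "('r, 'a, 'c) module_scheme" (structure) +
  assumes smult_closed:
      "\<lbrakk>a \<in> carrier R; x \<in> carrier M\<rbrakk> \<Longrightarrow> a \<odot>\<^bsub>M\<^esub> x \<in> carrier M"
    and smult_l_distr:
      "\<lbrakk>a \<in> carrier R; b \<in> carrier R; x \<in> carrier M\<rbrakk> \<Longrightarrow>
        (a \<oplus>\<^bsub>R\<^esub> b) \<odot>\<^bsub>M\<^esub> x = a \<odot>\<^bsub>M\<^esub> x \<oplus>\<^bsub>M\<^esub> b \<odot>\<^bsub>M\<^esub> x"
    and smult_r_distr:
      "\<lbrakk>a \<in> carrier R; x \<in> carrier M; y \<in> carrier M\<rbrakk> \<Longrightarrow>
        a \<odot>\<^bsub>M\<^esub> (x \<oplus>\<^bsub>M\<^esub> y) = a \<odot>\<^bsub>M\<^esub> x \<oplus>\<^bsub>M\<^esub> a \<odot>\<^bsub>M\<^esub> y"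
    and smult_assoc1:
      "\<lbrakk>a \<in> carrier R; b \<in> carrier R; x \<in> carrier M\<rbrakk> \<Longrightarrow>
        (a \<otimes>\<^bsub>R\<^esub> b) \<odot>\<^bsub>M\<^esub> x = a \<odot>\<^bsub>M\<^esub> (b \<odot>\<^bsub>M\<^esub> x)"
    and smult_one: "x \<in> carrier M \<Longrightarrow> \<one>\<^bsub>R\<^esub> \<odot>\<^bsub>M\<^esub> x = x"

definition module_iso ::
  "('r, 'q) ring_scheme \<Rightarrow> ('r, 'a, 'c) module_scheme \<Rightarrow> ('r, 'b, 'd) module_scheme \<Rightarrow> ('a \<Rightarrow> 'b) set"
  where "module_iso R M N = {h \<in> module_hom R M N. bij_betw h (carrier M) (carrier N)}"

definition modules_isomorphic ::
  "('r, 'q) ring_scheme \<Rightarrow> ('r, 'a, 'c) module_scheme \<Rightarrow> ('r, 'b, 'd) module_scheme \<Rightarrow> bool"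
  where "modules_isomorphic R M N \<longleftrightarrow> module_iso R M N \<noteq> {}"

text \<open>The ring \<open>R\<close> as a left module over itself.\<close>

definition regular_module :: "('r, 'q) ring_scheme \<Rightarrow> ('r, 'r) module"
  where "regular_module R =
    \<lparr>carrier = carrier R, monoid.mult = monoid.mult R, one = one R, zero = zero R, add = add R,
     module.smult = monoid.mult R\<rparr>"

definition generated_submodule ::
  "('r, 'q) ring_scheme \<Rightarrow> ('r, 'a, 'c) module_scheme \<Rightarrow> 'a set \<Rightarrow> 'a set"
  where "generated_submodule R M Y = \<Inter>{N. Module.submodule N R M \<and> Y \<subseteq> N}"

definition quotient_module :: "('r, 'a, 'c) module_scheme \<Rightarrow> 'a set \<Rightarrow> ('r, 'a set) module"
  where "quotient_module M N =
    \<lparr>carrier = a_rcosets\<^bsub>M\<^esub> N, monoid.mult = undefined, one = undefined, zero = N, add = set_add M,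
     module.smult = (\<lambda>a Y. \<Union>x\<in>Y. N +>\<^bsub>M\<^esub> (a \<odot>\<^bsub>M\<^esub> x))\<rparr>"


section \<open>Extensions and the first Ext space\<close>

definition short_exact ::
  "('r, 'q) ring_scheme \<Rightarrow> ('r, 'a) module \<Rightarrow> ('a \<Rightarrow> 't) \<Rightarrow> ('r, 't) module \<Rightarrow> ('t \<Rightarrow> 'b)
    \<Rightarrow> ('r, 'b) module \<Rightarrow> bool"
  where "short_exact R M i T p N \<longleftrightarrow>
    left_module R M \<and> left_module R T \<and> left_module R N \<and>
    i \<in> module_hom R M T \<and> p \<in> module_hom R T N \<and>
    inj_on i (carrier M) \<and>
    i ` carrier M = {t \<in> carrier T. p t = \<zero>\<^bsub>N\<^esub>} \<and>
    p ` carrier T = carrier N"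

text \<open>An extension \<open>0 \<rightarrow> M \<rightarrow> T \<rightarrow> N \<rightarrow> 0\<close> is recorded as the triple \<open>(T, i, p)\<close>.\<close>

type_synonym ('r, 'a, 'b, 't) ext = "('r, 't) module \<times> ('a \<Rightarrow> 't) \<times> ('t \<Rightarrow> 'b)"

definition ext_equiv ::
  "('r, 'q) ring_scheme \<Rightarrow> ('r, 'a) module \<Rightarrow> ('r, 'a, 'b, 's) ext \<Rightarrow> ('r, 'a, 'b, 't) ext \<Rightarrow> bool"
  where "ext_equiv R M E E' \<longleftrightarrow>
    (case E of (T, i, p) \<Rightarrow> case E' of (T', i', p') \<Rightarrow>
      \<exists>h \<in> module_iso R T T'.
        (\<forall>m \<in> carrier M. h (i m) = i' m) \<and> (\<forall>t \<in> carrier T. p' (h t) = p t))"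

definition split_ext :: "('r, 'a) module \<Rightarrow> ('r, 'b) module \<Rightarrow> ('r, 'a, 'b, 'a \<times> 'b) ext"
  where "split_ext M N = (direct_sum M N, (\<lambda>m. (m, \<zero>\<^bsub>N\<^esub>)), snd)"

text \<open>The Baer sum: the pullback of the two projections, modulo \<open>{(i m, - i' m) | m \<in> M}\<close>.\<close>

definition baer_sum ::
  "('r, 'a) module \<Rightarrow> ('r, 'a, 'b, 's) ext \<Rightarrow> ('r, 'a, 'b, 't) ext \<Rightarrow> ('r, 'a, 'b, ('s \<times> 't) set) ext"
  where "baer_sum M E E' =
    (case E of (T, i, p) \<Rightarrow> case E' of (T', i', p') \<Rightarrow>
      let P = (direct_sum T T')\<lparr>carrier := {(t, t') \<in> carrier T \<times> carrier T'. p t = p' t'}\<rparr>;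
          \<Delta> = (\<lambda>m. (i m, \<ominus>\<^bsub>T'\<^esub> i' m)) ` carrier M
      in (quotient_module P \<Delta>,
          (\<lambda>m. \<Delta> +>\<^bsub>P\<^esub> (i m, \<zero>\<^bsub>T'\<^esub>)),
          (\<lambda>Y. the_elem ((\<lambda>(t, t'). p t) ` Y))))"

text \<open>The pushout of an extension along an endomorphism \<open>\<phi>\<close> of \<open>M\<close>.\<close>

definition pushout_ext ::
  "('r, 'a) module \<Rightarrow> ('a \<Rightarrow> 'a) \<Rightarrow> ('r, 'a, 'b, 't) ext \<Rightarrow> ('r, 'a, 'b, ('a \<times> 't) set) ext"
  where "pushout_ext M \<phi> E =
    (case E of (T, i, p) \<Rightarrow>
      let Q = direct_sum M T;
          \<Delta> = (\<lambda>m. (\<phi> m, \<ominus>\<^bsub>T\<^esub> i m)) ` carrier M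
      in (quotient_module Q \<Delta>,
          (\<lambda>m. \<Delta> +>\<^bsub>Q\<^esub> (m, \<zero>\<^bsub>T\<^esub>)),
          (\<lambda>Y. the_elem ((\<lambda>(m, t). p t) ` Y))))"

text \<open>
  To have a set of equivalence classes, the middle terms are taken with underlying set contained
  in the type \<open>'a \<times> 'b\<close>.  Nothing is lost: for any extension \<open>0 \<rightarrow> M \<rightarrow> T \<rightarrow> N \<rightarrow> 0\<close>, in whatever
  type, a set-theoretic section of \<open>T \<rightarrow> N\<close> identifies \<open>T\<close> with the set
  \<open>carrier M \<times> carrier N\<close>, so that the extension is equivalent to one of these.
  The Baer sum and the pushout live in other types; the operations on classes collect the
  admissible extensions equivalent to them.
\<close>

definition extensions ::
  "('r, 'q) ring_scheme \<Rightarrow> ('r, 'a) module \<Rightarrow> ('r, 'b) module \<Rightarrow> ('r, 'a, 'b, 'a \<times> 'b) ext set"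
  where "extensions R M N = {(T, i, p). short_exact R M i T p N}"

definition ext_rel ::
  "('r, 'q) ring_scheme \<Rightarrow> ('r, 'a) module \<Rightarrow> ('r, 'b) module
    \<Rightarrow> (('r, 'a, 'b, 'a \<times> 'b) ext \<times> ('r, 'a, 'b, 'a \<times> 'b) ext) set"
  where "ext_rel R M N =
    {(E, E'). E \<in> extensions R M N \<and> E' \<in> extensions R M N \<and> ext_equiv R M E E'}"

text \<open>
  \<open>Ext1 R \<iota> M N\<close> is the space of classes of extensions \<open>0 \<rightarrow> M \<rightarrow> T \<rightarrow> N \<rightarrow> 0\<close> (in this order
  of the arguments), for an algebra \<open>R\<close> over a field \<open>'k\<close> with structure map \<open>\<iota>\<close>.
\<close>

definition Ext1 ::
  "('r, 'q) ring_scheme \<Rightarrow> ('k \<Rightarrow> 'r) \<Rightarrow> ('r, 'a) module \<Rightarrow> ('r, 'b) module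
    \<Rightarrow> ('k, ('r, 'a, 'b, 'a \<times> 'b) ext set) module"
  where "Ext1 R \<iota> M N =
    \<lparr>carrier = extensions R M N // ext_rel R M N,
     monoid.mult = undefined, one = undefined,
     zero = {E \<in> extensions R M N. ext_equiv R M E (split_ext M N)},
     add = (\<lambda>A B. {E \<in> extensions R M N. \<exists>E1\<in>A. \<exists>E2\<in>B. ext_equiv R M E (baer_sum M E1 E2)}),
     module.smult = (\<lambda>c A. {E \<in> extensions R M N.
               \<exists>E1\<in>A. ext_equiv R M E (pushout_ext M (\<lambda>m. \<iota> c \<odot>\<^bsub>M\<^esub> m) E1)})\<rparr>"


section \<open>Dimension over the base field\<close>

text \<open>
  The library's \<open>vectorspace.dim\<close> is a natural number without meaning for spaces that are not
  finitely generated, hence the clause \<open>fin_dim\<close>.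
\<close>

definition has_dim :: "('k::field, 'v, 'c) module_scheme \<Rightarrow> nat \<Rightarrow> bool"
  where "has_dim V d \<longleftrightarrow>
    vectorspace ring_of_type_algebra V \<and>
    vectorspace.fin_dim ring_of_type_algebra V \<and>
    vectorspace.dim ring_of_type_algebra V = d"

definition restrict_scalars :: "('k \<Rightarrow> 'r) \<Rightarrow> ('r, 'a) module \<Rightarrow> ('k, 'a) module"
  where "restrict_scalars \<iota> M =
    \<lparr>carrier = carrier M, monoid.mult = monoid.mult M, one = one M, zero = zero M, add = add M,
     module.smult = (\<lambda>c m. \<iota> c \<odot>\<^bsub>M\<^esub> m)\<rparr>"


section \<open>The double of the Jordan plane\<close>

datatype dj_gen = Gu | Gv | Gxi | Gg | Gginv | Gx | Gy

text \<open>
  Words form the free monoid under concatenation.  The wrapper type only serves to give this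
  monoid the additive notation from which the convolution product of \<open>poly_mapping\<close> is built;
  so \<open>word \<Rightarrow>\<^sub>0 'k\<close> is the free associative algebra.
\<close>

datatype word = Word (letters: "dj_gen list")

instantiation word :: monoid_add
begin
definition zero_word :: word where "0 = Word []"
definition plus_word :: "word \<Rightarrow> word \<Rightarrow> word" where "a + b = Word (letters a @ letters b)"
instance by standard (auto simp: zero_word_def plus_word_def)
end

type_synonym 'k free_alg = "word \<Rightarrow>\<^sub>0 'k"

definition fa_gen :: "dj_gen \<Rightarrow> 'k::field free_alg"
  where "fa_gen a = Poly_Mapping.single (Word [a]) 1"

definition fa_const :: "'k::field \<Rightarrow> 'k free_alg"
  where "fa_const c = Poly_Mapping.single 0 c"

text \<open>Each element stands for the relation setting it equal to zero.\<close>

definition dj_relators :: "'k::field free_alg set"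
  where "dj_relators =
    (let u = fa_gen Gu; v = fa_gen Gv; \<xi> = fa_gen Gxi; g = fa_gen Gg; ginv = fa_gen Gginv;
         x = fa_gen Gx; y = fa_gen Gy; half = fa_const (1 / 2)
     in {g * ginv - 1,
         ginv * g - 1,
         \<xi> * g - g * \<xi>,
         g * x - x * g,
         g * y - (y * g + x * g),
         \<xi> * y - (y * \<xi> - 2 * y),
         \<xi> * x - (x * \<xi> - 2 * x),
         u * g - g * u,
         v * g - (g * v + g * u),
         v * \<xi> - (\<xi> * v - 2 * v),
         u * \<xi> - (\<xi> * u - 2 * u),
         y * x - (x * y - half * x ^ 2),
         v * u - (u * v - half * u ^ 2),
         u * x - x * u,
         v * x - (x * v + (1 - g) + x * u),
         u * y - (y * u + (1 - g)),
         v * y - (y * v + half * g * \<xi> + y * u)})"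

definition dj_ideal :: "'k::field free_alg set"
  where "dj_ideal = genideal ring_of_type_algebra dj_relators"

type_synonym 'k dj = "'k free_alg set"

definition DJ :: "'k::field dj ring"
  where "DJ = ring_of_type_algebra Quot dj_ideal"

definition dj_elem :: "'k::field free_alg \<Rightarrow> 'k dj"
  where "dj_elem a = dj_ideal +>\<^bsub>ring_of_type_algebra\<^esub> a"

definition dj_gen_elem :: "dj_gen \<Rightarrow> 'k::field dj"
  where "dj_gen_elem a = dj_elem (fa_gen a)"

definition dj_const :: "'k::field \<Rightarrow> 'k dj"
  where "dj_const c = dj_elem (fa_const c)"


section \<open>The simple modules \<open>L(n)\<close>\<close>

text \<open>
  The underlying space consists of the \<open>f :: nat \<Rightarrow> 'k\<close> supported on \<open>{0..n}\<close>, where \<open>f\<close>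
  stands for the sum of the \<open>f i\<close> times \<open>z\<^sub>n\<^sub>,\<^sub>i\<close>.
\<close>

definition zvec :: "nat \<Rightarrow> nat \<Rightarrow> nat \<Rightarrow> 'k::field"
  where "zvec n i = (\<lambda>j. if j = i \<and> i \<le> n then 1 else 0)"

text \<open>
  The image of the basis vector \<open>z\<^sub>n\<^sub>,\<^sub>i\<close> under a generator.  For \<open>v\<close> and \<open>i = 0\<close> the truncated
  index \<open>i - 1\<close> is harmless, because the coefficient \<open>i (n - i + 1) / 2\<close> vanishes.
\<close>

fun L_basis_action :: "nat \<Rightarrow> dj_gen \<Rightarrow> nat \<Rightarrow> (nat \<Rightarrow> 'k::field)" where
  "L_basis_action n Gxi i = (\<lambda>j. (of_nat n - 2 * of_nat i) * zvec n i j)"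
| "L_basis_action n Gv i =
    (\<lambda>j. of_nat i * (of_nat n - of_nat i + 1) / 2 * zvec n (i - 1) j)"
| "L_basis_action n Gy i = zvec n (i + 1)"
| "L_basis_action n Gx i = (\<lambda>j. 0)"
| "L_basis_action n Gu i = (\<lambda>j. 0)"
| "L_basis_action n Gg i = zvec n i"
| "L_basis_action n Gginv i = zvec n i"

definition L_gen_action :: "nat \<Rightarrow> dj_gen \<Rightarrow> (nat \<Rightarrow> 'k::field) \<Rightarrow> (nat \<Rightarrow> 'k)"
  where "L_gen_action n a f = (\<lambda>j. \<Sum>i\<le>n. f i * L_basis_action n a i j)"

definition L_free_action :: "nat \<Rightarrow> 'k::field free_alg \<Rightarrow> (nat \<Rightarrow> 'k) \<Rightarrow> (nat \<Rightarrow> 'k)"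
  where "L_free_action n a f =
    (\<lambda>j. \<Sum>b\<in>Poly_Mapping.keys a. Poly_Mapping.lookup a b * foldr (L_gen_action n) (letters b) f j)"

text \<open>
  A class in \<open>DJ\<close> acts as any of its representatives; \<open>the_elem\<close> picks the common value, which is
  meaningful because the action of the free algebra kills the relators.
\<close>

definition L :: "nat \<Rightarrow> ('k::field dj, nat \<Rightarrow> 'k) module"
  where "L n =
    \<lparr>carrier = {f. \<forall>i>n. f i = 0}, monoid.mult = undefined, one = undefined,
     zero = (\<lambda>j. 0), add = (\<lambda>f h j. f j + h j),
     module.smult = (\<lambda>A f. the_elem ((\<lambda>a. L_free_action n a f) ` A))\<rparr>"


section \<open>The modules \<open>S(n; \<lambda>, \<mu>, \<gamma>)\<close>\<close>

text \<open>The free module on the generators \<open>s\<close> and \<open>w\<close>.\<close>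

definition S_free :: "('k::field dj, 'k dj \<times> 'k dj) module"
  where "S_free = direct_sum (regular_module DJ) (regular_module DJ)"

definition S_relators :: "nat \<Rightarrow> 'k::field \<Rightarrow> 'k \<Rightarrow> 'k \<Rightarrow> ('k dj \<times> 'k dj) set"
  where "S_relators n lam mu gam =
    (let F = S_free;
         s = (\<one>\<^bsub>DJ\<^esub>, \<zero>\<^bsub>DJ\<^esub>); w = (\<zero>\<^bsub>DJ\<^esub>, \<one>\<^bsub>DJ\<^esub>);
         u = dj_gen_elem Gu; v = dj_gen_elem Gv; \<xi> = dj_gen_elem Gxi; g = dj_gen_elem Gg;
         x = dj_gen_elem Gx; y = dj_gen_elem Gy; yn1 = y [^]\<^bsub>DJ\<^esub> (n + 1)
     in {g \<odot>\<^bsub>F\<^esub> s \<ominus>\<^bsub>F\<^esub> s,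
         g \<odot>\<^bsub>F\<^esub> w \<ominus>\<^bsub>F\<^esub> (w \<oplus>\<^bsub>F\<^esub> dj_const lam \<odot>\<^bsub>F\<^esub> s),
         \<xi> \<odot>\<^bsub>F\<^esub> s \<ominus>\<^bsub>F\<^esub> dj_const (of_nat n) \<odot>\<^bsub>F\<^esub> s,
         \<xi> \<odot>\<^bsub>F\<^esub> w \<ominus>\<^bsub>F\<^esub> (dj_const (of_nat n) \<odot>\<^bsub>F\<^esub> w \<oplus>\<^bsub>F\<^esub> dj_const mu \<odot>\<^bsub>F\<^esub> s),
         u \<odot>\<^bsub>F\<^esub> s, v \<odot>\<^bsub>F\<^esub> s, u \<odot>\<^bsub>F\<^esub> w, v \<odot>\<^bsub>F\<^esub> w,
         x \<odot>\<^bsub>F\<^esub> s, yn1 \<odot>\<^bsub>F\<^esub> s,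
         x \<odot>\<^bsub>F\<^esub> w \<ominus>\<^bsub>F\<^esub> dj_const gam \<odot>\<^bsub>F\<^esub> (y \<odot>\<^bsub>F\<^esub> s),
         yn1 \<odot>\<^bsub>F\<^esub> w})"

definition S :: "nat \<Rightarrow> 'k::field \<Rightarrow> 'k \<Rightarrow> 'k \<Rightarrow> ('k dj, ('k dj \<times> 'k dj) set) module"
  where "S n lam mu gam =
    quotient_module S_free (generated_submodule DJ S_free (S_relators n lam mu gam))"

text \<open>
  For \<open>n = 0\<close> the relation \<open>y s = 0\<close> makes \<open>x w = \<gamma> y s\<close> independent of \<open>\<gamma>\<close>: all \<open>S_gamma 0 \<gamma>\<close>
  coincide, and \<open>L 0\<close> has no nontrivial self-extension.
\<close>

definition S_gamma :: "nat \<Rightarrow> 'k::field \<Rightarrow> ('k dj, ('k dj \<times> 'k dj) set) module"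
  where "S_gamma n gam = S n (- (of_nat n / 2) * gam) 0 gam"

end

theory Submission
  imports Defs "HOL-Library.Function_Algebras" "HOL-Library.Product_Plus"
begin

text \<open>
  In a module generated by \<open>s\<close> and \<open>w\<close> as in the definition of \<open>S n lam mu gam\<close>, the relations of the
  algebra move every generator past \<open>y\<close>. So the vectors \<open>y\<^sup>i s\<close> and \<open>y\<^sup>i w\<close> span, and the action on them
  is forced by that on \<open>s\<close> and \<open>w\<close>. The resulting formulas are those of a self-extension of a Verma
  module with parameters \<open>\<alpha> = \<lambda> + n/2 \<gamma>\<close>, \<open>\<mu>\<close> and \<open>\<gamma>\<close> (lemma \<open>E_intertwines\<close>).

  Truncation at degree \<open>n\<close> obstructs: as \<open>y\<^sup>n\<^sup>+\<^sup>1 w = 0\<close>, the generators \<open>u\<close> and \<open>v\<close> give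
  \<open>\<alpha> y\<^sup>n s = 0\<close> and then \<open>\<mu> y\<^sup>n s = 0\<close>. As \<open>y\<^sup>n s = 0\<close> implies \<open>s = 0\<close>, either \<open>\<alpha> = \<mu> = 0\<close> or the module is
  spanned by the \<open>n + 1\<close> vectors \<open>y\<^sup>i w\<close> (lemma \<open>s_zero_or_parameters\<close>).

  For \<open>\<alpha> = \<mu> = 0\<close> there is a model of dimension \<open>2 (n + 1)\<close>: on the sum of two copies of \<open>L n\<close>, with \<open>\<epsilon>\<close>
  mapping the second copy to the first, let \<open>x\<close> act as \<open>\<gamma> \<epsilon> y\<close>, \<open>u\<close> as \<open>\<gamma> \<epsilon> v\<close>, \<open>g\<close> as \<open>1 - \<gamma>/2 \<epsilon> \<xi>\<close>, and
  change the action of \<open>v\<close> by \<open>- \<gamma>/2 \<epsilon> \<xi> v\<close>. It satisfies all relations (lemma \<open>ext_representation\<close>) and is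
  therefore isomorphic to \<open>S_gamma n gam\<close> (lemma \<open>ext_module_iso_S\<close>).

  Conversely, weights with respect to \<open>\<xi>\<close> show that a suitable lift \<open>w\<close> of the highest weight vector in
  any extension of \<open>L n\<close> by \<open>L n\<close> satisfies these relations, and \<open>s \<noteq> 0\<close>; hence the extension is
  equivalent to a model (lemma \<open>extension_classification\<close>). Its parameter is read off from
  \<open>x w = \<gamma> y s\<close>, which is no information if \<open>n = 0\<close>. Rescaling \<open>w\<close> rescales \<open>\<gamma>\<close>, which settles the
  isomorphism classes of modules. Under the Baer sum and under pushouts \<open>\<gamma>\<close> behaves linearly (lemma
  \<open>Ext1_operations\<close>), which gives the space of extensions.
\<close>

section \<open>Left modules\<close>

lemma (in abelian_group) minus_eq_zero_iff:
  assumes "x \<in> carrier G" "y \<in> carrier G"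
  shows "x \<ominus> y = \<zero> \<longleftrightarrow> x = y"
  using assms by (metis a_minus_def add.inv_solve_right' l_zero zero_closed)

context left_module begin

lemma smult_l_null:
  assumes "x \<in> carrier M" shows "\<zero>\<^bsub>R\<^esub> \<odot>\<^bsub>M\<^esub> x = \<zero>\<^bsub>M\<^esub>"
proof -
  have "\<zero>\<^bsub>R\<^esub> \<odot>\<^bsub>M\<^esub> x \<oplus>\<^bsub>M\<^esub> \<zero>\<^bsub>R\<^esub> \<odot>\<^bsub>M\<^esub> x = \<zero>\<^bsub>R\<^esub> \<odot>\<^bsub>M\<^esub> x"
    using smult_l_distr[of "\<zero>\<^bsub>R\<^esub>" "\<zero>\<^bsub>R\<^esub>" x] assms by simp
  then show ?thesis using assms smult_closed[of "\<zero>\<^bsub>R\<^esub>" x] by simp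
qed

lemma smult_r_null:
  assumes "a \<in> carrier R" shows "a \<odot>\<^bsub>M\<^esub> \<zero>\<^bsub>M\<^esub> = \<zero>\<^bsub>M\<^esub>"
proof -
  have "a \<odot>\<^bsub>M\<^esub> \<zero>\<^bsub>M\<^esub> \<oplus>\<^bsub>M\<^esub> a \<odot>\<^bsub>M\<^esub> \<zero>\<^bsub>M\<^esub> = a \<odot>\<^bsub>M\<^esub> \<zero>\<^bsub>M\<^esub>"
    using smult_r_distr[of a "\<zero>\<^bsub>M\<^esub>" "\<zero>\<^bsub>M\<^esub>"] assms by simp
  then show ?thesis using assms smult_closed[of a "\<zero>\<^bsub>M\<^esub>"] by simp
qed

lemma smult_r_minus:
  assumes "a \<in> carrier R" "x \<in> carrier M"
  shows "a \<odot>\<^bsub>M\<^esub> (\<ominus>\<^bsub>M\<^esub> x) = \<ominus>\<^bsub>M\<^esub> (a \<odot>\<^bsub>M\<^esub> x)"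
proof -
  have "a \<odot>\<^bsub>M\<^esub> (\<ominus>\<^bsub>M\<^esub> x) \<oplus>\<^bsub>M\<^esub> a \<odot>\<^bsub>M\<^esub> x = \<zero>\<^bsub>M\<^esub>"
    using smult_r_distr[of a "\<ominus>\<^bsub>M\<^esub> x" x] assms by (simp add: M.l_neg smult_r_null)
  then show ?thesis using assms by (intro M.minus_equality[symmetric]) (auto intro: smult_closed)
qed

lemma smult_l_minus:
  assumes "a \<in> carrier R" "x \<in> carrier M"
  shows "(\<ominus>\<^bsub>R\<^esub> a) \<odot>\<^bsub>M\<^esub> x = \<ominus>\<^bsub>M\<^esub> (a \<odot>\<^bsub>M\<^esub> x)"
proof -
  have "(\<ominus>\<^bsub>R\<^esub> a) \<odot>\<^bsub>M\<^esub> x \<oplus>\<^bsub>M\<^esub> a \<odot>\<^bsub>M\<^esub> x = \<zero>\<^bsub>M\<^esub>"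
    using smult_l_distr[of "\<ominus>\<^bsub>R\<^esub> a" a x] assms by (simp add: R.l_neg smult_l_null)
  then show ?thesis using assms by (intro M.minus_equality[symmetric]) (auto intro: smult_closed)
qed

lemma smult_r_diff:
  assumes "a \<in> carrier R" "x \<in> carrier M" "y \<in> carrier M"
  shows "a \<odot>\<^bsub>M\<^esub> (x \<ominus>\<^bsub>M\<^esub> y) = a \<odot>\<^bsub>M\<^esub> x \<ominus>\<^bsub>M\<^esub> a \<odot>\<^bsub>M\<^esub> y"
  using assms by (simp add: a_minus_def smult_r_distr smult_r_minus)

lemma submodule_abelian_subgroup:
  assumes "Module.submodule N R M" shows "abelian_subgroup N M"
  using assms M.abelian_group_axioms
  by (intro abelian_subgroupI3) (auto simp: Module.submodule_def additive_subgroup_def)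

lemma submoduleI:
  assumes "N \<subseteq> carrier M" "\<zero>\<^bsub>M\<^esub> \<in> N"
    and "\<And>x y. x \<in> N \<Longrightarrow> y \<in> N \<Longrightarrow> x \<oplus>\<^bsub>M\<^esub> y \<in> N"
    and smult: "\<And>a x. a \<in> carrier R \<Longrightarrow> x \<in> N \<Longrightarrow> a \<odot>\<^bsub>M\<^esub> x \<in> N"
  shows "Module.submodule N R M"
proof -
  have "\<ominus>\<^bsub>M\<^esub> x \<in> N" if "x \<in> N" for x
    using smult[of "\<ominus>\<^bsub>R\<^esub> \<one>\<^bsub>R\<^esub>" x] that assms(1) by (auto simp: smult_l_minus smult_one subset_iff)
  then show ?thesis
    using assms unfolding Module.submodule_def Module.submodule_axioms_def
    by (auto intro!: subgroup.intro simp: a_inv_def)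
qed

lemma submodule_left_module:
  assumes "Module.submodule N R M" shows "left_module R (M\<lparr>carrier := N\<rparr>)"
proof -
  interpret N: Module.submodule N R M by fact
  have sub: "x \<in> carrier M" if "x \<in> N" for x using N.subset that by auto
  show ?thesis
  proof (intro left_module.intro left_module_axioms.intro)
    show "ring R" by (rule R.ring_axioms)
    have "\<exists>y\<in>N. y \<oplus>\<^bsub>M\<^esub> x = \<zero>\<^bsub>M\<^esub>" if "x \<in> N" for x
      using N.m_inv_closed[OF that] sub[OF that] M.l_neg by (auto simp: a_inv_def[symmetric])
    then show "abelian_group (M\<lparr>carrier := N\<rparr>)"
      using N.m_closed N.one_closed M.a_assoc M.a_comm M.l_zero sub
      by (intro abelian_groupI) simp_all
  qed (auto simp: smult_l_distr smult_r_distr smult_assoc1 smult_one sub)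
qed

end

lemma left_module_direct_sum:
  assumes "left_module R M" "left_module R N"
  shows "left_module R (direct_sum M N)"
proof -
  interpret M: left_module R M by fact
  interpret N: left_module R N by fact
  have 1: "\<exists>y\<in>carrier M. \<exists>z\<in>carrier N. a \<oplus>\<^bsub>M\<^esub> y = \<zero>\<^bsub>M\<^esub> \<and> b \<oplus>\<^bsub>N\<^esub> z = \<zero>\<^bsub>N\<^esub>"
    if "a \<in> carrier M" "b \<in> carrier N" for a b
    using that by (intro bexI[of _ "\<ominus>\<^bsub>M\<^esub> a"] bexI[of _ "\<ominus>\<^bsub>N\<^esub> b"]) (auto simp: M.M.r_neg N.M.r_neg)
  show ?thesis
  proof (intro left_module.intro left_module_axioms.intro)
    show "ring R" by (rule M.R.ring_axioms)
    show "abelian_group (direct_sum M N)"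
      using 1 by (intro abelian_groupI)
        (auto simp: direct_sum_def M.M.a_ac N.M.a_ac)
  qed (auto simp: direct_sum_def M.smult_l_distr M.smult_r_distr M.smult_assoc1 M.smult_one
      N.smult_l_distr N.smult_r_distr N.smult_assoc1 N.smult_one M.smult_closed N.smult_closed)
qed

lemma left_module_regular: "ring R \<Longrightarrow> left_module R (regular_module R)"
proof -
  assume "ring R"
  then interpret ring R .
  show ?thesis
  proof (intro left_module.intro left_module_axioms.intro)
    show "ring R" by fact
    have 1: "\<exists>y\<in>carrier R. y \<oplus>\<^bsub>R\<^esub> x = \<zero>\<^bsub>R\<^esub>" if "x \<in> carrier R" for x
      using that l_neg by (intro bexI[of _ "\<ominus>\<^bsub>R\<^esub> x"]) auto
    show "abelian_group (regular_module R)"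
      using 1 by (intro abelian_groupI) (auto simp: regular_module_def a_ac)
  qed (auto simp: regular_module_def l_distr r_distr m_assoc)
qed

subsection \<open>Homomorphisms\<close>

lemma module_homI:
  assumes "\<And>x. x \<in> carrier M \<Longrightarrow> f x \<in> carrier N"
    and "\<And>x y. x \<in> carrier M \<Longrightarrow> y \<in> carrier M \<Longrightarrow> f (x \<oplus>\<^bsub>M\<^esub> y) = f x \<oplus>\<^bsub>N\<^esub> f y"
    and "\<And>a x. a \<in> carrier R \<Longrightarrow> x \<in> carrier M \<Longrightarrow> f (a \<odot>\<^bsub>M\<^esub> x) = a \<odot>\<^bsub>N\<^esub> f x"
  shows "f \<in> module_hom R M N"
  using assms by (auto simp: module_hom_def)

lemma module_hom_in: "f \<in> module_hom R M N \<Longrightarrow> x \<in> carrier M \<Longrightarrow> f x \<in> carrier N"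
  by (auto simp: module_hom_def)

lemma module_hom_zero:
  assumes "left_module R M" "left_module R N" "f \<in> module_hom R M N"
  shows "f \<zero>\<^bsub>M\<^esub> = \<zero>\<^bsub>N\<^esub>"
proof -
  interpret M: left_module R M by fact
  interpret N: left_module R N by fact
  have "f \<zero>\<^bsub>M\<^esub> \<oplus>\<^bsub>N\<^esub> f \<zero>\<^bsub>M\<^esub> = f \<zero>\<^bsub>M\<^esub>"
    using module_hom_add[OF assms(3), of "\<zero>\<^bsub>M\<^esub>" "\<zero>\<^bsub>M\<^esub>"] by simp
  then show ?thesis using module_hom_in[OF assms(3), of "\<zero>\<^bsub>M\<^esub>"] by simp
qed

lemma module_hom_minus:
  assumes "left_module R M" "left_module R N" "f \<in> module_hom R M N" "x \<in> carrier M"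
  shows "f (\<ominus>\<^bsub>M\<^esub> x) = \<ominus>\<^bsub>N\<^esub> f x"
proof -
  interpret M: left_module R M by fact
  interpret N: left_module R N by fact
  have "f (\<ominus>\<^bsub>M\<^esub> x) \<oplus>\<^bsub>N\<^esub> f x = \<zero>\<^bsub>N\<^esub>"
    using module_hom_add[OF assms(3), of "\<ominus>\<^bsub>M\<^esub> x" x] assms
    by (simp add: M.M.l_neg module_hom_zero[OF assms(1-3)])
  then show ?thesis
    using assms module_hom_in[OF assms(3)] by (intro N.M.minus_equality[symmetric]) auto
qed

lemma module_hom_diff:
  assumes "left_module R M" "left_module R N" "f \<in> module_hom R M N" "x \<in> carrier M" "y \<in> carrier M"
  shows "f (x \<ominus>\<^bsub>M\<^esub> y) = f x \<ominus>\<^bsub>N\<^esub> f y"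
proof -
  interpret M: left_module R M by fact
  show ?thesis using assms by (simp add: a_minus_def module_hom_minus module_hom_add[OF assms(3)])
qed

lemma module_hom_comp:
  "f \<in> module_hom R M N \<Longrightarrow> g \<in> module_hom R N P \<Longrightarrow> g \<circ> f \<in> module_hom R M P"
  by (auto simp: module_hom_def Pi_def)

lemma kernel_submodule:
  assumes "left_module R M" "left_module R N" "f \<in> module_hom R M N"
  shows "Module.submodule {x \<in> carrier M. f x = \<zero>\<^bsub>N\<^esub>} R M"
proof -
  interpret M: left_module R M by fact
  interpret N: left_module R N by fact
  show ?thesis
    by (rule M.submoduleI)
      (auto simp: module_hom_zero[OF assms] module_hom_add[OF assms(3)] module_hom_smult[OF assms(3)]
        N.smult_r_null M.smult_closed)
qed

lemma module_hom_inj_onI: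
  assumes "left_module R M" "left_module R N" "f \<in> module_hom R M N"
    and "\<And>x. x \<in> carrier M \<Longrightarrow> f x = \<zero>\<^bsub>N\<^esub> \<Longrightarrow> x = \<zero>\<^bsub>M\<^esub>"
  shows "inj_on f (carrier M)"
proof (rule inj_onI)
  interpret M: left_module R M by fact
  interpret N: left_module R N by fact
  fix x y assume xy: "x \<in> carrier M" "y \<in> carrier M" "f x = f y"
  then have "f (x \<ominus>\<^bsub>M\<^esub> y) = \<zero>\<^bsub>N\<^esub>"
    using module_hom_in[OF assms(3)] by (simp add: module_hom_diff[OF assms(1-3)] N.M.minus_eq_zero_iff)
  then show "x = y" using assms(4)[of "x \<ominus>\<^bsub>M\<^esub> y"] xy by (auto simp: M.M.minus_eq_zero_iff)
qed

lemma module_iso_comp: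
  "f \<in> module_iso R M N \<Longrightarrow> g \<in> module_iso R N P \<Longrightarrow> g \<circ> f \<in> module_iso R M P"
  by (auto simp: module_iso_def module_hom_comp intro: bij_betw_trans)

text \<open>The target inherits from the source the laws that make the inverse a homomorphism.\<close>

lemma module_iso_inv:
  assumes "left_module R M" "f \<in> module_iso R M N"
  shows "inv_into (carrier M) f \<in> module_iso R N M"
proof -
  interpret M: left_module R M by fact
  let ?g = "inv_into (carrier M) f"
  have hom: "f \<in> module_hom R M N" and bij: "bij_betw f (carrier M) (carrier N)"
    using assms by (auto simp: module_iso_def)
  have g: "?g y \<in> carrier M" "f (?g y) = y" if "y \<in> carrier N" for y
    using bij that by (auto simp: bij_betw_def inv_into_into f_inv_into_f)
  have gf: "?g (f x) = x" if "x \<in> carrier M" for x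
    using bij that by (simp add: bij_betw_def)
  have "?g \<in> module_hom R N M"
  proof (rule module_homI)
    fix x y assume "x \<in> carrier N" "y \<in> carrier N"
    then show "?g (x \<oplus>\<^bsub>N\<^esub> y) = ?g x \<oplus>\<^bsub>M\<^esub> ?g y"
      using gf[of "?g x \<oplus>\<^bsub>M\<^esub> ?g y"] g by (simp add: module_hom_add[OF hom])
  next
    fix a x assume "a \<in> carrier R" "x \<in> carrier N"
    then show "?g (a \<odot>\<^bsub>N\<^esub> x) = a \<odot>\<^bsub>M\<^esub> ?g x"
      using gf[of "a \<odot>\<^bsub>M\<^esub> ?g x"] g by (simp add: module_hom_smult[OF hom] M.smult_closed)
  qed (use g in auto)
  then show ?thesis using bij_betw_inv_into[OF bij] by (simp add: module_iso_def)
qed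

lemma modules_isomorphic_sym:
  "left_module R M \<Longrightarrow> modules_isomorphic R M N \<Longrightarrow> modules_isomorphic R N M"
  unfolding modules_isomorphic_def using module_iso_inv by blast

lemma modules_isomorphic_trans:
  "modules_isomorphic R M N \<Longrightarrow> modules_isomorphic R N P \<Longrightarrow> modules_isomorphic R M P"
  unfolding modules_isomorphic_def using module_iso_comp by blast

subsection \<open>Quotients\<close>

context left_module begin

context fixes N assumes N: "Module.submodule N R M" begin

interpretation N: abelian_subgroup N M using submodule_abelian_subgroup[OF N] .

private abbreviation "Q \<equiv> quotient_module M N"

lemma quotient_coset_eq_iff:
  assumes "x \<in> carrier M" "y \<in> carrier M"
  shows "N +>\<^bsub>M\<^esub> x = N +>\<^bsub>M\<^esub> y \<longleftrightarrow> x \<ominus>\<^bsub>M\<^esub> y \<in> N"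
proof
  assume "N +>\<^bsub>M\<^esub> x = N +>\<^bsub>M\<^esub> y"
  then have "x \<in> N +>\<^bsub>M\<^esub> y" using N.a_rcos_self[OF assms(1)] by simp
  then show "x \<ominus>\<^bsub>M\<^esub> y \<in> N" using N.a_rcos_module[of y x] assms by (simp add: a_minus_def)
next
  assume "x \<ominus>\<^bsub>M\<^esub> y \<in> N"
  then have "x \<in> N +>\<^bsub>M\<^esub> y" using N.a_rcos_module[of y x] assms by (simp add: a_minus_def)
  then show "N +>\<^bsub>M\<^esub> x = N +>\<^bsub>M\<^esub> y" using N.a_repr_independence'[of x y] assms by simp
qed

lemma quotient_carrier: "carrier Q = (\<lambda>x. N +>\<^bsub>M\<^esub> x) ` carrier M"
  by (auto simp: quotient_module_def A_RCOSETS_def' )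

lemma quotient_add:
  assumes "x \<in> carrier M" "y \<in> carrier M"
  shows "(N +>\<^bsub>M\<^esub> x) \<oplus>\<^bsub>Q\<^esub> (N +>\<^bsub>M\<^esub> y) = N +>\<^bsub>M\<^esub> (x \<oplus>\<^bsub>M\<^esub> y)"
  using N.a_rcos_sum[OF assms] by (simp add: quotient_module_def)

lemma quotient_zero: "\<zero>\<^bsub>Q\<^esub> = N +>\<^bsub>M\<^esub> \<zero>\<^bsub>M\<^esub>"
  using N.a_subset by (simp add: quotient_module_def)

lemma quotient_smult:
  assumes "a \<in> carrier R" "x \<in> carrier M"
  shows "a \<odot>\<^bsub>Q\<^esub> (N +>\<^bsub>M\<^esub> x) = N +>\<^bsub>M\<^esub> (a \<odot>\<^bsub>M\<^esub> x)"
proof -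
  have "N +>\<^bsub>M\<^esub> (a \<odot>\<^bsub>M\<^esub> y) = N +>\<^bsub>M\<^esub> (a \<odot>\<^bsub>M\<^esub> x)" if y: "y \<in> N +>\<^bsub>M\<^esub> x" for y
  proof -
    have yM: "y \<in> carrier M" using y assms M.a_r_coset_subset_G[OF N.a_subset] by blast
    have "N +>\<^bsub>M\<^esub> y = N +>\<^bsub>M\<^esub> x" using N.a_repr_independence'[OF y] assms by simp
    then have "y \<ominus>\<^bsub>M\<^esub> x \<in> N" using quotient_coset_eq_iff yM assms by simp
    then have "a \<odot>\<^bsub>M\<^esub> (y \<ominus>\<^bsub>M\<^esub> x) \<in> N" using N assms by (simp add: Module.submodule.smult_closed)
    then show ?thesis
      using quotient_coset_eq_iff[of "a \<odot>\<^bsub>M\<^esub> y" "a \<odot>\<^bsub>M\<^esub> x"] assms yM by (simp add: smult_r_diff smult_closed)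
  qed
  then have "(\<lambda>y. N +>\<^bsub>M\<^esub> (a \<odot>\<^bsub>M\<^esub> y)) ` (N +>\<^bsub>M\<^esub> x) = {N +>\<^bsub>M\<^esub> (a \<odot>\<^bsub>M\<^esub> x)}"
    using N.a_rcos_self[OF assms(2)] by (metis (no_types, lifting) image_cong image_constant)
  then show ?thesis by (simp add: quotient_module_def)
qed

lemma quotient_left_module: "left_module R Q"
proof (intro left_module.intro left_module_axioms.intro)
  show "ring R" by (rule R.ring_axioms)
  show "abelian_group Q"
  proof (rule abelian_groupI)
    fix A assume "A \<in> carrier Q"
    then obtain x where x: "x \<in> carrier M" "A = N +>\<^bsub>M\<^esub> x" by (auto simp: quotient_carrier)
    show "\<exists>B\<in>carrier Q. B \<oplus>\<^bsub>Q\<^esub> A = \<zero>\<^bsub>Q\<^esub>"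
    proof (rule bexI)
      show "(N +>\<^bsub>M\<^esub> (\<ominus>\<^bsub>M\<^esub> x)) \<oplus>\<^bsub>Q\<^esub> A = \<zero>\<^bsub>Q\<^esub>"
        using x(1) unfolding x(2) by (simp only: quotient_add M.minus_closed quotient_zero M.l_neg M.a_inv_closed)
      show "N +>\<^bsub>M\<^esub> (\<ominus>\<^bsub>M\<^esub> x) \<in> carrier Q" using x by (auto simp: quotient_carrier)
    qed
  next
    fix A B assume "A \<in> carrier Q" "B \<in> carrier Q"
    then obtain x y where x: "x \<in> carrier M" "A = N +>\<^bsub>M\<^esub> x" "y \<in> carrier M" "B = N +>\<^bsub>M\<^esub> y"
      by (auto simp: quotient_carrier)
    show "A \<oplus>\<^bsub>Q\<^esub> B = B \<oplus>\<^bsub>Q\<^esub> A"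
      using x(1,3) unfolding x(2,4) by (simp only: quotient_add M.a_comm)
    show "A \<oplus>\<^bsub>Q\<^esub> B \<in> carrier Q"
      using x(1,3) unfolding x(2,4) by (simp only: quotient_add quotient_carrier M.a_closed imageI)
  next
    fix A B C assume "A \<in> carrier Q" "B \<in> carrier Q"
      "C \<in> carrier Q"
    then obtain x y z where x: "x \<in> carrier M" "y \<in> carrier M" "z \<in> carrier M"
      "A = N +>\<^bsub>M\<^esub> x" "B = N +>\<^bsub>M\<^esub> y" "C = N +>\<^bsub>M\<^esub> z"
      by (auto simp: quotient_carrier)
    show "A \<oplus>\<^bsub>Q\<^esub> B \<oplus>\<^bsub>Q\<^esub> C
        = A \<oplus>\<^bsub>Q\<^esub> (B \<oplus>\<^bsub>Q\<^esub> C)"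
      using x(1-3) unfolding x(4-) by (simp only: quotient_add M.a_assoc M.a_closed)
  next
    fix A assume "A \<in> carrier Q"
    then obtain x where x: "x \<in> carrier M" "A = N +>\<^bsub>M\<^esub> x" by (auto simp: quotient_carrier)
    show "\<zero>\<^bsub>Q\<^esub> \<oplus>\<^bsub>Q\<^esub> A = A"
      using x(1) unfolding x(2) by (simp only: quotient_add quotient_zero M.l_zero M.zero_closed)
  qed (simp add: quotient_carrier quotient_zero)
next
  fix a A assume a: "a \<in> carrier R" and "A \<in> carrier Q"
  then obtain x where x: "x \<in> carrier M" "A = N +>\<^bsub>M\<^esub> x" by (auto simp: quotient_carrier)
  show "a \<odot>\<^bsub>Q\<^esub> A \<in> carrier Q"
    using x(1) a unfolding x(2) by (simp only: quotient_smult quotient_carrier smult_closed imageI)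
  fix b assume b: "b \<in> carrier R"
  show "(a \<oplus>\<^bsub>R\<^esub> b) \<odot>\<^bsub>Q\<^esub> A
      = a \<odot>\<^bsub>Q\<^esub> A \<oplus>\<^bsub>Q\<^esub> b \<odot>\<^bsub>Q\<^esub> A"
    using x(1) a b unfolding x(2)
    by (simp only: quotient_smult quotient_add smult_closed smult_l_distr R.a_closed)
  show "(a \<otimes>\<^bsub>R\<^esub> b) \<odot>\<^bsub>Q\<^esub> A = a \<odot>\<^bsub>Q\<^esub> (b \<odot>\<^bsub>Q\<^esub> A)"
    using x(1) a b unfolding x(2) by (simp only: quotient_smult smult_closed smult_assoc1 R.m_closed)
  fix B assume "B \<in> carrier Q"
  then obtain y where y: "y \<in> carrier M" "B = N +>\<^bsub>M\<^esub> y" by (auto simp: quotient_carrier)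
  show "a \<odot>\<^bsub>Q\<^esub> (A \<oplus>\<^bsub>Q\<^esub> B)
      = a \<odot>\<^bsub>Q\<^esub> A \<oplus>\<^bsub>Q\<^esub> a \<odot>\<^bsub>Q\<^esub> B"
    using x(1) y(1) a unfolding x(2) y(2)
    by (simp only: quotient_smult quotient_add smult_closed smult_r_distr M.a_closed)
next
  fix A assume "A \<in> carrier Q"
  then obtain x where x: "x \<in> carrier M" "A = N +>\<^bsub>M\<^esub> x" by (auto simp: quotient_carrier)
  show "\<one>\<^bsub>R\<^esub> \<odot>\<^bsub>Q\<^esub> A = A"
    using x(1) unfolding x(2) by (simp only: quotient_smult smult_one R.one_closed)
qed

lemma quotient_hom: "(\<lambda>x. N +>\<^bsub>M\<^esub> x) \<in> module_hom R M Q"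
  by (rule module_homI) (simp_all only: quotient_carrier quotient_add quotient_smult imageI)

lemma quotient_coset_zero_iff:
  assumes "x \<in> carrier M"
  shows "N +>\<^bsub>M\<^esub> x = \<zero>\<^bsub>Q\<^esub> \<longleftrightarrow> x \<in> N"
proof -
  have "x \<ominus>\<^bsub>M\<^esub> \<zero>\<^bsub>M\<^esub> = x" using assms M.minus_equality[of "\<zero>\<^bsub>M\<^esub>" "\<zero>\<^bsub>M\<^esub>"] by (simp add: a_minus_def)
  then show ?thesis using quotient_coset_eq_iff[of x "\<zero>\<^bsub>M\<^esub>"] assms by (simp add: quotient_zero)
qed

end

end

text \<open>A homomorphism is constant on the cosets of its kernel, so that a coset has a single image.\<close>

lemma hom_image_coset:
  assumes M: "left_module R M" and P: "left_module R P"
    and f: "f \<in> module_hom R M P" and x: "x \<in> carrier M"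
  shows "f ` ({x \<in> carrier M. f x = \<zero>\<^bsub>P\<^esub>} +>\<^bsub>M\<^esub> x) = {f x}"
proof -
  let ?K = "{x \<in> carrier M. f x = \<zero>\<^bsub>P\<^esub>}"
  have "f y = f x" if y: "y \<in> ?K +>\<^bsub>M\<^esub> x" for y
  proof -
    obtain z where z: "z \<in> carrier M" "f z = \<zero>\<^bsub>P\<^esub>" "y = z \<oplus>\<^bsub>M\<^esub> x"
      using y unfolding a_r_coset_def' by blast
    have "f y = f z \<oplus>\<^bsub>P\<^esub> f x" unfolding z(3) by (rule module_hom_add[OF f z(1) x])
    then show ?thesis
      using module_hom_in[OF f x] z(2) P by (simp add: abelian_monoid.l_zero left_module_def abelian_group_def)
  qed
  then show ?thesis
    using abelian_subgroup.a_rcos_self[OF left_module.submodule_abelian_subgroup[OF M kernel_submodule[OF M P f]] x]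
    by (metis (no_types, lifting) image_cong image_constant)
qed

text \<open>The isomorphism is explicit: it sends a coset to the only element of its image. The projections of
  the Baer sum and of the pushout are defined in the same way.\<close>

lemma first_isomorphism:
  assumes M: "left_module R M" and P: "left_module R P"
    and f: "f \<in> module_hom R M P" and surj: "f ` carrier M = carrier P"
  defines "K \<equiv> {x \<in> carrier M. f x = \<zero>\<^bsub>P\<^esub>}"
  shows "Module.submodule K R M" (is ?sub) "left_module R (quotient_module M K)" (is ?mod)
    "(\<lambda>Y. the_elem (f ` Y)) \<in> module_iso R (quotient_module M K) P" (is ?iso)
    "\<forall>x\<in>carrier M. the_elem (f ` (K +>\<^bsub>M\<^esub> x)) = f x" (is ?val)
proof -
  show sub: ?sub unfolding K_def by (rule kernel_submodule[OF M P f])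
  show ?mod by (rule left_module.quotient_left_module[OF M sub])
  have fP: "f x \<in> carrier P" if "x \<in> carrier M" for x using module_hom_in[OF f that] .
  have val: "the_elem (f ` (K +>\<^bsub>M\<^esub> x)) = f x" if x: "x \<in> carrier M" for x
    unfolding K_def hom_image_coset[OF M P f x] by simp
  then show ?val by blast
  note Q = left_module.quotient_carrier[OF M sub] left_module.quotient_add[OF M sub]
    left_module.quotient_smult[OF M sub]
  have closed: "x \<oplus>\<^bsub>M\<^esub> y \<in> carrier M" "x \<ominus>\<^bsub>M\<^esub> y \<in> carrier M"
    if "x \<in> carrier M" "y \<in> carrier M" for x y
    using M that by (auto simp: left_module_def abelian_group.minus_closed abelian_group_def abelian_monoid.a_closed)
  have eq: "f x = f y \<longleftrightarrow> K +>\<^bsub>M\<^esub> x = K +>\<^bsub>M\<^esub> y" if "x \<in> carrier M" "y \<in> carrier M" for x y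
  proof -
    have "K +>\<^bsub>M\<^esub> x = K +>\<^bsub>M\<^esub> y \<longleftrightarrow> f x \<ominus>\<^bsub>P\<^esub> f y = \<zero>\<^bsub>P\<^esub>"
      using left_module.quotient_coset_eq_iff[OF M sub that] module_hom_diff[OF M P f that] closed(2)[OF that]
      unfolding K_def by simp
    then show ?thesis
      using abelian_group.minus_eq_zero_iff[of P "f x" "f y"] P fP that by (simp add: left_module_def)
  qed
  show ?iso
    unfolding module_iso_def
  proof (intro CollectI conjI module_homI)
    have "inj_on (\<lambda>Y. the_elem (f ` Y)) (carrier (quotient_module M K))"
      unfolding inj_on_def Q(1) using eq val by (metis (no_types, lifting) imageE)
    moreover have "(\<lambda>Y. the_elem (f ` Y)) ` carrier (quotient_module M K) = carrier P"
      unfolding Q(1) image_image surj[symmetric] using val by (intro image_cong) simp_all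
    ultimately show "bij_betw (\<lambda>Y. the_elem (f ` Y)) (carrier (quotient_module M K)) (carrier P)"
      by (simp add: bij_betw_def)
  next
    fix A assume "A \<in> carrier (quotient_module M K)"
    then obtain x where x: "x \<in> carrier M" "A = K +>\<^bsub>M\<^esub> x" by (auto simp: Q(1))
    show "the_elem (f ` A) \<in> carrier P" unfolding x(2) val[OF x(1)] by (rule fP[OF x(1)])
    fix B assume "B \<in> carrier (quotient_module M K)"
    then obtain y where y: "y \<in> carrier M" "B = K +>\<^bsub>M\<^esub> y" by (auto simp: Q(1))
    show "the_elem (f ` (A \<oplus>\<^bsub>quotient_module M K\<^esub> B)) = the_elem (f ` A) \<oplus>\<^bsub>P\<^esub> the_elem (f ` B)"
      using x(1) y(1) unfolding x(2) y(2) by (simp only: Q(2) val closed module_hom_add[OF f])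
  next
    fix a A assume a: "a \<in> carrier R" and "A \<in> carrier (quotient_module M K)"
    then obtain x where x: "x \<in> carrier M" "A = K +>\<^bsub>M\<^esub> x" by (auto simp: Q(1))
    show "the_elem (f ` (a \<odot>\<^bsub>quotient_module M K\<^esub> A)) = a \<odot>\<^bsub>P\<^esub> the_elem (f ` A)"
      using x(1) a unfolding x(2)
      by (simp only: Q(3) val left_module.smult_closed[OF M] module_hom_smult[OF f])
  qed
qed

lemma generated_submodule_submodule:
  assumes "left_module R M" "Y \<subseteq> carrier M"
  shows "Module.submodule (generated_submodule R M Y) R M" "Y \<subseteq> generated_submodule R M Y"
proof -
  interpret left_module R M by fact
  have top: "Module.submodule (carrier M) R M" by (rule submoduleI) (auto intro: smult_closed)
  show "Y \<subseteq> generated_submodule R M Y" by (auto simp: generated_submodule_def)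
  have closed: "\<zero>\<^bsub>M\<^esub> \<in> N" "x \<in> N \<Longrightarrow> y \<in> N \<Longrightarrow> x \<oplus>\<^bsub>M\<^esub> y \<in> N"
    "a \<in> carrier R \<Longrightarrow> x \<in> N \<Longrightarrow> a \<odot>\<^bsub>M\<^esub> x \<in> N"
    if N: "Module.submodule N R M" for N x y a
    using N subgroup.one_closed[of N "add_monoid M"] subgroup.m_closed[of N "add_monoid M"]
    by (auto simp: Module.submodule_def Module.submodule_axioms_def)
  show "Module.submodule (generated_submodule R M Y) R M"
  proof (rule submoduleI)
    show "generated_submodule R M Y \<subseteq> carrier M"
      unfolding generated_submodule_def using top assms(2) by blast
  qed (unfold generated_submodule_def, (blast intro: closed)+)
qed

lemma generated_submodule_least:
  "Module.submodule N R M \<Longrightarrow> Y \<subseteq> N \<Longrightarrow> generated_submodule R M Y \<subseteq> N"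
  by (auto simp: generated_submodule_def)


section \<open>The algebra given by generators and relations\<close>

lemma ring_of_type_algebra_simps [simp]:
  "carrier ring_of_type_algebra = UNIV" "add ring_of_type_algebra = (+)"
  "monoid.mult ring_of_type_algebra = (*)" "one ring_of_type_algebra = 1" "zero ring_of_type_algebra = 0"
  by (auto simp: ring_of_type_algebra_def fun_eq_iff)

lemma ring_ring_of_type_algebra: "ring (ring_of_type_algebra :: 'a::ring_1 ring)"
proof -
  have "\<exists>y. y + x = 0" for x :: 'a by (rule exI[of _ "- x"]) simp
  then show ?thesis
    by (intro ringI abelian_groupI monoidI) (auto simp: algebra_simps)
qed

text \<open>Every word is a product of generators and every element a combination of words, hence a property
  that is closed under sums and products need only be verified on constants and generators.\<close>

lemma free_alg_induct [case_names const gen add mult]: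
  fixes a :: "'k::field free_alg"
  assumes const: "\<And>c. P (fa_const c)" and gen: "\<And>g. P (fa_gen g)"
    and add: "\<And>a b. P a \<Longrightarrow> P b \<Longrightarrow> P (a + b)" and mult: "\<And>a b. P a \<Longrightarrow> P b \<Longrightarrow> P (a * b)"
  shows "P a"
proof (induction a rule: Poly_Mapping.update_induct)
  case const
  show ?case using assms(1)[of 0] by (simp add: fa_const_def)
next
  case (update f a b)
  have word: "P (Poly_Mapping.single (Word xs) 1)" for xs
  proof (induction xs)
    case Nil
    show ?case using const[of 1] by (simp add: fa_const_def zero_word_def)
  next
    case (Cons x xs)
    have "Poly_Mapping.single (Word (x # xs)) 1 = (fa_gen x * Poly_Mapping.single (Word xs) 1 :: 'k free_alg)"
      by (simp add: fa_gen_def mult_single plus_word_def)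
    then show ?case using mult[OF gen[of x] Cons] by simp
  qed
  have "Poly_Mapping.single a b = fa_const b * Poly_Mapping.single a 1"
    by (simp add: fa_const_def mult_single)
  then have "P (Poly_Mapping.single a b)"
    using mult[OF const[of b] word[of "letters a"]] by simp
  moreover have "Poly_Mapping.update a b f = f + Poly_Mapping.single a b"
    using update(1) by (intro poly_mapping_eqI) (auto simp: lookup_update lookup_add lookup_single when_def in_keys_iff)
  ultimately show ?case using add[OF update(3)] by simp
qed

lemma dj_ideal_ideal: "ideal (dj_ideal :: 'k::field free_alg set) ring_of_type_algebra"
  unfolding dj_ideal_def by (rule ring.genideal_ideal[OF ring_ring_of_type_algebra]) simp

lemma ring_DJ: "ring (DJ :: 'k::field dj ring)"
  unfolding DJ_def by (rule ideal.quotient_is_ring[OF dj_ideal_ideal])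

lemma dj_elem_hom: "(dj_elem :: 'k::field free_alg \<Rightarrow> 'k dj) \<in> ring_hom ring_of_type_algebra DJ"
  using ideal.rcos_ring_hom[OF dj_ideal_ideal] unfolding DJ_def dj_elem_def[abs_def] by simp

lemma dj_elem_simps:
  fixes a b :: "'k::field free_alg"
  shows
  "dj_elem (a + b) = dj_elem a \<oplus>\<^bsub>DJ\<^esub> dj_elem b" "dj_elem (a * b) = dj_elem a \<otimes>\<^bsub>DJ\<^esub> dj_elem b"
  "dj_elem (1 :: 'k free_alg) = \<one>\<^bsub>DJ\<^esub>" "dj_elem a \<in> carrier DJ"
  using dj_elem_hom[where 'k='k] unfolding ring_hom_def Pi_def by simp_all

lemma carrier_DJ: "carrier (DJ :: 'k::field dj ring) = range dj_elem"
  by (auto simp: DJ_def FactRing_def A_RCOSETS_def' dj_elem_def)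

lemma dj_elem_eqI:
  fixes a b :: "'k::field free_alg"
  assumes "a - b \<in> dj_relators" shows "dj_elem a = dj_elem b"
proof -
  interpret ideal "dj_ideal :: 'k free_alg set" ring_of_type_algebra by (rule dj_ideal_ideal)
  have m: "\<ominus>\<^bsub>ring_of_type_algebra\<^esub> b = - b"
    by (rule minus_equality) auto
  have "a - b \<in> dj_ideal"
    unfolding dj_ideal_def using assms ring.genideal_self[OF ring_ring_of_type_algebra, of dj_relators] by auto
  then have "a \<in> dj_ideal +>\<^bsub>ring_of_type_algebra\<^esub> b"
    using a_rcos_module[of b a] m by simp
  then show ?thesis unfolding dj_elem_def using a_repr_independence'[of a b] by simp
qed

subsection \<open>Modules over the double of the Jordan plane\<close>

text \<open>All computations in a module take place through the free algebra: \<open>act\<close> is the action of its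
  elements, \<open>gact\<close> and \<open>cact\<close> are those of its generators and of the field.\<close>

abbreviation act :: "('k::field dj, 'a) module \<Rightarrow> 'k free_alg \<Rightarrow> 'a \<Rightarrow> 'a"
  where "act T a t \<equiv> dj_elem a \<odot>\<^bsub>T\<^esub> t"

abbreviation gact :: "('k::field dj, 'a) module \<Rightarrow> dj_gen \<Rightarrow> 'a \<Rightarrow> 'a"
  where "gact T a t \<equiv> dj_gen_elem a \<odot>\<^bsub>T\<^esub> t"

abbreviation cact :: "('k::field dj, 'a) module \<Rightarrow> 'k \<Rightarrow> 'a \<Rightarrow> 'a"
  where "cact T c t \<equiv> dj_const c \<odot>\<^bsub>T\<^esub> t"

text \<open>The elements that commute with \<open>f\<close> form a subalgebra, which is everything once it contains the
  generators.\<close>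

lemma dj_module_homI:
  fixes M :: "('k::field dj, 'a) module" and N :: "('k dj, 'b) module"
  assumes M: "left_module DJ M" and N: "left_module DJ N"
    and closed: "\<And>x. x \<in> carrier M \<Longrightarrow> f x \<in> carrier N"
    and add: "\<And>x y. x \<in> carrier M \<Longrightarrow> y \<in> carrier M \<Longrightarrow> f (x \<oplus>\<^bsub>M\<^esub> y) = f x \<oplus>\<^bsub>N\<^esub> f y"
    and const: "\<And>c x. x \<in> carrier M \<Longrightarrow> f (cact M c x) = cact N c (f x)"
    and gen: "\<And>g x. x \<in> carrier M \<Longrightarrow> f (gact M g x) = gact N g (f x)"
  shows "f \<in> module_hom DJ M N"
proof (rule module_homI)
  interpret M: left_module DJ M by fact
  interpret N: left_module DJ N by fact
  fix A :: "'k dj" and x assume "A \<in> carrier DJ" and x: "x \<in> carrier M"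
  then obtain a where A: "A = dj_elem a" by (auto simp: carrier_DJ)
  have "\<forall>x\<in>carrier M. f (act M a x) = act N a (f x)"
  proof (induction a rule: free_alg_induct)
    case (const c)
    then show ?case using assms(5) by (simp add: dj_const_def)
  next
    case (gen g)
    then show ?case using assms(6) by (simp add: dj_gen_elem_def)
  next
    case (add a b)
    then show ?case
      by (simp add: dj_elem_simps M.smult_l_distr N.smult_l_distr closed assms(4) M.smult_closed)
  next
    case (mult a b)
    then show ?case
      by (simp add: dj_elem_simps M.smult_assoc1 N.smult_assoc1 closed M.smult_closed)
  qed
  then show "f (A \<odot>\<^bsub>M\<^esub> x) = A \<odot>\<^bsub>N\<^esub> f x" using x by (simp add: A)
qed (use closed add in auto)

subsection \<open>Modules from operators\<close>

text \<open>One operator for each generator on a vector space defines a module over the free algebra. Linearity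
  is only required on the subspace \<open>C\<close>, because the operators of interest are given by formulas that
  also make sense, but satisfy fewer relations, outside of it.\<close>

locale dj_operators =
  fixes C :: "'v::ab_group_add set" and scale :: "'k::field \<Rightarrow> 'v \<Rightarrow> 'v" and \<rho> :: "dj_gen \<Rightarrow> 'v \<Rightarrow> 'v"
  assumes C_0: "0 \<in> C" and C_add: "x \<in> C \<Longrightarrow> y \<in> C \<Longrightarrow> x + y \<in> C" and C_scale: "x \<in> C \<Longrightarrow> scale c x \<in> C"
    and scale_add: "scale c (x + y) = scale c x + scale c y"
    and scale_add_left: "scale (c + d) x = scale c x + scale d x"
    and scale_scale: "scale c (scale d x) = scale (c * d) x"
    and scale_1: "scale 1 x = x"
    and \<rho>_C: "x \<in> C \<Longrightarrow> \<rho> g x \<in> C"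
    and \<rho>_add: "x \<in> C \<Longrightarrow> y \<in> C \<Longrightarrow> \<rho> g (x + y) = \<rho> g x + \<rho> g y"
    and \<rho>_scale: "x \<in> C \<Longrightarrow> \<rho> g (scale c x) = scale c (\<rho> g x)"
begin

definition free_act :: "'k free_alg \<Rightarrow> 'v \<Rightarrow> 'v"
  where "free_act a x = (\<Sum>b\<in>Poly_Mapping.keys a. scale (Poly_Mapping.lookup a b) (foldr \<rho> (letters b) x))"

lemma scale_0_left [simp]: "scale 0 x = 0" using scale_add_left[of 0 0 x] by simp
lemma scale_0_right [simp]: "scale c 0 = 0" using scale_add[of c 0 0] by simp
lemma scale_uminus: "scale (- 1) x = - x"
  using scale_add_left[of "- 1" 1 x] by (simp add: scale_1 eq_neg_iff_add_eq_0)
lemma scale_sum: "scale c (sum f B) = (\<Sum>b\<in>B. scale c (f b))"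
  by (induction B rule: infinite_finite_induct) (auto simp: scale_add)
lemma C_uminus: "x \<in> C \<Longrightarrow> - x \<in> C" using C_scale[of x "- 1"] by (simp add: scale_uminus)
lemma C_sum: "(\<And>b. b \<in> B \<Longrightarrow> f b \<in> C) \<Longrightarrow> sum f B \<in> C"
  by (induction B rule: infinite_finite_induct) (auto simp: C_0 C_add)

lemma word_C: "x \<in> C \<Longrightarrow> foldr \<rho> w x \<in> C"
  by (induction w) (auto simp: \<rho>_C)
lemma word_add: "x \<in> C \<Longrightarrow> y \<in> C \<Longrightarrow> foldr \<rho> w (x + y) = foldr \<rho> w x + foldr \<rho> w y"
  by (induction w) (auto simp: \<rho>_add word_C)
lemma word_scale: "x \<in> C \<Longrightarrow> foldr \<rho> w (scale c x) = scale c (foldr \<rho> w x)"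
  by (induction w) (auto simp: \<rho>_scale word_C)

lemma free_act_superset:
  assumes "finite B" "Poly_Mapping.keys a \<subseteq> B"
  shows "free_act a x = (\<Sum>b\<in>B. scale (Poly_Mapping.lookup a b) (foldr \<rho> (letters b) x))"
  unfolding free_act_def using assms by (intro sum.mono_neutral_left) (auto simp: in_keys_iff)

lemma free_act_C: "x \<in> C \<Longrightarrow> free_act a x \<in> C"
  unfolding free_act_def by (intro C_sum C_scale word_C)

lemma free_act_add_left: "free_act (a + b) x = free_act a x + free_act b x"
proof -
  let ?B = "Poly_Mapping.keys a \<union> Poly_Mapping.keys b"
  show ?thesis
    using free_act_superset[of ?B a x] free_act_superset[of ?B b x] free_act_superset[of ?B "a + b" x]
      Poly_Mapping.keys_add[of a b]
    by (simp add: sum.distrib[symmetric] lookup_add scale_add_left)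
qed

lemma free_act_single: "free_act (Poly_Mapping.single w c) x = scale c (foldr \<rho> (letters w) x)"
  using free_act_superset[of "{w}" "Poly_Mapping.single w c" x] by simp

lemma free_act_0 [simp]: "free_act 0 x = 0" by (simp add: free_act_def)

lemma free_act_add: "x \<in> C \<Longrightarrow> y \<in> C \<Longrightarrow> free_act a (x + y) = free_act a x + free_act a y"
  by (simp add: free_act_def word_add scale_add sum.distrib)

lemma free_act_scale: "x \<in> C \<Longrightarrow> free_act a (scale c x) = scale c (free_act a x)"
  by (simp add: free_act_def word_scale scale_sum scale_scale mult.commute)

lemma free_act_uminus: "free_act (- a) x = - free_act a x"
  using free_act_add_left[of a "- a" x] by (simp add: eq_neg_iff_add_eq_0 add.commute)

lemma free_act_diff: "free_act (a - b) x = free_act a x - free_act b x"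
  using free_act_add_left[of a "- b" x] by (simp add: free_act_uminus)

lemma update_eq_add:
  "w \<notin> Poly_Mapping.keys (f :: 'k free_alg) \<Longrightarrow> Poly_Mapping.update w c f = f + Poly_Mapping.single w c"
  by (intro poly_mapping_eqI) (auto simp: lookup_update lookup_add lookup_single when_def in_keys_iff)

lemma free_act_mult:
  assumes x: "x \<in> C" shows "free_act (a * b) x = free_act a (free_act b x)"
proof (induction a rule: Poly_Mapping.update_induct)
  case (update f w c)
  have "free_act (Poly_Mapping.single w c * b) x = scale c (foldr \<rho> (letters w) (free_act b x))"
  proof (induction b rule: Poly_Mapping.update_induct)
    case const
    show ?case using word_scale[OF C_0, of "letters w" 0] by simp
  next
    case (update h v d)
    then show ?case using x
      by (simp add: update_eq_add free_act_add_left free_act_C free_act_single mult_single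
          distrib_left word_add word_scale word_C C_scale scale_add scale_scale plus_word_def)
  qed
  with update show ?case
    by (simp add: update_eq_add free_act_add_left free_act_single distrib_right)
qed simp

lemma free_act_gen: "free_act (fa_gen g) x = \<rho> g x"
  by (simp add: fa_gen_def free_act_single scale_1)

lemma free_act_const: "free_act (fa_const c) x = scale c x"
  by (simp add: fa_const_def free_act_single zero_word_def)

lemma free_act_1: "free_act 1 x = x"
  using free_act_const[of 1 x] by (simp add: fa_const_def scale_1)

text \<open>This has the shape of the definition of \<open>L n\<close>, so that \<open>L n\<close> is an instance.\<close>

definition op_module :: "('k dj, 'v) module"
  where "op_module = \<lparr>carrier = C, monoid.mult = undefined, one = undefined, zero = 0, add = (+),
     module.smult = (\<lambda>A x. the_elem ((\<lambda>a. free_act a x) ` A))\<rparr>"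

end

locale dj_representation = dj_operators +
  assumes relators: "a \<in> dj_relators \<Longrightarrow> x \<in> C \<Longrightarrow> free_act a x = 0"
begin

text \<open>The elements that annihilate \<open>C\<close> form a two-sided ideal, so they contain the ideal generated by the
  relators.\<close>

lemma ideal_acts_zero:
  assumes "a \<in> dj_ideal" "x \<in> C" shows "free_act a x = 0"
proof -
  let ?I = "{a. \<forall>x\<in>C. free_act a x = 0}"
  have "subgroup ?I (add_monoid ring_of_type_algebra)"
  proof (rule group.subgroupI)
    show "group (add_monoid (ring_of_type_algebra :: 'b free_alg ring))"
      using abelian_group.a_group[OF ring.is_abelian_group[OF ring_ring_of_type_algebra]] .
    fix a assume a: "a \<in> ?I"
    have "inv\<^bsub>add_monoid ring_of_type_algebra\<^esub> a = - a"
      using abelian_group.minus_equality[OF ring.is_abelian_group[OF ring_ring_of_type_algebra], of "-a" a]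
      by (simp add: a_inv_def)
    then show "inv\<^bsub>add_monoid ring_of_type_algebra\<^esub> a \<in> ?I" using a by (simp add: free_act_uminus)
  qed (auto simp: free_act_add_left intro: exI[of _ 0])
  then have "ideal ?I ring_of_type_algebra"
    using free_act_scale[OF C_0, of _ 0]
    by (intro idealI ring_ring_of_type_algebra) (auto simp: free_act_mult free_act_C)
  moreover have "dj_relators \<subseteq> ?I" using relators by auto
  ultimately have "dj_ideal \<subseteq> ?I"
    unfolding dj_ideal_def by (rule ring.genideal_minimal[OF ring_ring_of_type_algebra])
  then show ?thesis using assms by auto
qed

lemma op_module_act:
  assumes "x \<in> C" shows "act op_module a x = free_act a x"
proof -
  interpret ideal "dj_ideal :: 'b free_alg set" ring_of_type_algebra by (rule dj_ideal_ideal)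
  have "free_act b x = free_act a x" if "b \<in> dj_elem a" for b
    using that assms ideal_acts_zero by (auto simp: dj_elem_def a_r_coset_def' free_act_add_left)
  moreover have "a \<in> dj_elem a" unfolding dj_elem_def by (rule a_rcos_self) simp
  ultimately have "(\<lambda>a. free_act a x) ` dj_elem a = {free_act a x}"
    by (metis (no_types, lifting) image_cong image_constant)
  then show ?thesis by (simp add: op_module_def)
qed

lemma op_module_left_module: "left_module DJ op_module"
proof (intro left_module.intro left_module_axioms.intro ring_DJ)
  show "abelian_group op_module"
    by (rule abelian_groupI) (auto simp: op_module_def C_0 C_add add.assoc add.commute
        intro!: bexI[of _ "- x" for x] C_uminus)
next
  fix A x assume "A \<in> carrier (DJ :: 'b dj ring)" and "x \<in> carrier op_module"
  then obtain a where A: "A = dj_elem a" and x: "x \<in> C" by (auto simp: carrier_DJ op_module_def)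
  show "A \<odot>\<^bsub>op_module\<^esub> x \<in> carrier op_module"
    using free_act_C[OF x, of a] unfolding A op_module_act[OF x] by (simp add: op_module_def)
  fix y assume "y \<in> carrier op_module"
  then have y: "y \<in> C" by (simp add: op_module_def)
  have "x \<oplus>\<^bsub>op_module\<^esub> y = x + y" for x y by (simp add: op_module_def)
  then show "A \<odot>\<^bsub>op_module\<^esub> (x \<oplus>\<^bsub>op_module\<^esub> y) = A \<odot>\<^bsub>op_module\<^esub> x \<oplus>\<^bsub>op_module\<^esub> A \<odot>\<^bsub>op_module\<^esub> y"
    using x y by (simp add: A op_module_act C_add free_act_add)
next
  fix A B x assume "A \<in> carrier (DJ :: 'b dj ring)" "B \<in> carrier (DJ :: 'b dj ring)" "x \<in> carrier op_module"
  then obtain a b where A: "A = dj_elem a" "B = dj_elem b" and x: "x \<in> C"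
    by (auto simp: carrier_DJ op_module_def)
  have add: "x \<oplus>\<^bsub>op_module\<^esub> y = x + y" for x y by (simp add: op_module_def)
  show "(A \<oplus>\<^bsub>DJ\<^esub> B) \<odot>\<^bsub>op_module\<^esub> x = A \<odot>\<^bsub>op_module\<^esub> x \<oplus>\<^bsub>op_module\<^esub> B \<odot>\<^bsub>op_module\<^esub> x"
    using x by (simp add: A add dj_elem_simps(1)[symmetric] op_module_act free_act_add_left)
  show "(A \<otimes>\<^bsub>DJ\<^esub> B) \<odot>\<^bsub>op_module\<^esub> x = A \<odot>\<^bsub>op_module\<^esub> (B \<odot>\<^bsub>op_module\<^esub> x)"
    using x by (simp add: A dj_elem_simps(2)[symmetric] op_module_act free_act_mult free_act_C)
next
  fix x assume "x \<in> carrier op_module"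
  then show "\<one>\<^bsub>DJ\<^esub> \<odot>\<^bsub>op_module\<^esub> x = x"
    by (simp add: dj_elem_simps(3)[symmetric] op_module_act free_act_1 op_module_def[THEN arg_cong[of _ _ carrier]])
qed

lemma op_module_gact: "x \<in> C \<Longrightarrow> gact op_module g x = \<rho> g x"
  by (simp add: dj_gen_elem_def op_module_act free_act_gen)

lemma op_module_cact: "x \<in> C \<Longrightarrow> cact op_module c x = scale c x"
  by (simp add: dj_const_def op_module_act free_act_const)

end

section \<open>Verma modules and their self-extensions\<close>

type_synonym 'k fpair = "(nat \<Rightarrow> 'k) \<times> (nat \<Rightarrow> 'k)"

text \<open>Sequences are read as coefficients: \<open>f\<close> stands for the formal sum of the \<open>f i\<close> times \<open>y\<^sup>i s\<close>, and
  \<open>shift\<close> is multiplication by \<open>y\<close>.\<close>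

definition shift :: "(nat \<Rightarrow> 'k::zero) \<Rightarrow> nat \<Rightarrow> 'k"
  where "shift f i = (case i of 0 \<Rightarrow> 0 | Suc j \<Rightarrow> f j)"

text \<open>The (completed) Verma module of highest weight \<open>n\<close>, on which \<open>y\<close> acts freely. Its quotient by the
  vectors from degree \<open>n + 1\<close> on is \<open>L n\<close>. Working before truncation removes the case distinction
  at the top degree from all relations.\<close>

fun verma :: "nat \<Rightarrow> dj_gen \<Rightarrow> (nat \<Rightarrow> 'k::field) \<Rightarrow> (nat \<Rightarrow> 'k)" where
  "verma n Gxi f = (\<lambda>i. (of_nat n - 2 * of_nat i) * f i)"
| "verma n Gv f = (\<lambda>i. of_nat (Suc i) * (of_nat n - of_nat i) / 2 * f (Suc i))"
| "verma n Gy f = shift f"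
| "verma n Gx f = (\<lambda>i. 0)"
| "verma n Gu f = (\<lambda>i. 0)"
| "verma n Gg f = f"
| "verma n Gginv f = f"

text \<open>The off-diagonal part of a self-extension of the Verma module. With \<open>\<epsilon>\<close> the nilpotent endomorphism
  that sends \<open>w\<close> to \<open>s\<close>, and \<open>\<partial>\<close> the operator with \<open>\<partial> y\<^sup>i = i y\<^sup>i\<^sup>-\<^sup>1\<close>, the generators act as \<open>x = \<gamma> \<epsilon> y\<close>,
  \<open>g = 1 + \<epsilon> (\<alpha> - \<gamma>/2 H)\<close>, \<open>\<xi> = H + \<epsilon> \<mu>\<close> and \<open>u = \<epsilon> (\<gamma> V - \<alpha> \<partial>)\<close>, where \<open>H\<close> and \<open>V\<close> are the actions
  of \<open>\<xi>\<close> and \<open>v\<close> on the Verma module. The value at \<open>v\<close> is the solution of the recursion that the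
  relation between \<open>v\<close> and \<open>y\<close> imposes, starting from \<open>v w = 0\<close>. The argument \<open>al\<close> is \<open>\<alpha>\<close>, and \<open>g w = w + \<lambda> s\<close>
  corresponds to \<open>\<alpha> = \<lambda> + n/2 \<gamma>\<close>.\<close>

fun cocycle :: "nat \<Rightarrow> 'k \<Rightarrow> 'k \<Rightarrow> 'k \<Rightarrow> dj_gen \<Rightarrow> (nat \<Rightarrow> 'k::field) \<Rightarrow> (nat \<Rightarrow> 'k)" where
  "cocycle n al mu gam Gxi a = (\<lambda>i. mu * a i)"
| "cocycle n al mu gam Gg a = (\<lambda>i. (al - gam / 2 * (of_nat n - 2 * of_nat i)) * a i)"
| "cocycle n al mu gam Gginv a = (\<lambda>i. - (al - gam / 2 * (of_nat n - 2 * of_nat i)) * a i)"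
| "cocycle n al mu gam Gx a = (\<lambda>i. gam * shift a i)"
| "cocycle n al mu gam Gu a = (\<lambda>i. gam * verma n Gv a i - al * of_nat (Suc i) * a (Suc i))"
| "cocycle n al mu gam Gv a = (\<lambda>i. - (gam / 2) * (of_nat n - 2 * of_nat i) * verma n Gv a i
      + ((al * of_nat n + mu) / 2 * of_nat (Suc i) - al * of_nat (Suc i) * of_nat i) * a (Suc i))"
| "cocycle n al mu gam Gy a = (\<lambda>i. 0)"

definition verma_ext ::
  "nat \<Rightarrow> 'k \<Rightarrow> 'k \<Rightarrow> 'k \<Rightarrow> dj_gen \<Rightarrow> 'k::field fpair \<Rightarrow> 'k fpair"
  where "verma_ext n al mu gam g m = (verma n g (fst m) + cocycle n al mu gam g (snd m), verma n g (snd m))"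

definition scale1 :: "'k::field \<Rightarrow> (nat \<Rightarrow> 'k) \<Rightarrow> (nat \<Rightarrow> 'k)"
  where "scale1 c f = (\<lambda>i. c * f i)"

definition scale2 :: "'k::field \<Rightarrow> 'k fpair \<Rightarrow> 'k fpair"
  where "scale2 c m = (scale1 c (fst m), scale1 c (snd m))"

lemma shift_simps [simp]: "shift f 0 = 0" "shift f (Suc i) = f i"
  by (simp_all add: shift_def)

lemma shift_linear: "shift (f + h) = shift f + shift h" "shift (scale1 c f) = scale1 c (shift f)"
  for f :: "nat \<Rightarrow> 'k::field"
  by (auto simp: shift_def scale1_def fun_eq_iff split: nat.split)

lemma verma_add: "verma n g (f + h) = verma n g f + verma n g h"
  by (cases g) (simp_all add: shift_linear fun_eq_iff distrib_left add_divide_distrib)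

lemma verma_scale1: "verma n g (scale1 c f) = scale1 c (verma n g f)"
  by (cases g) (simp_all add: shift_linear, simp_all add: scale1_def fun_eq_iff mult.left_commute)

lemma cocycle_add:
  "cocycle n al mu gam g (f + h) = cocycle n al mu gam g f + cocycle n al mu gam g h"
  by (cases g) (simp_all del: verma.simps add: verma_add shift_linear fun_eq_iff distrib_left)

lemma cocycle_scale1:
  "cocycle n al mu gam g (scale1 c f) = scale1 c (cocycle n al mu gam g f)"
  by (cases g) (simp_all del: verma.simps add: verma_scale1 shift_linear,
    simp_all del: verma.simps add: scale1_def fun_eq_iff right_diff_distrib distrib_left mult.left_commute)

lemmas verma_linear = verma_add verma_scale1
lemmas cocycle_linear = cocycle_add cocycle_scale1

lemma scale1_add: "scale1 c (f + h) = scale1 c f + scale1 c h"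
  by (auto simp: scale1_def fun_eq_iff algebra_simps)

lemma verma_ext_linear:
  "verma_ext n al mu gam g (m + m') = verma_ext n al mu gam g m + verma_ext n al mu gam g m'"
  "verma_ext n al mu gam g (scale2 c m) = scale2 c (verma_ext n al mu gam g m)"
  by (simp_all add: verma_ext_def scale2_def verma_linear cocycle_linear scale1_add)

lemma pair_fun_eqI: "(\<And>i. fst m i = fst m' i) \<Longrightarrow> (\<And>i. snd m i = snd m' i) \<Longrightarrow> m = m'"
  by (simp add: prod_eq_iff fun_eq_iff)

text \<open>For arbitrary parameters only the relations that move a generator past \<open>y\<close> are needed, since
  these determine the action on the vectors \<open>y\<^sup>i s\<close> and \<open>y\<^sup>i w\<close>; the other conclusions are used to
  reach \<open>g\<^sup>-\<^sup>1\<close> and to see that \<open>x\<close> has square zero.\<close>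

lemma verma_ext_y_relations:
  fixes al mu gam :: "'k::field_char_0" and n :: nat
  defines "\<rho> \<equiv> verma_ext n al mu gam"
  shows "\<rho> Gx (\<rho> Gy m) = \<rho> Gy (\<rho> Gx m) + scale2 (1/2) (\<rho> Gx (\<rho> Gx m))"
    "\<rho> Gg (\<rho> Gy m) = \<rho> Gy (\<rho> Gg m) + \<rho> Gx (\<rho> Gg m)"
    "\<rho> Gxi (\<rho> Gy m) = \<rho> Gy (\<rho> Gxi m) + scale2 (-2) (\<rho> Gy m)"
    "\<rho> Gu (\<rho> Gy m) = \<rho> Gy (\<rho> Gu m) + (m + scale2 (-1) (\<rho> Gg m))"
    "\<rho> Gv (\<rho> Gy m) = \<rho> Gy (\<rho> Gv m) + scale2 (1/2) (\<rho> Gg (\<rho> Gxi m)) + \<rho> Gy (\<rho> Gu m)"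
    "\<rho> Gg (\<rho> Gginv m) = m"
    "\<rho> Gx (\<rho> Gx m) = 0"
  unfolding \<rho>_def
  by (rule pair_fun_eqI; case_tac i; simp add: verma_ext_def scale2_def scale1_def field_simps)+

subsection \<open>The modules \<open>L(n)\<close> and the model of \<open>S_gamma(n)\<close>\<close>

definition trunc :: "nat \<Rightarrow> (nat \<Rightarrow> 'k::zero) \<Rightarrow> (nat \<Rightarrow> 'k)"
  where "trunc n f = (\<lambda>i. if i \<le> n then f i else 0)"

definition supp :: "nat \<Rightarrow> (nat \<Rightarrow> 'k::zero) set"
  where "supp n = {f. \<forall>i>n. f i = 0}"

text \<open>The finite-dimensional model, \<open>L n\<close> with scalars extended to the dual numbers, on which
  \<open>x = \<gamma> \<epsilon> y\<close>, \<open>u = \<gamma> \<epsilon> v\<close> and \<open>g = 1 - \<gamma>/2 \<epsilon> \<xi>\<close>. It is the truncation of \<open>verma_ext\<close> at the parameters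
  \<open>\<alpha> = \<mu> = 0\<close>.\<close>

definition ext_gen_action ::
  "nat \<Rightarrow> 'k \<Rightarrow> dj_gen \<Rightarrow> 'k::field fpair \<Rightarrow> 'k fpair"
  where "ext_gen_action n gam g m = map_prod (trunc n) (trunc n) (verma_ext n 0 0 gam g m)"

text \<open>Inside \<open>supp n\<close> the matrices that define \<open>L n\<close> are the truncated Verma operators.\<close>

lemma L_gen_action_eq:
  fixes f :: "nat \<Rightarrow> 'k::field"
  assumes f: "f \<in> supp n" shows "L_gen_action n g f = trunc n (verma n g f)"
proof
  fix j
  have delta: "(\<Sum>i\<le>n. f i * (h i * zvec n i j)) = (if j \<le> n then f j * h j else 0)" for h
  proof -
    have "(\<Sum>i\<le>n. f i * (h i * zvec n i j)) = (\<Sum>i\<le>n. if i = j then f i * h i else 0)"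
      by (intro sum.cong) (auto simp: zvec_def)
    then show ?thesis by (simp add: sum.delta)
  qed
  show "L_gen_action n g f j = trunc n (verma n g f) j"
  proof (cases g)
    case Gv
    have "(\<Sum>i\<le>n. f i * (of_nat i * (of_nat n - of_nat i + 1) / 2 * zvec n (i - 1) j))
        = (\<Sum>i\<le>n. if i = Suc j then f i * (of_nat i * (of_nat n - of_nat i + 1) / 2) else 0)"
    proof (rule sum.cong)
      fix i assume "i \<in> {..n}"
      then show "f i * (of_nat i * (of_nat n - of_nat i + 1) / 2 * zvec n (i - 1) j)
          = (if i = Suc j then f i * (of_nat i * (of_nat n - of_nat i + 1) / 2) else 0)"
        by (cases i) (auto simp: zvec_def)
    qed simp
    also have "\<dots> = (if Suc j \<le> n then f (Suc j) * (of_nat (Suc j) * (of_nat n - of_nat (Suc j) + 1) / 2) else 0)"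
      by (simp add: sum.delta)
    also have "\<dots> = trunc n (verma n g f) j"
      using Gv f by (auto simp: trunc_def supp_def)
    finally show ?thesis using Gv by (simp add: L_gen_action_def)
  next
    case Gy
    have "(\<Sum>i\<le>n. f i * zvec n (i + 1) j) = (\<Sum>i\<le>n. if j = Suc i \<and> Suc i \<le> n then f i else 0)"
      by (intro sum.cong) (auto simp: zvec_def)
    also have "\<dots> = trunc n (shift f) j"
    proof (cases j)
      case (Suc k)
      have "(\<Sum>i\<le>n. if j = Suc i \<and> Suc i \<le> n then f i else 0) = (\<Sum>i\<le>n. if i = k then (if Suc k \<le> n then f i else 0) else 0)"
        by (intro sum.cong) (auto simp: Suc)
      then show ?thesis by (simp add: Suc trunc_def sum.delta)
    qed (simp add: trunc_def)
    finally show ?thesis using Gy by (simp add: L_gen_action_def)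
  qed (use delta[of "\<lambda>i. 1"] delta[of "\<lambda>i. of_nat n - 2 * of_nat i"] in
      \<open>simp_all add: L_gen_action_def trunc_def mult.commute\<close>)
qed

lemma trunc_in_supp [simp]: "trunc n f \<in> supp n" by (simp add: trunc_def supp_def)
lemma trunc_id: "f \<in> supp n \<Longrightarrow> trunc n f = f"
  by (auto simp: trunc_def supp_def fun_eq_iff not_le)
lemma trunc_linear: "trunc n (f + h) = trunc n f + trunc n h" "trunc n (scale1 c f) = scale1 c (trunc n f)"
  for f :: "nat \<Rightarrow> 'k::field"
  by (auto simp: trunc_def scale1_def fun_eq_iff)
lemma supp_closed: "0 \<in> supp n" "f \<in> supp n \<Longrightarrow> h \<in> supp n \<Longrightarrow> f + h \<in> supp n" "f \<in> supp n \<Longrightarrow> scale1 c f \<in> supp n"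
  for f :: "nat \<Rightarrow> 'k::field"
  by (auto simp: supp_def scale1_def)


lemma (in dj_operators) free_act_2: "free_act 2 x = scale 2 x"
  using free_act_add_left[of 1 1 x] scale_add_left[of 1 1 x] by (simp add: free_act_1 scale_1)

lemma verma_ext_representation:
  "dj_representation UNIV scale2 (verma_ext n 0 0 (gam :: 'k::field_char_0))"
proof -
  interpret dj_operators UNIV scale2 "verma_ext n 0 0 gam"
    by unfold_locales (simp_all add: verma_ext_linear,
      simp_all add: scale2_def scale1_def prod_eq_iff fun_eq_iff algebra_simps)
  show ?thesis
  proof
    fix a :: "'k free_alg" and m :: "'k fpair" assume a: "a \<in> dj_relators"
    show "free_act a m = 0"
    proof (rule pair_fun_eqI)
      fix i
      show "fst (free_act a m) i = fst 0 i"
        using a unfolding dj_relators_def Let_def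
        by (simp only: insert_iff empty_iff HOL.simp_thms)
          (elim disjE; cases i; simp add: free_act_diff free_act_add_left free_act_mult
            power2_eq_square free_act_gen free_act_const free_act_1 free_act_2
            verma_ext_def scale2_def scale1_def; simp add: field_simps)
      show "snd (free_act a m) i = snd 0 i"
        using a unfolding dj_relators_def Let_def
        by (simp only: insert_iff empty_iff HOL.simp_thms)
          (elim disjE; cases i; simp add: free_act_diff free_act_add_left free_act_mult
            power2_eq_square free_act_gen free_act_const free_act_1 free_act_2
            verma_ext_def scale2_def scale1_def; simp add: field_simps)
    qed
  qed
qed

text \<open>A surjective map that intertwines two families of operators carries the relations over. Thus the
  seventeen relations are only computed once, on the Verma side, and pass to the model and to \<open>L n\<close>.\<close>

lemma representation_transfer:
  assumes "dj_representation C scale \<rho>" and "dj_operators C' scale' \<rho>'"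
    and surj: "f ` C = C'"
    and add: "\<And>x y. x \<in> C \<Longrightarrow> y \<in> C \<Longrightarrow> f (x + y) = f x + f y"
    and scale: "\<And>c x. x \<in> C \<Longrightarrow> f (scale c x) = scale' c (f x)"
    and gen: "\<And>g x. x \<in> C \<Longrightarrow> f (\<rho> g x) = \<rho>' g (f x)"
  shows "dj_representation C' scale' \<rho>'"
proof -
  interpret V: dj_representation C scale \<rho> by fact
  interpret W: dj_operators C' scale' \<rho>' by fact
  have zero: "f 0 = 0" using add[OF V.C_0 V.C_0] by simp
  have "\<forall>x\<in>C. f (V.free_act a x) = W.free_act a (f x)" for a
  proof (induction a rule: free_alg_induct)
    case (mult a b)
    then show ?case using surj by (auto simp: V.free_act_mult W.free_act_mult V.free_act_C)
  qed (use surj in \<open>auto simp: V.free_act_const W.free_act_const V.free_act_gen W.free_act_gen scale gen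
      V.free_act_add_left W.free_act_add_left add V.free_act_C\<close>)
  then have hom: "f (V.free_act a x) = W.free_act a (f x)" if "x \<in> C" for a x using that by blast
  have "W.free_act a y = 0" if "a \<in> dj_relators" and y: "y \<in> C'" for a y
  proof -
    from y surj obtain x where "x \<in> C" "y = f x" by blast
    then show ?thesis using V.relators[OF that(1)] hom[of x a] zero by simp
  qed
  then show ?thesis by (intro dj_representation.intro dj_representation_axioms.intro assms(2))
qed

text \<open>The only operator that leads from degree \<open>n + 1\<close> back to degree \<open>n\<close> is \<open>v\<close>, and its coefficient
  \<open>(i + 1) (n - i) / 2\<close> vanishes at \<open>i = n\<close>. So the vectors of degree above \<open>n\<close> form a submodule.\<close>

lemma trunc_verma: "trunc n (verma n g (trunc n f)) = trunc n (verma n g f)"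
proof
  fix i
  show "trunc n (verma n g (trunc n f)) i = trunc n (verma n g f) i"
    by (cases "i = n"; cases g; cases i) (auto simp: trunc_def shift_def split: nat.split)
qed

text \<open>At \<open>\<alpha> = \<mu> = 0\<close> the off-diagonal parts of \<open>u\<close> and \<open>v\<close> are multiples of \<open>v\<close>, so the same
  coefficient vanishes.\<close>

lemma trunc_cocycle: "trunc n (cocycle n 0 0 gam g (trunc n f)) = trunc n (cocycle n 0 0 gam g f)"
proof
  fix i
  show "trunc n (cocycle n 0 0 gam g (trunc n f)) i = trunc n (cocycle n 0 0 gam g f) i"
    by (cases "i = n"; cases g; cases i) (auto simp: trunc_def shift_def split: nat.split)
qed

lemma ext_gen_action_trunc:
  "ext_gen_action n gam g (map_prod (trunc n) (trunc n) m) = map_prod (trunc n) (trunc n) (verma_ext n 0 0 gam g m)"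
  by (simp add: ext_gen_action_def verma_ext_def trunc_linear trunc_verma trunc_cocycle)

lemma scale_operators:
  "scale1 c (f + h) = scale1 c f + scale1 c h" "scale1 (c + d) f = scale1 c f + scale1 d f"
  "scale1 c (scale1 d f) = scale1 (c * d) f" "scale1 1 f = f"
  by (auto simp: scale1_def fun_eq_iff algebra_simps)

lemma ext_representation:
  "dj_representation (supp n \<times> supp n) scale2 (ext_gen_action n (gam :: 'k::field_char_0))"
proof (rule representation_transfer[OF verma_ext_representation[of n gam]])
  show "dj_operators (supp n \<times> supp n) scale2 (ext_gen_action n gam)"
    by unfold_locales
      (auto simp: scale2_def zero_prod_def supp_closed scale_operators ext_gen_action_def
        verma_ext_def verma_linear cocycle_linear trunc_linear add_ac)
  have "trunc n ` UNIV = (supp n :: (nat \<Rightarrow> 'k) set)"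
    using trunc_id by (auto simp: image_iff intro: sym)
  from map_prod_surj_on[OF this this]
  show "map_prod (trunc n) (trunc n) ` UNIV = (supp n \<times> supp n :: ('k fpair) set)"
    by simp
  fix m m' :: "'k fpair" and c :: 'k and g
  show "map_prod (trunc n) (trunc n) (m + m') = map_prod (trunc n) (trunc n) m + map_prod (trunc n) (trunc n) m'"
    by (cases m; cases m') (simp add: trunc_linear)
  show "map_prod (trunc n) (trunc n) (scale2 c m) = scale2 c (map_prod (trunc n) (trunc n) m)"
    by (cases m) (simp add: scale2_def trunc_linear)
  show "map_prod (trunc n) (trunc n) (verma_ext n 0 0 gam g m)
      = ext_gen_action n gam g (map_prod (trunc n) (trunc n) m)"
    by (rule ext_gen_action_trunc[symmetric])
qed

lemma L_operators:
  "dj_operators (supp n) scale1 (L_gen_action n :: dj_gen \<Rightarrow> (nat \<Rightarrow> 'k::field_char_0) \<Rightarrow> _)"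
proof
  fix f h :: "nat \<Rightarrow> 'k" and g and c :: 'k
  assume f: "f \<in> supp n"
  show "L_gen_action n g f \<in> supp n" unfolding L_gen_action_eq[OF f] by simp
  show "L_gen_action n g (scale1 c f) = scale1 c (L_gen_action n g f)"
    unfolding L_gen_action_eq[OF f] L_gen_action_eq[OF supp_closed(3)[OF f]] verma_linear trunc_linear ..
  assume h: "h \<in> supp n"
  show "L_gen_action n g (f + h) = L_gen_action n g f + L_gen_action n g h"
    unfolding L_gen_action_eq[OF f] L_gen_action_eq[OF h] L_gen_action_eq[OF supp_closed(2)[OF f h]]
      verma_linear trunc_linear ..
qed (auto simp: supp_closed scale_operators)

lemma L_representation:
  "dj_representation (supp n) scale1 (L_gen_action n :: dj_gen \<Rightarrow> (nat \<Rightarrow> 'k::field_char_0) \<Rightarrow> _)"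
proof (rule representation_transfer[OF ext_representation[of n 0] L_operators])
  show "snd ` (supp n \<times> supp n) = (supp n :: (nat \<Rightarrow> 'k) set)"
    using supp_closed(1)[of n] by (metis empty_iff snd_image_times)
  fix m m' :: "'k fpair" and c :: 'k and g
  show "snd (scale2 c m) = scale1 c (snd m)" by (simp add: scale2_def)
  show "snd (m + m') = snd m + snd m'" by simp
  assume "m \<in> supp n \<times> supp n"
  then show "snd (ext_gen_action n 0 g m) = L_gen_action n g (snd m)"
    by (cases m) (simp add: ext_gen_action_def verma_ext_def L_gen_action_eq)
qed

lemma L_eq_op_module: "L n = dj_operators.op_module (supp n) scale1 (L_gen_action n :: dj_gen \<Rightarrow> (nat \<Rightarrow> 'k::field_char_0) \<Rightarrow> _)"
proof -
  interpret dj_representation "supp n" scale1 "L_gen_action n :: dj_gen \<Rightarrow> (nat \<Rightarrow> 'k) \<Rightarrow> _"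
    by (rule L_representation)
  have "sum h A j = (\<Sum>b\<in>A. h b j)" for A :: "word set" and h :: "word \<Rightarrow> nat \<Rightarrow> 'k" and j
    by (induction A rule: infinite_finite_induct) auto
  then have "L_free_action n a f = free_act a f" for a f
    by (simp add: L_free_action_def free_act_def scale1_def fun_eq_iff)
  then show ?thesis
    by (simp add: L_def op_module_def supp_def[symmetric] zero_fun_def plus_fun_def[abs_def])
qed

definition ext_module :: "nat \<Rightarrow> 'k \<Rightarrow> ('k::field_char_0 dj, 'k fpair) module"
  where "ext_module n gam = dj_operators.op_module (supp n \<times> supp n) scale2 (ext_gen_action n gam)"

lemma L_module:
  fixes f h :: "nat \<Rightarrow> 'k::field_char_0"
  shows "left_module DJ (L n :: ('k dj, nat \<Rightarrow> 'k) module)" "carrier (L n :: ('k dj, _) module) = supp n"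
    "f \<oplus>\<^bsub>L n\<^esub> h = f + h" "\<zero>\<^bsub>L n\<^esub> = (0 :: nat \<Rightarrow> 'k)"
    "f \<in> supp n \<Longrightarrow> gact (L n) g f = trunc n (verma n g f)"
    "f \<in> supp n \<Longrightarrow> cact (L n) c f = scale1 c f"
proof -
  interpret dj_representation "supp n" scale1 "L_gen_action n :: dj_gen \<Rightarrow> (nat \<Rightarrow> 'k) \<Rightarrow> _"
    by (rule L_representation)
  show "left_module DJ (L n :: ('k dj, nat \<Rightarrow> 'k) module)" "carrier (L n :: ('k dj, _) module) = supp n"
    "f \<oplus>\<^bsub>L n\<^esub> h = f + h" "\<zero>\<^bsub>L n\<^esub> = (0 :: nat \<Rightarrow> 'k)"
    using op_module_left_module by (simp_all add: L_eq_op_module) (simp_all add: op_module_def)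
  assume "f \<in> supp n"
  then show "gact (L n) g f = trunc n (verma n g f)" "cact (L n) c f = scale1 c f"
    by (simp_all add: L_eq_op_module op_module_gact op_module_cact L_gen_action_eq)
qed

lemma ext_module:
  fixes m m' :: "'k::field_char_0 fpair"
  shows "left_module DJ (ext_module n gam :: ('k dj, _) module)"
    "carrier (ext_module n gam :: ('k dj, _) module) = supp n \<times> supp n"
    "m \<oplus>\<^bsub>ext_module n gam\<^esub> m' = m + m'" "\<zero>\<^bsub>ext_module n gam\<^esub> = (0, 0 :: nat \<Rightarrow> 'k)"
    "m \<in> supp n \<times> supp n \<Longrightarrow> gact (ext_module n gam) g m = ext_gen_action n gam g m"
    "m \<in> supp n \<times> supp n \<Longrightarrow> cact (ext_module n gam) c m = scale2 c m"
proof -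
  interpret dj_representation "supp n \<times> supp n" scale2 "ext_gen_action n gam"
    by (rule ext_representation)
  show "left_module DJ (ext_module n gam :: ('k dj, _) module)"
    using op_module_left_module by (simp add: ext_module_def)
  show "carrier (ext_module n gam :: ('k dj, _) module) = supp n \<times> supp n"
    "m \<oplus>\<^bsub>ext_module n gam\<^esub> m' = m + m'" "\<zero>\<^bsub>ext_module n gam\<^esub> = (0, 0 :: nat \<Rightarrow> 'k)"
    by (simp_all add: ext_module_def op_module_def zero_prod_def)
  assume "m \<in> supp n \<times> supp n"
  then show "gact (ext_module n gam) g m = ext_gen_action n gam g m"
    "cact (ext_module n gam) c m = scale2 c m"
    by (simp_all add: ext_module_def op_module_gact op_module_cact del: mem_Times_iff)
qed

section \<open>Generators and constants acting on a module\<close>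

lemma dj_const_simps:
  "dj_const (c + d) = dj_const c \<oplus>\<^bsub>DJ\<^esub> dj_const d" "dj_const (c * d) = dj_const c \<otimes>\<^bsub>DJ\<^esub> dj_const d"
  "dj_const (1 :: 'k) = \<one>\<^bsub>DJ\<^esub>" "dj_const c \<in> carrier DJ" "dj_gen_elem g \<in> carrier (DJ :: 'k dj ring)"
  "dj_gen_elem g \<otimes>\<^bsub>DJ\<^esub> dj_const c = dj_const c \<otimes>\<^bsub>DJ\<^esub> dj_gen_elem g"
  for c d :: "'k::field"
  by (simp_all add: dj_const_def dj_gen_elem_def dj_elem_simps(1-3)[symmetric] fa_const_def fa_gen_def
      single_add mult_single dj_elem_simps(4) mult.commute)

locale dj_module = left_module DJ T for T :: "('k::field_char_0 dj, 't) module" (structure)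
begin

lemma gact_closed [simp]: "t \<in> carrier T \<Longrightarrow> gact T g t \<in> carrier T"
  by (simp add: smult_closed dj_const_simps)
lemma cact_closed [simp]: "t \<in> carrier T \<Longrightarrow> cact T c t \<in> carrier T"
  by (simp add: smult_closed dj_const_simps)
lemma gact_add: "t \<in> carrier T \<Longrightarrow> t' \<in> carrier T \<Longrightarrow> gact T g (t \<oplus> t') = gact T g t \<oplus> gact T g t'"
  by (simp add: smult_r_distr dj_const_simps)
lemma cact_add: "t \<in> carrier T \<Longrightarrow> t' \<in> carrier T \<Longrightarrow> cact T c (t \<oplus> t') = cact T c t \<oplus> cact T c t'"
  by (simp add: smult_r_distr dj_const_simps)
lemma cact_add_left: "t \<in> carrier T \<Longrightarrow> cact T (c + d) t = cact T c t \<oplus> cact T d t"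
  by (simp add: smult_l_distr dj_const_simps)
lemma cact_cact: "t \<in> carrier T \<Longrightarrow> cact T c (cact T d t) = cact T (c * d) t"
  by (simp add: smult_assoc1 dj_const_simps)
lemma cact_1 [simp]: "t \<in> carrier T \<Longrightarrow> cact T 1 t = t"
  by (simp add: smult_one dj_const_simps)
lemma cact_0_right [simp]: "cact T c \<zero> = \<zero>"
  by (simp add: smult_r_null dj_const_simps)
lemma gact_0_right [simp]: "gact T g \<zero> = \<zero>"
  by (simp add: smult_r_null dj_const_simps)
lemma cact_0 [simp]: "t \<in> carrier T \<Longrightarrow> cact T 0 t = \<zero>"
  using cact_add_left[of t 0 0] cact_closed[of t 0] by simp
lemma cact_uminus: "t \<in> carrier T \<Longrightarrow> cact T (- 1) t = \<ominus> t"
  using cact_add_left[of t "- 1" 1] by (intro M.minus_equality[symmetric]) simp_all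
lemma gact_cact: "t \<in> carrier T \<Longrightarrow> gact T g (cact T c t) = cact T c (gact T g t)"
  by (simp add: smult_assoc1[symmetric] dj_const_simps)

lemma cact_eq_0D: "t \<in> carrier T \<Longrightarrow> cact T c t = \<zero> \<Longrightarrow> c = 0 \<or> t = \<zero>"
  using cact_cact[of t "inverse c" c] by (cases "c = 0") auto

lemma act_relation:
  assumes "a - b \<in> dj_relators" "t \<in> carrier T" shows "act T a t = act T b t"
  using dj_elem_eqI[OF assms(1)] by simp

lemma act_simps:
  assumes "t \<in> carrier T"
  shows "act T (a + b) t = act T a t \<oplus> act T b t" "act T (a * b) t = act T a (act T b t)"
    "act T (fa_gen g) t = gact T g t" "act T (fa_const c) t = cact T c t" "act T 1 t = t"
    "act T (a - b) t = act T a t \<oplus> cact T (- 1) (act T b t)" "act T 2 t = cact T 2 t" "act T a t \<in> carrier T"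
proof -
  show closed: "act T a t \<in> carrier T" for a using assms by (simp add: smult_closed dj_elem_simps)
  show add: "act T (a + b) t = act T a t \<oplus> act T b t" for a b
    using assms by (simp add: smult_l_distr dj_elem_simps)
  show mult: "act T (a * b) t = act T a (act T b t)" using assms by (simp add: smult_assoc1 dj_elem_simps)
  show "act T (fa_gen g) t = gact T g t" "act T (fa_const c) t = cact T c t"
    by (simp_all add: dj_gen_elem_def dj_const_def)
  show one: "act T 1 t = t" using assms by (simp add: dj_elem_simps smult_one)
  show "act T (a - b) t = act T a t \<oplus> cact T (- 1) (act T b t)"
    using add[of "a - b" b] closed by (simp add: cact_uminus M.a_assoc M.r_neg)
  show "act T 2 t = cact T 2 t"
    using add[of 1 1] cact_add_left[OF assms, of 1 1] assms by (simp add: one)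
qed

lemma y_relations:
  assumes t: "t \<in> carrier T"
  shows "gact T Gx (gact T Gy t) = gact T Gy (gact T Gx t) \<oplus> cact T (1/2) (gact T Gx (gact T Gx t))"
    "gact T Gg (gact T Gy t) = gact T Gy (gact T Gg t) \<oplus> gact T Gx (gact T Gg t)"
    "gact T Gxi (gact T Gy t) = gact T Gy (gact T Gxi t) \<oplus> cact T (- 2) (gact T Gy t)"
    "gact T Gu (gact T Gy t) = gact T Gy (gact T Gu t) \<oplus> (t \<oplus> cact T (- 1) (gact T Gg t))"
    "gact T Gv (gact T Gy t) = gact T Gy (gact T Gv t) \<oplus> cact T (1/2) (gact T Gg (gact T Gxi t))
        \<oplus> gact T Gy (gact T Gu t)"
    "gact T Gginv (gact T Gg t) = t"
proof -
  note rel = act_relation[OF _ t] and S = act_simps t cact_cact gact_cact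
  have yx: "act T (fa_gen Gy * fa_gen Gx) t
      = act T (fa_gen Gx * fa_gen Gy - fa_const (1/2) * fa_gen Gx ^ 2) t"
    by (rule rel) (simp add: dj_relators_def Let_def)
  then show "gact T Gx (gact T Gy t) = gact T Gy (gact T Gx t) \<oplus> cact T (1/2) (gact T Gx (gact T Gx t))"
    by (simp add: S power2_eq_square cact_uminus M.a_assoc cact_add_left[symmetric])
  have "act T (fa_gen Gg * fa_gen Gy) t = act T (fa_gen Gy * fa_gen Gg + fa_gen Gx * fa_gen Gg) t"
    by (rule rel) (simp add: dj_relators_def Let_def)
  then show "gact T Gg (gact T Gy t) = gact T Gy (gact T Gg t) \<oplus> gact T Gx (gact T Gg t)"
    by (simp add: S)
  have "act T (fa_gen Gxi * fa_gen Gy) t = act T (fa_gen Gy * fa_gen Gxi - 2 * fa_gen Gy) t"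
    by (rule rel) (simp add: dj_relators_def Let_def)
  then show "gact T Gxi (gact T Gy t) = gact T Gy (gact T Gxi t) \<oplus> cact T (- 2) (gact T Gy t)"
    by (simp add: S)
  have "act T (fa_gen Gu * fa_gen Gy) t = act T (fa_gen Gy * fa_gen Gu + (1 - fa_gen Gg)) t"
    by (rule rel) (simp add: dj_relators_def Let_def)
  then show "gact T Gu (gact T Gy t) = gact T Gy (gact T Gu t) \<oplus> (t \<oplus> cact T (- 1) (gact T Gg t))"
    by (simp add: S)
  have "act T (fa_gen Gv * fa_gen Gy) t
      = act T (fa_gen Gy * fa_gen Gv + fa_const (1/2) * fa_gen Gg * fa_gen Gxi + fa_gen Gy * fa_gen Gu) t"
    by (rule rel) (simp add: dj_relators_def Let_def)
  then show "gact T Gv (gact T Gy t) = gact T Gy (gact T Gv t) \<oplus> cact T (1/2) (gact T Gg (gact T Gxi t))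
        \<oplus> gact T Gy (gact T Gu t)"
    by (simp add: S)
  have "act T (fa_gen Gginv * fa_gen Gg) t = act T 1 t"
    by (rule rel) (simp add: dj_relators_def Let_def)
  then show "gact T Gginv (gact T Gg t) = t"
    by (simp add: S)
qed

end

definition unitv :: "nat \<Rightarrow> nat \<Rightarrow> 'k::zero_neq_one"
  where "unitv i = (\<lambda>j. if j = i then 1 else 0)"

definition finsupp :: "(nat \<Rightarrow> 'k::zero) set"
  where "finsupp = (\<Union>N. supp N)"

lemma finsupp_closed:
  fixes f h :: "nat \<Rightarrow> 'k::field"
  shows "0 \<in> (finsupp :: (nat \<Rightarrow> 'k) set)" "f \<in> finsupp \<Longrightarrow> h \<in> finsupp \<Longrightarrow> f + h \<in> finsupp"
    "f \<in> finsupp \<Longrightarrow> scale1 c f \<in> finsupp" "unitv i \<in> (finsupp :: (nat \<Rightarrow> 'k) set)"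
    "f \<in> finsupp \<Longrightarrow> verma n g f \<in> finsupp" "f \<in> finsupp \<Longrightarrow> cocycle n al mu gam g f \<in> finsupp"
proof -
  have iff: "f \<in> finsupp \<longleftrightarrow> (\<exists>N. \<forall>i>N. f i = 0)" for f :: "nat \<Rightarrow> 'k"
    by (auto simp: finsupp_def supp_def)
  show "0 \<in> (finsupp :: (nat \<Rightarrow> 'k) set)" by (simp add: iff)
  show "unitv i \<in> (finsupp :: (nat \<Rightarrow> 'k) set)" unfolding iff by (intro exI[of _ i]) (simp add: unitv_def)
  show "scale1 c f \<in> finsupp" if "f \<in> finsupp" using that by (auto simp: iff scale1_def)
  show "f + h \<in> finsupp" if "f \<in> finsupp" "h \<in> finsupp"
  proof -
    from that obtain N N' where "\<forall>i>N. f i = 0" "\<forall>i>N'. h i = 0" by (auto simp: iff)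
    then show ?thesis unfolding iff by (intro exI[of _ "max N N'"]) simp
  qed
  assume "f \<in> finsupp"
  then obtain N where N: "\<forall>i>N. f i = 0" by (auto simp: iff)
  then have S: "\<forall>i>Suc N. shift f i = 0" by (auto simp: shift_def split: nat.split)
  show "verma n g f \<in> finsupp" unfolding iff using N S by (intro exI[of _ "Suc N"]) (cases g; simp)
  show "cocycle n al mu gam g f \<in> finsupp"
    unfolding iff using N S by (intro exI[of _ "Suc N"]) (cases g; simp)
qed

lemma verma_ext_finsupp:
  "m \<in> finsupp \<times> finsupp \<Longrightarrow> verma_ext n al mu gam g m \<in> finsupp \<times> finsupp"
  by (auto simp: verma_ext_def finsupp_closed)

lemma shift_unitv: "shift (unitv i) = (unitv (Suc i) :: nat \<Rightarrow> 'k::zero_neq_one)"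
  by (auto simp: shift_def unitv_def fun_eq_iff split: nat.split)

text \<open>Under linear combinations and \<open>y\<close> the two highest weight vectors generate all finitely supported
  pairs.\<close>

lemma finsupp_pair_induct [consumes 1, case_names unit1 unit2 add scale y]:
  fixes m :: "'k::field fpair"
  assumes m: "m \<in> finsupp \<times> finsupp"
    and base: "P (unitv 0, 0)" "P (0, unitv 0)"
    and add: "\<And>m m'. P m \<Longrightarrow> P m' \<Longrightarrow> P (m + m')" and scale: "\<And>c m. P m \<Longrightarrow> P (scale2 c m)"
    and y: "\<And>m. P m \<Longrightarrow> P (shift (fst m), shift (snd m))"
  shows "P m"
proof -
  have [simp]: "shift 0 = (0 :: nat \<Rightarrow> 'k)" by (auto simp: shift_def fun_eq_iff split: nat.split)
  have [simp]: "scale1 c 0 = (0 :: nat \<Rightarrow> 'k)" for c by (auto simp: scale1_def)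
  have unit: "P (unitv i, 0)" "P (0, unitv i)" for i
    using base y[of "(unitv i, 0)" for i] y[of "(0, unitv i)" for i] by (induction i) (auto simp: shift_unitv)
  have split0: "f = scale1 (f 0) (unitv 0)" if "f \<in> supp 0" for f :: "nat \<Rightarrow> 'k"
    using that by (auto simp: supp_def scale1_def unitv_def fun_eq_iff)
  have split: "f = f(Suc N := 0) + scale1 (f (Suc N)) (unitv (Suc N))" "f(Suc N := 0) \<in> supp N"
    if "f \<in> supp (Suc N)" for f :: "nat \<Rightarrow> 'k" and N
    using that by (auto simp: supp_def scale1_def unitv_def fun_eq_iff)
  have "P (f, 0)" if "f \<in> supp N" for f N
    using that
  proof (induction N arbitrary: f)
    case 0
    have "scale2 (f 0) (unitv 0, 0) = (f, 0)" using split0[OF 0, symmetric] by (simp add: scale2_def)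
    with scale[OF unit(1), of "f 0" 0] show ?case by (simp only:)
  next
    case (Suc N)
    have "(f(Suc N := 0), 0) + scale2 (f (Suc N)) (unitv (Suc N), 0) = (f, 0)"
      using split(1)[OF Suc.prems, symmetric] by (simp add: scale2_def)
    with add[OF Suc.IH[OF split(2)[OF Suc.prems]] scale[OF unit(1), of "f (Suc N)" "Suc N"]]
    show ?case by (simp only:)
  qed
  moreover have "P (0, f)" if "f \<in> supp N" for f N
    using that
  proof (induction N arbitrary: f)
    case 0
    have "scale2 (f 0) (0, unitv 0) = (0, f)" using split0[OF 0, symmetric] by (simp add: scale2_def)
    with scale[OF unit(2), of "f 0" 0] show ?case by (simp only:)
  next
    case (Suc N)
    have "(0, f(Suc N := 0)) + scale2 (f (Suc N)) (0, unitv (Suc N)) = (0, f)"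
      using split(1)[OF Suc.prems, symmetric] by (simp add: scale2_def)
    with add[OF Suc.IH[OF split(2)[OF Suc.prems]] scale[OF unit(2), of "f (Suc N)" "Suc N"]]
    show ?case by (simp only:)
  qed
  ultimately show ?thesis using m add[of "(fst m, 0)" "(0, snd m)"] by (auto simp: finsupp_def)
qed

context dj_module begin

text \<open>In a module with \<open>y\<^sup>n\<^sup>+\<^sup>1 t = 0\<close> the sum over \<open>i \<le> n\<close> already is the sum over all \<open>i\<close>; hence \<open>lin\<close>
  accepts arbitrary sequences and turns \<open>shift\<close> into \<open>y\<close>.\<close>

definition lin :: "nat \<Rightarrow> (nat \<Rightarrow> 't) \<Rightarrow> (nat \<Rightarrow> 'k) \<Rightarrow> 't"
  where "lin n b f = (\<Oplus>i\<in>{..n}. cact T (f i) (b i))"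

definition ypow :: "'t \<Rightarrow> nat \<Rightarrow> 't"
  where "ypow t i = (gact T Gy ^^ i) t"

lemma ypow_simps [simp]: "ypow t 0 = t" "ypow t (Suc i) = gact T Gy (ypow t i)"
  by (simp_all add: ypow_def)

lemma ypow_closed [simp]: "t \<in> carrier T \<Longrightarrow> ypow t i \<in> carrier T"
  by (induction i) simp_all

lemma lin_closed: "(\<And>i. b i \<in> carrier T) \<Longrightarrow> lin n b f \<in> carrier T"
  unfolding lin_def by (intro M.finsum_closed) auto

lemma lin_cong: "(\<And>i. i \<le> n \<Longrightarrow> f i = h i) \<Longrightarrow> (\<And>i. b i \<in> carrier T) \<Longrightarrow> lin n b f = lin n b h"
  unfolding lin_def by (intro M.finsum_cong') auto

lemma lin_Suc: "(\<And>i. b i \<in> carrier T) \<Longrightarrow> lin (Suc n) b f = cact T (f (Suc n)) (b (Suc n)) \<oplus> lin n b f"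
  unfolding lin_def by (intro M.finsum_Suc) auto

lemma lin_0: "(\<And>i. b i \<in> carrier T) \<Longrightarrow> lin 0 b f = cact T (f 0) (b 0)"
  unfolding lin_def by simp

lemma lin_add:
  assumes "\<And>i. b i \<in> carrier T" shows "lin n b (f + h) = lin n b f \<oplus> lin n b h"
  unfolding lin_def using assms by (subst M.finsum_addf[symmetric]) (auto simp: cact_add_left)

lemma lin_scale:
  assumes b: "\<And>i. b i \<in> carrier T" shows "lin n b (scale1 c f) = cact T c (lin n b f)"
  by (induction n) (simp_all add: lin_0[OF b] lin_Suc[OF b] b scale1_def cact_cact cact_add lin_closed)

lemma lin_zero: "(\<And>i. b i \<in> carrier T) \<Longrightarrow> lin n b 0 = \<zero>"
  using lin_scale[of b n 0 0] lin_closed[of b n 0] by (simp add: scale1_def zero_fun_def)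

lemma lin_unitv:
  assumes b: "\<And>i. b i \<in> carrier T" shows "lin n b (unitv i) = (if i \<le> n then b i else \<zero>)"
proof (induction n)
  case 0
  show ?case by (simp add: lin_0[OF b] unitv_def b)
next
  case (Suc n)
  have "i = Suc n \<or> i \<le> n \<or> i > Suc n" by linarith
  with Suc show ?case by (auto simp: lin_Suc[OF b] b) (auto simp: unitv_def b)
qed

lemma gact_lin:
  assumes b: "\<And>i. b i \<in> carrier T" shows "gact T g (lin n b f) = lin n (\<lambda>i. gact T g (b i)) f"
  by (induction n) (simp_all add: lin_0 lin_Suc b gact_cact gact_add lin_closed)

lemma lin_shift:
  assumes b: "\<And>i. b i \<in> carrier T" shows "lin (Suc n) b (shift f) = lin n (\<lambda>i. b (Suc i)) f"
  by (induction n) (simp_all add: lin_0 lin_Suc b lin_closed)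

lemma lin_ypow_shift:
  assumes t: "t \<in> carrier T" and top: "ypow t (Suc n) = \<zero>"
  shows "lin n (ypow t) (shift f) = gact T Gy (lin n (ypow t) f)"
proof -
  have "lin (Suc n) (ypow t) (shift f) = lin n (ypow t) (shift f)"
    using top lin_Suc[of "ypow t" n "shift f"] t by (simp add: lin_closed del: ypow_simps(2))
  then show ?thesis
    using lin_shift[of "ypow t" n f] gact_lin[of "ypow t" Gy n f] t by simp
qed

end

text \<open>Two elements of an arbitrary module that satisfy the defining relations of \<open>S n lam mu gam\<close>.\<close>

locale jordan_pair = dj_module T for T :: "('k::field_char_0 dj, 't) module" (structure) +
  fixes n :: nat and lam mu gam :: 'k and s w :: 't
  assumes s [simp]: "s \<in> carrier T" and w [simp]: "w \<in> carrier T"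
    and g_s: "gact T Gg s = s" and g_w: "gact T Gg w = w \<oplus> cact T lam s"
    and xi_s: "gact T Gxi s = cact T (of_nat n) s" and xi_w: "gact T Gxi w = cact T (of_nat n) w \<oplus> cact T mu s"
    and u_s: "gact T Gu s = \<zero>" and v_s: "gact T Gv s = \<zero>" and u_w: "gact T Gu w = \<zero>" and v_w: "gact T Gv w = \<zero>"
    and x_s: "gact T Gx s = \<zero>" and y_s: "ypow s (Suc n) = \<zero>"
    and x_w: "gact T Gx w = cact T gam (gact T Gy s)" and y_w: "ypow w (Suc n) = \<zero>"
begin

definition al :: 'k where "al = lam + of_nat n / 2 * gam"

definition E :: "'k fpair \<Rightarrow> 't"
  where "E m = lin n (ypow s) (fst m) \<oplus> lin n (ypow w) (snd m)"

abbreviation \<rho> :: "dj_gen \<Rightarrow> 'k fpair \<Rightarrow> 'k fpair"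
  where "\<rho> \<equiv> verma_ext n al mu gam"

lemma E_closed [simp]: "E m \<in> carrier T" by (simp add: E_def lin_closed)

lemma E_add: "E (m + m') = E m \<oplus> E m'"
  by (simp add: E_def lin_add lin_closed M.a_ac)

lemma E_scale: "E (scale2 c m) = cact T c (E m)"
  by (simp add: E_def scale2_def lin_scale cact_add lin_closed)

lemma E_0: "E (0, 0) = \<zero>" by (simp add: E_def lin_zero)

lemma E_0' [simp]: "E 0 = \<zero>" using E_0 by (simp add: zero_prod_def)

lemma E_cong: "(\<And>i. i \<le> n \<Longrightarrow> fst m i = fst m' i) \<Longrightarrow> (\<And>i. i \<le> n \<Longrightarrow> snd m i = snd m' i) \<Longrightarrow> E m = E m'"
  unfolding E_def by (intro arg_cong2[where f = "(\<oplus>)"] lin_cong) auto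

lemma E_unit: "E (unitv i, 0) = (if i \<le> n then ypow s i else \<zero>)" "E (0, unitv i) = (if i \<le> n then ypow w i else \<zero>)"
  by (simp_all add: E_def lin_unitv lin_zero)

lemma E_y: "E (\<rho> Gy m) = gact T Gy (E m)"
  using lin_ypow_shift[OF s y_s] lin_ypow_shift[OF w y_w]
  by (simp add: E_def verma_ext_def gact_add lin_closed zero_fun_def[symmetric])

lemma \<rho>_base:
  "\<rho> Gx (unitv 0, 0) = 0" "\<rho> Gx (0, unitv 0) = scale2 gam (\<rho> Gy (unitv 0, 0))"
  "\<rho> Gg (unitv 0, 0) = (unitv 0, 0)" "\<rho> Gg (0, unitv 0) = (0, unitv 0) + scale2 lam (unitv 0, 0)"
  "\<rho> Gxi (unitv 0, 0) = scale2 (of_nat n) (unitv 0, 0)"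
  "\<rho> Gxi (0, unitv 0) = scale2 (of_nat n) (0, unitv 0) + scale2 mu (unitv 0, 0)"
  "\<rho> Gu (unitv 0, 0) = 0" "\<rho> Gu (0, unitv 0) = 0" "\<rho> Gv (unitv 0, 0) = 0" "\<rho> Gv (0, unitv 0) = 0"
  by (rule pair_fun_eqI; case_tac i;
    simp add: verma_ext_def scale2_def scale1_def unitv_def al_def field_simps)+

text \<open>Finite support is part of the predicate so that a proof by induction over \<open>y\<close> can apply the result
  for one generator to the image of a vector under another.\<close>

definition commutes :: "dj_gen \<Rightarrow> 'k fpair \<Rightarrow> bool"
  where "commutes g m \<longleftrightarrow> m \<in> finsupp \<times> finsupp \<and> E (\<rho> g m) = gact T g (E m)"

lemma commutes_add: "commutes g m \<Longrightarrow> commutes g m' \<Longrightarrow> commutes g (m + m')"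
  by (simp add: commutes_def mem_Times_iff finsupp_closed verma_ext_linear E_add gact_add)

lemma commutes_scale: "commutes g m \<Longrightarrow> commutes g (scale2 c m)"
  by (simp add: commutes_def finsupp_closed verma_ext_linear E_scale gact_cact) (simp add: scale2_def finsupp_closed mem_Times_iff)

lemma commutes_induct:
  assumes "commutes g (unitv 0, 0)" "commutes g (0, unitv 0)"
    and "\<And>m. commutes g m \<Longrightarrow> commutes g (\<rho> Gy m)" and "m \<in> finsupp \<times> finsupp"
  shows "commutes g m"
  using assms(4)
proof (induction rule: finsupp_pair_induct)
  case (y m)
  have "\<rho> Gy m = (shift (fst m), shift (snd m))"
    by (simp add: verma_ext_def zero_fun_def[symmetric])
  then show ?case using assms(3)[OF y] by simp
next
  case unit1
  show ?case by (rule assms(1))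
next
  case unit2
  show ?case by (rule assms(2))
next
  case (add m m')
  then show ?case by (rule commutes_add)
next
  case (scale c m)
  then show ?case by (rule commutes_scale)
qed

lemma unit_finsupp:
  "(unitv i, 0) \<in> (finsupp \<times> finsupp :: ('k fpair) set)"
  "(0, unitv i) \<in> (finsupp \<times> finsupp :: ('k fpair) set)"
  by (simp_all add: finsupp_closed)

lemma commutesD: "commutes g m \<Longrightarrow> E (\<rho> g m) = gact T g (E m)" "commutes g m \<Longrightarrow> m \<in> finsupp \<times> finsupp"
  unfolding commutes_def by (rule conjunct2, assumption) (rule conjunct1, assumption)

lemma commutesI: "m \<in> finsupp \<times> finsupp \<Longrightarrow> E (\<rho> g m) = gact T g (E m) \<Longrightarrow> commutes g m"
  by (simp add: commutes_def)

lemma commutes_0: "commutes g 0"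
proof -
  have "scale2 0 m = (0 :: 'k fpair)" for m :: "'k fpair"
    by (simp add: scale2_def scale1_def zero_prod_def zero_fun_def)
  then have "\<rho> g 0 = 0" using verma_ext_linear(2)[of n al mu gam g 0 0] by simp
  then show ?thesis by (simp add: commutes_def finsupp_closed zero_prod_def) (simp add: zero_prod_def[symmetric])
qed

text \<open>The generators are treated in the order in which the relations with \<open>y\<close> allow it: that of \<open>x\<close>
  involves only \<open>x\<close>, that of \<open>g\<close> also \<open>x\<close>, that of \<open>u\<close> also \<open>g\<close>, and that of \<open>v\<close> all of \<open>g\<close>, \<open>\<xi>\<close> and \<open>u\<close>.
  For \<open>x\<close> the relation contains \<open>x\<^sup>2\<close>, so the induction carries the claim for the image under \<open>x\<close>
  along; it stops there because \<open>x\<close> has square zero.\<close>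

lemma commutes_x:
  assumes "m \<in> finsupp \<times> finsupp" shows "commutes Gx m"
proof -
  have step: "commutes Gx (\<rho> Gy m)" if m: "commutes Gx m" "commutes Gx (\<rho> Gx m)" for m
    using m unfolding commutes_def
    by (simp add: verma_ext_finsupp verma_ext_y_relations(1) E_add E_scale E_y y_relations(1) del: mem_Times_iff)
  have unit: "commutes Gx (unitv 0, 0)"
    using unit_finsupp(1)[of 0] x_s by (simp add: commutes_def \<rho>_base E_unit)
  have y_unit: "commutes Gx (\<rho> Gy (unitv 0, 0))"
    using step[OF unit] commutes_0 by (simp add: \<rho>_base)
  have "commutes Gx m \<and> commutes Gx (\<rho> Gx m)"
    using assms
  proof (induction rule: finsupp_pair_induct)
    case unit2
    have "commutes Gx (0, unitv 0)"
      using unit_finsupp(2)[of 0] x_w by (simp add: commutes_def \<rho>_base E_unit E_scale E_y)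
    then show ?case using commutes_scale[OF y_unit, of gam] by (simp add: \<rho>_base)
  next
    case (y m)
    have eq: "\<rho> Gy m = (shift (fst m), shift (snd m))"
      by (simp add: verma_ext_def zero_fun_def[symmetric])
    have "commutes Gx (\<rho> Gx (\<rho> Gy m))"
      using step[of "\<rho> Gx m"] y commutes_0 commutes_scale[OF commutes_0, of Gx "1/2"]
      by (simp add: verma_ext_y_relations(1,7) commutes_add)
    then show ?case using step[of m] y by (simp add: eq)
  next
    case unit1
    show ?case using unit commutes_0 by (simp add: \<rho>_base)
  next
    case (add m m')
    then show ?case by (simp add: verma_ext_linear commutes_add)
  next
    case (scale c m)
    then show ?case by (simp add: verma_ext_linear commutes_scale)
  qed
  then show ?thesis ..
qed

lemma commutes_g:
  assumes "m \<in> finsupp \<times> finsupp" shows "commutes Gg m"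
proof (rule commutes_induct[OF _ _ _ assms])
  show "commutes Gg (unitv 0, 0)"
    by (rule commutesI[OF unit_finsupp(1)]) (simp add: \<rho>_base E_unit E_add E_scale g_s)
  show "commutes Gg (0, unitv 0)"
    by (rule commutesI[OF unit_finsupp(2)]) (simp add: \<rho>_base E_unit E_add E_scale g_w)
  fix m assume m: "commutes Gg m"
  show "commutes Gg (\<rho> Gy m)"
  proof (rule commutesI[OF verma_ext_finsupp[OF commutesD(2)[OF m]]])
    note fin = commutesD(2)[OF m]
    show "E (\<rho> Gg (\<rho> Gy m)) = gact T Gg (E (\<rho> Gy m))"
      unfolding E_y y_relations[OF E_closed] verma_ext_y_relations E_add E_scale E_y
        commutesD(1)[OF commutes_x[OF verma_ext_finsupp[OF fin]]] commutesD(1)[OF m] ..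
  qed
qed

lemma commutes_xi:
  assumes "m \<in> finsupp \<times> finsupp" shows "commutes Gxi m"
proof (rule commutes_induct[OF _ _ _ assms])
  show "commutes Gxi (unitv 0, 0)"
    by (rule commutesI[OF unit_finsupp(1)]) (simp add: \<rho>_base E_unit E_add E_scale xi_s)
  show "commutes Gxi (0, unitv 0)"
    by (rule commutesI[OF unit_finsupp(2)]) (simp add: \<rho>_base E_unit E_add E_scale xi_w)
  fix m assume m: "commutes Gxi m"
  show "commutes Gxi (\<rho> Gy m)"
  proof (rule commutesI[OF verma_ext_finsupp[OF commutesD(2)[OF m]]])
    note fin = commutesD(2)[OF m]
    show "E (\<rho> Gxi (\<rho> Gy m)) = gact T Gxi (E (\<rho> Gy m))"
      unfolding E_y y_relations[OF E_closed] verma_ext_y_relations E_add E_scale E_y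
        commutesD(1)[OF m] ..
  qed
qed

lemma commutes_u:
  assumes "m \<in> finsupp \<times> finsupp" shows "commutes Gu m"
proof (rule commutes_induct[OF _ _ _ assms])
  show "commutes Gu (unitv 0, 0)"
    by (rule commutesI[OF unit_finsupp(1)]) (simp add: \<rho>_base E_unit E_add E_scale u_s)
  show "commutes Gu (0, unitv 0)"
    by (rule commutesI[OF unit_finsupp(2)]) (simp add: \<rho>_base E_unit E_add E_scale u_w)
  fix m assume m: "commutes Gu m"
  show "commutes Gu (\<rho> Gy m)"
  proof (rule commutesI[OF verma_ext_finsupp[OF commutesD(2)[OF m]]])
    note fin = commutesD(2)[OF m]
    show "E (\<rho> Gu (\<rho> Gy m)) = gact T Gu (E (\<rho> Gy m))"
      unfolding E_y y_relations[OF E_closed] verma_ext_y_relations E_add E_scale E_y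
        commutesD(1)[OF commutes_g[OF fin]] commutesD(1)[OF m] ..
  qed
qed

lemma commutes_v:
  assumes "m \<in> finsupp \<times> finsupp" shows "commutes Gv m"
proof (rule commutes_induct[OF _ _ _ assms])
  show "commutes Gv (unitv 0, 0)"
    by (rule commutesI[OF unit_finsupp(1)]) (simp add: \<rho>_base E_unit E_add E_scale v_s)
  show "commutes Gv (0, unitv 0)"
    by (rule commutesI[OF unit_finsupp(2)]) (simp add: \<rho>_base E_unit E_add E_scale v_w)
  fix m assume m: "commutes Gv m"
  show "commutes Gv (\<rho> Gy m)"
  proof (rule commutesI[OF verma_ext_finsupp[OF commutesD(2)[OF m]]])
    note fin = commutesD(2)[OF m]
    show "E (\<rho> Gv (\<rho> Gy m)) = gact T Gv (E (\<rho> Gy m))"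
      unfolding E_y y_relations[OF E_closed] verma_ext_y_relations E_add E_scale E_y
        commutesD(1)[OF commutes_g[OF verma_ext_finsupp[OF fin]]] commutesD(1)[OF commutes_xi[OF fin]]
        commutesD(1)[OF commutes_u[OF fin]] commutesD(1)[OF m] ..
  qed
qed

text \<open>The action on the vectors \<open>y\<^sup>i s\<close> and \<open>y\<^sup>i w\<close> in any module is given by the formulas of \<open>verma_ext\<close>.
  This holds for all \<open>i\<close>, also for \<open>i = n + 1\<close>, where these vectors vanish; it is there that the
  parameters are constrained.\<close>

lemma E_intertwines:
  assumes m: "m \<in> finsupp \<times> finsupp" shows "E (\<rho> g m) = gact T g (E m)"
proof (cases g)
  case Gginv
  have "gact T Gg (E (\<rho> Gginv m)) = E m"
    using commutesD(1)[OF commutes_g[OF verma_ext_finsupp[OF m, of n al mu gam Gginv]]] unfolding verma_ext_y_relations(6) ..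
  then show ?thesis using y_relations(6)[of "E (\<rho> Gginv m)"] Gginv by simp
qed (simp_all only: E_y commutesD(1)[OF commutes_x[OF m]] commutesD(1)[OF commutes_g[OF m]]
    commutesD(1)[OF commutes_xi[OF m]] commutesD(1)[OF commutes_u[OF m]] commutesD(1)[OF commutes_v[OF m]])

text \<open>Since \<open>y\<^sup>n\<^sup>+\<^sup>1 w = 0\<close>, applying \<open>u\<close> to it yields \<open>(n + 1) \<alpha> y\<^sup>n s = 0\<close>; once \<open>\<alpha> = 0\<close>, applying \<open>v\<close>
  yields \<open>(n + 1)/2 \<mu> y\<^sup>n s = 0\<close>. And \<open>y\<^sup>n s = 0\<close> would force \<open>s = 0\<close>, because \<open>v\<close> leads from \<open>y\<^sup>i\<^sup>+\<^sup>1 s\<close> to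
  a nonzero multiple of \<open>y\<^sup>i s\<close> for \<open>i < n\<close>.\<close>

lemma s_zero_or_parameters:
  assumes "s \<noteq> \<zero>" shows "lam + of_nat n / 2 * gam = 0 \<and> mu = 0"
proof -
  have descend: "ypow s i = \<zero>" if "ypow s (Suc i) = \<zero>" "Suc i \<le> n" for i
  proof -
    have "\<rho> Gv (unitv (Suc i), 0) = scale2 (of_nat (Suc i) * (of_nat n - of_nat i) / 2) (unitv i, 0)"
      by (rule pair_fun_eqI) (auto simp: verma_ext_def scale2_def scale1_def unitv_def zero_fun_def[symmetric])
    then have "cact T (of_nat (Suc i) * (of_nat n - of_nat i) / 2) (ypow s i) = \<zero>"
      using E_intertwines[OF unit_finsupp(1)[of "Suc i"], of Gv] that
      by (simp add: E_scale E_unit del: ypow_simps(2) of_nat_Suc)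
    moreover have "of_nat (Suc i) * (of_nat n - of_nat i) / 2 \<noteq> (0 :: 'k)"
      using that(2) by (simp del: of_nat_Suc)
    ultimately show ?thesis using cact_eq_0D[OF ypow_closed[OF s]] by blast
  qed
  have top: "ypow s n \<noteq> \<zero>"
  proof
    assume "ypow s n = \<zero>"
    then have "ypow s (n - i) = \<zero>" for i
    proof (induction i)
      case (Suc i)
      show ?case
      proof (cases "i < n")
        case True
        then show ?thesis using descend[of "n - Suc i"] Suc by (simp add: Suc_diff_Suc)
      qed (use Suc in simp)
    qed simp
    from this[of n] show False using assms by simp
  qed
  have "\<rho> Gu (0, unitv (Suc n)) = scale2 (- al * of_nat (Suc n)) (unitv n, 0)"
    by (rule pair_fun_eqI) (auto simp: verma_ext_def scale2_def scale1_def unitv_def zero_fun_def[symmetric])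
  then have "cact T (- al * of_nat (Suc n)) (ypow s n) = \<zero>"
    using E_intertwines[OF unit_finsupp(2)[of "Suc n"], of Gu] by (simp add: E_scale E_unit del: of_nat_Suc)
  then have "- al * of_nat (Suc n) = 0" using cact_eq_0D[OF ypow_closed[OF s]] top by blast
  then have al: "al = 0" by (simp del: of_nat_Suc)
  have "\<rho> Gv (0, unitv (Suc n)) = scale2 (mu / 2 * of_nat (Suc n)) (unitv n, 0)"
    by (rule pair_fun_eqI) (auto simp: al verma_ext_def scale2_def scale1_def unitv_def zero_fun_def[symmetric])
  then have "cact T (mu / 2 * of_nat (Suc n)) (ypow s n) = \<zero>"
    using E_intertwines[OF unit_finsupp(2)[of "Suc n"], of Gv] by (simp add: E_scale E_unit del: of_nat_Suc)
  then have "mu / 2 * of_nat (Suc n) = 0" using cact_eq_0D[OF ypow_closed[OF s]] top by blast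
  then have "mu = 0" by (simp del: of_nat_Suc)
  with al show ?thesis by (simp add: al_def)
qed

lemma supp_finsupp: "f \<in> supp n \<Longrightarrow> f \<in> finsupp" by (auto simp: finsupp_def)

text \<open>For admissible parameters the model maps to every module that contains such a pair.\<close>

lemma E_hom:
  assumes "lam + of_nat n / 2 * gam = 0" "mu = 0"
  shows "E \<in> module_hom DJ (ext_module n gam) T"
proof (rule dj_module_homI[OF ext_module(1) left_module_axioms])
  fix m assume m: "m \<in> carrier (ext_module n gam :: ('k dj, _) module)"
  then have m': "m \<in> supp n \<times> supp n" by (simp only: ext_module(2))
  then have fin: "m \<in> finsupp \<times> finsupp" using supp_finsupp by auto
  show "E m \<in> carrier T" by simp
  show "E (cact (ext_module n gam) c m) = cact T c (E m)" for c
    using m' by (simp only: ext_module(6) E_scale)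
  show "E (gact (ext_module n gam) g m) = gact T g (E m)" for g
  proof -
    have "E (ext_gen_action n gam g m) = E (\<rho> g m)"
      using assms by (intro E_cong) (simp_all add: ext_gen_action_def al_def trunc_def)
    then show ?thesis using m' E_intertwines[OF fin] by (simp only: ext_module(5))
  qed
qed (simp add: ext_module(3) E_add)

end

lemma (in dj_module) dj_submoduleI:
  assumes "N \<subseteq> carrier T" "\<zero> \<in> N" and add: "\<And>x y. x \<in> N \<Longrightarrow> y \<in> N \<Longrightarrow> x \<oplus> y \<in> N"
    and const: "\<And>c x. x \<in> N \<Longrightarrow> cact T c x \<in> N" and gen: "\<And>g x. x \<in> N \<Longrightarrow> gact T g x \<in> N"
  shows "Module.submodule N DJ T"
proof (rule submoduleI[OF assms(1-3)])
  fix A x assume "A \<in> carrier (DJ :: 'k dj ring)" and x: "x \<in> N"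
  then obtain a where A: "A = dj_elem a" by (auto simp: carrier_DJ)
  have "\<forall>x\<in>N. act T a x \<in> N"
  proof (induction a rule: free_alg_induct)
    case (const c)
    show ?case using assms(4) by (simp add: dj_const_def)
  next
    case (gen g)
    show ?case using assms(5) by (simp add: dj_gen_elem_def)
  next
    case (add a b)
    then show ?case using assms(1) by (simp add: subset_iff act_simps(1) assms(3))
  next
    case (mult a b)
    then show ?case using assms(1) by (simp add: subset_iff act_simps(2))
  qed
  then show "A \<odot>\<^bsub>T\<^esub> x \<in> N" using x by (simp add: A)
qed

lemma (in dj_module) dj_pow_act:
  assumes "t \<in> carrier T" shows "(dj_gen_elem Gy [^]\<^bsub>DJ\<^esub> k) \<odot>\<^bsub>T\<^esub> t = ypow t k"
proof (induction k)
  case (Suc k)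
  have "(dj_gen_elem Gy :: 'k dj) [^]\<^bsub>DJ\<^esub> Suc k = dj_gen_elem Gy \<otimes>\<^bsub>DJ\<^esub> (dj_gen_elem Gy [^]\<^bsub>DJ\<^esub> k)"
    by (rule R.nat_pow_Suc2) (rule dj_const_simps)
  then show ?case using Suc assms by (simp add: smult_assoc1 dj_const_simps R.nat_pow_closed)
qed (use assms in \<open>simp add: smult_one\<close>)

section \<open>The modules \<open>S\<close> as quotients of a free module\<close>

abbreviation free_s :: "'k::field dj \<times> 'k dj" where "free_s \<equiv> (\<one>\<^bsub>DJ\<^esub>, \<zero>\<^bsub>DJ\<^esub>)"
abbreviation free_w :: "'k::field dj \<times> 'k dj" where "free_w \<equiv> (\<zero>\<^bsub>DJ\<^esub>, \<one>\<^bsub>DJ\<^esub>)"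

lemma S_free_module: "left_module DJ (S_free :: ('k::field dj, _) module)"
  unfolding S_free_def by (intro left_module_direct_sum left_module_regular ring_DJ)

lemma S_free_simps:
  "carrier (S_free :: ('k::field dj, _) module) = carrier DJ \<times> carrier DJ"
  "p \<oplus>\<^bsub>S_free\<^esub> q = (fst p \<oplus>\<^bsub>DJ\<^esub> fst q, snd p \<oplus>\<^bsub>DJ\<^esub> snd q)"
  "A \<odot>\<^bsub>S_free\<^esub> p = (A \<otimes>\<^bsub>DJ\<^esub> fst p, A \<otimes>\<^bsub>DJ\<^esub> snd p)"
  for p q :: "'k::field dj \<times> 'k dj"
  by (simp_all add: S_free_def direct_sum_def regular_module_def)

text \<open>The homomorphism from the free module determined by the images of its two generators.\<close>

definition free_map :: "('k::field dj, 't) module \<Rightarrow> 't \<Rightarrow> 't \<Rightarrow> 'k dj \<times> 'k dj \<Rightarrow> 't"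
  where "free_map T s w p = fst p \<odot>\<^bsub>T\<^esub> s \<oplus>\<^bsub>T\<^esub> snd p \<odot>\<^bsub>T\<^esub> w"

context dj_module begin

lemma free_map_hom:
  assumes "s \<in> carrier T" "w \<in> carrier T"
  shows "free_map T s w \<in> module_hom DJ S_free T"
proof (rule module_homI)
  fix p q :: "'k dj \<times> 'k dj" assume p: "p \<in> carrier S_free"
  show "free_map T s w p \<in> carrier T"
    using p assms by (auto simp: S_free_simps free_map_def smult_closed)
  show "free_map T s w (A \<odot>\<^bsub>S_free\<^esub> p) = A \<odot>\<^bsub>T\<^esub> free_map T s w p" if "A \<in> carrier DJ" for A
    using p assms that by (auto simp: S_free_simps free_map_def smult_closed smult_assoc1 smult_r_distr)
  assume q: "q \<in> carrier S_free"
  show "free_map T s w (p \<oplus>\<^bsub>S_free\<^esub> q) = free_map T s w p \<oplus> free_map T s w q"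
    using p q assms by (auto simp: S_free_simps free_map_def smult_closed smult_l_distr M.a_ac)
qed

lemma free_map_unit:
  assumes "s \<in> carrier T" "w \<in> carrier T"
  shows "free_map T s w free_s = s" "free_map T s w free_w = w"
  using assms by (simp_all add: free_map_def smult_one smult_l_null)

end

lemma free_unit_closed:
  "(free_s :: 'k::field dj \<times> 'k dj) \<in> carrier S_free" "(free_w :: 'k dj \<times> 'k dj) \<in> carrier S_free"
proof -
  interpret ring "DJ :: 'k dj ring" by (rule ring_DJ)
  show "(free_s :: 'k dj \<times> 'k dj) \<in> carrier S_free" "(free_w :: 'k dj \<times> 'k dj) \<in> carrier S_free"
    by (simp_all add: S_free_simps)
qed

lemma y_pow_closed: "dj_gen_elem Gy [^]\<^bsub>DJ\<^esub> (k::nat) \<in> carrier (DJ :: 'k::field dj ring)"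
  by (intro monoid.nat_pow_closed[OF ring.is_monoid[OF ring_DJ]] dj_const_simps)

lemma S_relators_closed: "S_relators n lam mu gam \<subseteq> carrier (S_free :: ('k::field dj, _) module)"
proof -
  interpret F: left_module DJ "S_free :: ('k dj, _) module" by (rule S_free_module)
  note closed = F.smult_closed F.M.minus_closed F.M.a_closed free_unit_closed y_pow_closed dj_const_simps(4,5)
  show ?thesis
    unfolding S_relators_def Let_def insert_subset by (intro conjI empty_subsetI closed)
qed

text \<open>This translates the relators, which are elements of the free module, into equations between \<open>s\<close>
  and \<open>w\<close>. It is used in both directions: to find the relations in \<open>S\<close>, and to map \<open>S\<close> to other modules.\<close>

lemma (in dj_module) jordan_pair_iff:
  fixes n :: nat and lam mu gam :: 'k
  assumes s: "s \<in> carrier T" and w: "w \<in> carrier T"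
  shows "jordan_pair T n lam mu gam s w \<longleftrightarrow> (\<forall>r\<in>S_relators n lam mu gam. free_map T s w r = \<zero>)"
proof -
  interpret F: left_module DJ "S_free :: ('k dj, _) module" by (rule S_free_module)
  note hom = free_map_hom[OF s w]
  note rules = module_hom_diff[OF S_free_module left_module_axioms hom] module_hom_add[OF hom]
    module_hom_smult[OF hom] free_map_unit[OF s w] F.smult_closed F.M.minus_closed F.M.a_closed free_unit_closed
    y_pow_closed dj_const_simps(4,5) dj_pow_act s w gact_closed cact_closed
  have pow: "(dj_gen_elem Gy [^]\<^bsub>DJ\<^esub> n \<otimes>\<^bsub>DJ\<^esub> dj_gen_elem Gy) \<odot>\<^bsub>T\<^esub> t = ypow t (Suc n)"
    if "t \<in> carrier T" for t
    using dj_pow_act[OF that, of "Suc n"] by simp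
  show ?thesis
    unfolding S_relators_def Let_def ball_simps jordan_pair_def jordan_pair_axioms_def
    by (simp add: rules dj_module_axioms M.minus_eq_zero_iff pow del: ypow_simps(2))
qed

definition S_class :: "nat \<Rightarrow> 'k \<Rightarrow> 'k \<Rightarrow> 'k \<Rightarrow> 'k::field dj \<times> 'k dj \<Rightarrow> ('k dj \<times> 'k dj) set"
  where "S_class n lam mu gam p = generated_submodule DJ S_free (S_relators n lam mu gam) +>\<^bsub>S_free\<^esub> p"

context
  fixes n :: nat and lam mu gam :: "'k::field_char_0"
begin

private abbreviation "N \<equiv> generated_submodule DJ S_free (S_relators n lam mu gam)"
private abbreviation "\<pi> \<equiv> S_class n lam mu gam"

interpretation F: left_module DJ "S_free :: ('k dj, _) module" by (rule S_free_module)

lemma S_submodule: "Module.submodule N DJ S_free" "S_relators n lam mu gam \<subseteq> N"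
  by (rule generated_submodule_submodule[OF S_free_module S_relators_closed])+

lemma S_left_module: "left_module DJ (S n lam mu gam)"
  unfolding S_def by (rule F.quotient_left_module[OF S_submodule(1)])

lemma S_class_hom: "\<pi> \<in> module_hom DJ S_free (S n lam mu gam)"
  using F.quotient_hom[OF S_submodule(1)] unfolding S_def S_class_def[abs_def] .

lemma S_carrier: "carrier (S n lam mu gam) = \<pi> ` carrier S_free"
  using F.quotient_carrier[OF S_submodule(1)] unfolding S_def S_class_def[abs_def] .

lemma S_class_zero_iff: "p \<in> carrier S_free \<Longrightarrow> \<pi> p = \<zero>\<^bsub>S n lam mu gam\<^esub> \<longleftrightarrow> p \<in> N"
  using F.quotient_coset_zero_iff[OF S_submodule(1), of p] unfolding S_def S_class_def .

lemma S_class_eq: 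
  assumes p: "p \<in> carrier S_free"
  shows "\<pi> p = free_map (S n lam mu gam) (\<pi> free_s) (\<pi> free_w) p"
proof -
  interpret R: ring "DJ :: 'k dj ring" by (rule ring_DJ)
  have AB: "fst p \<in> carrier DJ" "snd p \<in> carrier DJ" using p by (auto simp: S_free_simps)
  have "p = fst p \<odot>\<^bsub>S_free\<^esub> free_s \<oplus>\<^bsub>S_free\<^esub> snd p \<odot>\<^bsub>S_free\<^esub> free_w"
    using AB by (simp add: S_free_simps prod_eq_iff)
  then have "\<pi> p = \<pi> (fst p \<odot>\<^bsub>S_free\<^esub> free_s \<oplus>\<^bsub>S_free\<^esub> snd p \<odot>\<^bsub>S_free\<^esub> free_w)" by (rule arg_cong)
  also have "\<dots> = fst p \<odot>\<^bsub>S n lam mu gam\<^esub> \<pi> free_s \<oplus>\<^bsub>S n lam mu gam\<^esub> snd p \<odot>\<^bsub>S n lam mu gam\<^esub> \<pi> free_w"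
    unfolding module_hom_add[OF S_class_hom F.smult_closed[OF AB(1) free_unit_closed(1)]
        F.smult_closed[OF AB(2) free_unit_closed(2)]]
      module_hom_smult[OF S_class_hom AB(1) free_unit_closed(1)]
      module_hom_smult[OF S_class_hom AB(2) free_unit_closed(2)] ..
  finally show ?thesis by (simp add: free_map_def)
qed

lemma S_class_in: "p \<in> carrier S_free \<Longrightarrow> \<pi> p \<in> carrier (S n lam mu gam)"
  by (simp add: S_carrier)

lemma S_jordan_pair: "jordan_pair (S n lam mu gam) n lam mu gam (\<pi> free_s) (\<pi> free_w)"
proof -
  interpret dj_module "S n lam mu gam" by (rule dj_module.intro) (rule S_left_module)
  have "free_map (S n lam mu gam) (\<pi> free_s) (\<pi> free_w) r = \<zero>\<^bsub>S n lam mu gam\<^esub>"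
    if "r \<in> S_relators n lam mu gam" for r
  proof -
    have r: "r \<in> carrier S_free" using that S_relators_closed by blast
    have "\<pi> r = \<zero>\<^bsub>S n lam mu gam\<^esub>" using S_class_zero_iff[OF r] that S_submodule(2) by blast
    then show ?thesis unfolding S_class_eq[OF r] .
  qed
  then show ?thesis
    using jordan_pair_iff[OF S_class_in S_class_in, OF free_unit_closed] by blast
qed

lemma S_generated:
  assumes K: "Module.submodule K DJ (S n lam mu gam)" and "\<pi> free_s \<in> K" "\<pi> free_w \<in> K"
  shows "carrier (S n lam mu gam) \<subseteq> K"
proof
  fix t assume "t \<in> carrier (S n lam mu gam)"
  then obtain p where p: "p \<in> carrier S_free" "t = \<pi> p" by (auto simp: S_carrier)
  have AB: "fst p \<in> carrier DJ" "snd p \<in> carrier DJ" using p by (auto simp: S_free_simps)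
  have "t = fst p \<odot>\<^bsub>S n lam mu gam\<^esub> \<pi> free_s \<oplus>\<^bsub>S n lam mu gam\<^esub> snd p \<odot>\<^bsub>S n lam mu gam\<^esub> \<pi> free_w"
    using S_class_eq[OF p(1)] p(2) by (simp add: free_map_def)
  moreover have "x \<oplus>\<^bsub>S n lam mu gam\<^esub> y \<in> K" if "x \<in> K" "y \<in> K" for x y
    using K that subgroup.m_closed[of K "add_monoid (S n lam mu gam)"] by (auto simp: Module.submodule_def)
  ultimately show "t \<in> K" using assms AB by (simp add: Module.submodule.smult_closed)
qed

end

context jordan_pair begin

lemma E_highest: "E (unitv 0, 0) = s" "E (0, unitv 0) = w"
  by (simp_all add: E_unit)

text \<open>By \<open>E_intertwines\<close> the image of \<open>E\<close> is a submodule, so it is everything if \<open>s\<close> and \<open>w\<close> generate.\<close>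

lemma E_surj:
  assumes gen: "\<And>K. Module.submodule K DJ T \<Longrightarrow> s \<in> K \<Longrightarrow> w \<in> K \<Longrightarrow> carrier T \<subseteq> K"
  shows "carrier T = E ` (finsupp \<times> finsupp)"
proof
  have "Module.submodule (E ` (finsupp \<times> finsupp)) DJ T"
  proof (rule dj_submoduleI)
    show "\<zero> \<in> E ` (finsupp \<times> finsupp)"
      using E_0 finsupp_closed(1)[where 'k = 'k] by (metis SigmaI image_eqI)
    fix x assume "x \<in> E ` (finsupp \<times> finsupp)"
    then obtain m where m: "m \<in> finsupp \<times> finsupp" "x = E m" by blast
    show "gact T g x \<in> E ` (finsupp \<times> finsupp)" for g
      unfolding m(2) E_intertwines[OF m(1), symmetric] using verma_ext_finsupp[OF m(1)] by (rule imageI)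
    have "scale2 c m \<in> finsupp \<times> finsupp" for c
      using m(1) by (simp add: scale2_def mem_Times_iff finsupp_closed)
    then show "cact T c x \<in> E ` (finsupp \<times> finsupp)" for c
      unfolding m(2) E_scale[symmetric] by (rule imageI)
    fix y assume "y \<in> E ` (finsupp \<times> finsupp)"
    then obtain m' where m': "m' \<in> finsupp \<times> finsupp" "y = E m'" by blast
    have "m + m' \<in> finsupp \<times> finsupp" using m(1) m'(1) by (simp add: mem_Times_iff finsupp_closed)
    then show "x \<oplus> y \<in> E ` (finsupp \<times> finsupp)" unfolding m(2) m'(2) E_add[symmetric] by (rule imageI)
  qed auto
  moreover have "s \<in> E ` (finsupp \<times> finsupp)" "w \<in> E ` (finsupp \<times> finsupp)"
    using E_highest unit_finsupp[of 0] by (metis image_eqI)+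
  ultimately show "carrier T \<subseteq> E ` (finsupp \<times> finsupp)" by (rule gen)
qed auto

end

subsection \<open>The model is isomorphic to \<open>S\<close>\<close>

lemma unitv_supp: "(unitv 0 :: nat \<Rightarrow> 'k::field) \<in> supp n" by (simp add: supp_def unitv_def)

lemma ext_units_closed:
  "(unitv 0, 0) \<in> carrier (ext_module n gam :: ('k::field_char_0 dj, _) module)"
  "(0, unitv 0) \<in> carrier (ext_module n gam :: ('k::field_char_0 dj, _) module)"
  by (simp_all add: ext_module(2) unitv_supp supp_closed)

lemma trunc_shift: "trunc n (shift (trunc n f)) = trunc n (shift f)" for f :: "nat \<Rightarrow> 'k::field"
  using trunc_verma[of n Gy f] by simp

lemma trunc_0 [simp]: "trunc n 0 = (0 :: nat \<Rightarrow> 'k::field)" by (simp add: trunc_def zero_fun_def)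
lemma shift_0 [simp]: "shift 0 = (0 :: nat \<Rightarrow> 'k::field)" by (simp add: shift_def zero_fun_def fun_eq_iff split: nat.split)

lemma ext_gact_y:
  "gact (ext_module n gam) Gy (trunc n f, trunc n h) = (trunc n (shift f), trunc n (shift h))"
  for f h :: "nat \<Rightarrow> 'k::field_char_0"
  by (simp add: ext_module(5) ext_gen_action_def verma_ext_def trunc_shift zero_fun_def[symmetric])

lemma ext_module_pair:
  fixes gam :: "'k::field_char_0"
  shows "jordan_pair (ext_module n gam) n (- (of_nat n / 2) * gam) 0 gam (unitv 0, 0) (0, unitv 0)"
proof -
  interpret dj_module "ext_module n gam" by (rule dj_module.intro) (rule ext_module(1))
  have t0: "trunc n (unitv 0) = (unitv 0 :: nat \<Rightarrow> 'k)" by (rule trunc_id[OF unitv_supp])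
  have pow: "ypow (unitv 0, 0) i = (trunc n (unitv i), 0)" "ypow (0, unitv 0) i = (0, trunc n (unitv i))" for i
    using ext_gact_y[of n gam "unitv i" 0 for i] ext_gact_y[of n gam 0 "unitv i" for i]
    by (induction i) (simp_all add: t0 shift_unitv)
  have top: "trunc n (unitv (Suc n)) = (0 :: nat \<Rightarrow> 'k)" by (auto simp: trunc_def unitv_def fun_eq_iff)
  note closed = ext_units_closed[where 'k = 'k, unfolded ext_module(2)]
  show ?thesis
  proof
    show "ypow (unitv 0, 0) (Suc n) = \<zero>\<^bsub>ext_module n gam\<^esub>" "ypow (0, unitv 0) (Suc n) = \<zero>\<^bsub>ext_module n gam\<^esub>"
      unfolding pow top ext_module(4) by simp_all
    show "gact (ext_module n gam) Gx (0, unitv 0) = cact (ext_module n gam) gam (gact (ext_module n gam) Gy (unitv 0, 0))"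
      unfolding ext_module(5)[OF closed(1)] ext_module(5)[OF closed(2)] ext_gen_action_def
      by (subst ext_module(6)) (auto simp: verma_ext_def scale2_def trunc_def supp_def scale1_def fun_eq_iff)
  qed (simp_all only: ext_units_closed ext_module(3,4) ext_module(5)[OF closed(1)] ext_module(5)[OF closed(2)]
      ext_module(6)[OF closed(1)] ext_module(6)[OF closed(2)],
      (rule pair_fun_eqI; case_tac i; simp add: ext_gen_action_def verma_ext_def trunc_def scale2_def scale1_def unitv_def
        field_simps)+)
qed

lemma trunc2_hom:
  "map_prod (trunc n) (trunc n) (m + m') = map_prod (trunc n) (trunc n) m + map_prod (trunc n) (trunc n) m'"
  "map_prod (trunc n) (trunc n) (scale2 c m) = scale2 c (map_prod (trunc n) (trunc n) m)"
  for m m' :: "'k::field fpair"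
  by (cases m; cases m'; simp add: trunc_linear) (cases m; simp add: scale2_def trunc_linear)

lemma trunc2_closed: "map_prod (trunc n) (trunc n) m \<in> supp n \<times> supp n" by (cases m) simp

lemma trunc2_id: "m \<in> supp n \<times> supp n \<Longrightarrow> map_prod (trunc n) (trunc n) m = m"
  by (cases m) (simp add: trunc_id)

lemma supp2_finsupp: "m \<in> supp n \<times> supp n \<Longrightarrow> m \<in> finsupp \<times> finsupp"
  by (auto simp: finsupp_def)

lemma ext_gact_trunc:
  fixes m :: "'k::field_char_0 fpair"
  shows "gact (ext_module n gam) Gy (map_prod (trunc n) (trunc n) m)
    = map_prod (trunc n) (trunc n) (shift (fst m), shift (snd m))"
  using ext_gact_y[of n gam "fst m" "snd m"] by (cases m) simp

lemma free_map_ext_surj: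
  fixes gam :: "'k::field_char_0"
  shows "free_map (ext_module n gam) (unitv 0, 0) (0, unitv 0) ` carrier S_free = carrier (ext_module n gam)"
    (is "?f ` _ = _")
proof
  interpret dj_module "ext_module n gam" by (rule dj_module.intro) (rule ext_module(1))
  interpret F: left_module DJ "S_free :: ('k dj, _) module" by (rule S_free_module)
  note hom = free_map_hom[OF ext_units_closed[of n gam]]
  note unit = free_map_unit[OF ext_units_closed[of n gam]]
  show "?f ` carrier S_free \<subseteq> carrier (ext_module n gam)" using module_hom_in[OF hom] by blast
  show "carrier (ext_module n gam) \<subseteq> ?f ` carrier S_free"
  proof
    fix m assume "m \<in> carrier (ext_module n gam)"
    then have m: "m \<in> supp n \<times> supp n" by (simp only: ext_module(2))
    have "map_prod (trunc n) (trunc n) m \<in> ?f ` carrier S_free"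
      using supp2_finsupp[OF m]
    proof (induction rule: finsupp_pair_induct)
      case unit1
      have "map_prod (trunc n) (trunc n) (unitv 0, 0) = ((unitv 0, 0) :: 'k fpair)"
        by (simp add: trunc_id unitv_supp)
      then show ?case by (simp only:) (rule image_eqI[of _ ?f, OF unit(1)[symmetric] free_unit_closed(1)])
    next
      case unit2
      have "map_prod (trunc n) (trunc n) (0, unitv 0) = ((0, unitv 0) :: 'k fpair)"
        by (simp add: trunc_id unitv_supp)
      then show ?case by (simp only:) (rule image_eqI[of _ ?f, OF unit(2)[symmetric] free_unit_closed(2)])
    next
      case (add m m')
      then obtain q q' where q: "q \<in> carrier S_free" "map_prod (trunc n) (trunc n) m = ?f q"
        "q' \<in> carrier S_free" "map_prod (trunc n) (trunc n) m' = ?f q'" by blast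
      have "map_prod (trunc n) (trunc n) (m + m') = ?f (q \<oplus>\<^bsub>S_free\<^esub> q')"
        unfolding trunc2_hom q module_hom_add[OF hom q(1,3)] ext_module(3) ..
      then show ?case using F.M.a_closed[OF q(1,3)] by (rule image_eqI)
    next
      case (scale c m)
      then obtain q where q: "q \<in> carrier S_free" "map_prod (trunc n) (trunc n) m = ?f q" by blast
      have "map_prod (trunc n) (trunc n) (scale2 c m) = ?f (dj_const c \<odot>\<^bsub>S_free\<^esub> q)"
        unfolding trunc2_hom module_hom_smult[OF hom dj_const_simps(4) q(1)] q(2)[symmetric]
          ext_module(6)[OF trunc2_closed] ..
      then show ?case using F.smult_closed[OF dj_const_simps(4) q(1)] by (rule image_eqI)
    next
      case (y m)
      then obtain q where q: "q \<in> carrier S_free" "map_prod (trunc n) (trunc n) m = ?f q" by blast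
      have "map_prod (trunc n) (trunc n) (shift (fst m), shift (snd m)) = ?f (dj_gen_elem Gy \<odot>\<^bsub>S_free\<^esub> q)"
        unfolding module_hom_smult[OF hom dj_const_simps(5) q(1)] q(2)[symmetric] ext_gact_trunc ..
      then show ?case using F.smult_closed[OF dj_const_simps(5) q(1)] by (rule image_eqI)
    qed
    then show "m \<in> ?f ` carrier S_free" by (simp only: trunc2_id[OF m])
  qed
qed

text \<open>The kernel of the map from the free module to the model contains the relators. It is not larger
  than the submodule that they generate, because the composite with \<open>E\<close> is the projection to \<open>S\<close>.\<close>

lemma ext_module_iso_S:
  fixes gam :: "'k::field_char_0" and n :: nat
  defines "lam \<equiv> - (of_nat n / 2) * gam"
  shows "jordan_pair.E (S n lam 0 gam) n (S_class n lam 0 gam free_s) (S_class n lam 0 gam free_w)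
    \<in> module_iso DJ (ext_module n gam) (S n lam 0 gam)"
proof -
  let ?f = "free_map (ext_module n gam) (unitv 0, 0) (0, unitv 0)"
  let ?N = "generated_submodule DJ S_free (S_relators n lam 0 gam)"
  let ?K = "{p \<in> carrier S_free. ?f p = \<zero>\<^bsub>ext_module n gam\<^esub>}"
  interpret X: dj_module "ext_module n gam" by (rule dj_module.intro) (rule ext_module(1))
  note hom = X.free_map_hom[OF ext_units_closed[of n gam]]
  have sub: "?N \<subseteq> ?K"
  proof (rule generated_submodule_least)
    show "Module.submodule ?K DJ S_free" by (rule kernel_submodule[OF S_free_module ext_module(1) hom])
    show "S_relators n lam 0 gam \<subseteq> ?K"
      using X.jordan_pair_iff[OF ext_units_closed, of n lam 0 gam] ext_module_pair[of n gam] S_relators_closed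
      unfolding lam_def
      by blast
  qed
  interpret Q: jordan_pair "S n lam 0 gam" n lam 0 gam "S_class n lam 0 gam free_s" "S_class n lam 0 gam free_w"
    by (rule S_jordan_pair)
  have h: "Q.E \<in> module_hom DJ (ext_module n gam) (S n lam 0 gam)" by (rule Q.E_hom) (simp_all add: lam_def)
  have E_f: "Q.E (?f p) = S_class n lam 0 gam p" if p: "p \<in> carrier S_free" for p
  proof -
    have AB: "fst p \<in> carrier DJ" "snd p \<in> carrier DJ" using p by (auto simp: S_free_simps)
    show ?thesis
      unfolding S_class_eq[OF p] free_map_def
        module_hom_add[OF h X.smult_closed[OF AB(1) ext_units_closed(1)] X.smult_closed[OF AB(2) ext_units_closed(2)]]
        module_hom_smult[OF h AB(1) ext_units_closed(1)] module_hom_smult[OF h AB(2) ext_units_closed(2)]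
        Q.E_highest ..
  qed
  have "inj_on Q.E (carrier (ext_module n gam))"
  proof (rule module_hom_inj_onI[OF ext_module(1) S_left_module h])
    fix m assume "m \<in> carrier (ext_module n gam)" and 0: "Q.E m = \<zero>\<^bsub>S n lam 0 gam\<^esub>"
    then obtain p where p: "p \<in> carrier S_free" "m = ?f p" using free_map_ext_surj[of n gam] by blast
    then have "p \<in> ?N" using E_f[OF p(1)] 0 S_class_zero_iff[OF p(1)] by simp
    then show "m = \<zero>\<^bsub>ext_module n gam\<^esub>" using sub p(2) by blast
  qed
  moreover have "Q.E ` carrier (ext_module n gam) = carrier (S n lam 0 gam)"
    unfolding free_map_ext_surj[symmetric] S_carrier image_image by (rule image_cong[OF refl E_f])
  ultimately show ?thesis using h by (simp add: module_iso_def bij_betw_def)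
qed

lemma S_gamma_isomorphic: "modules_isomorphic DJ (ext_module n gam) (S_gamma n (gam :: 'k::field_char_0))"
  using ext_module_iso_S[of n gam] unfolding modules_isomorphic_def S_gamma_def by blast

subsection \<open>The model is an extension\<close>

lemma ext_module_short_exact:
  "short_exact DJ (L n) (\<lambda>f. (f, 0)) (ext_module n gam) snd (L n)" for gam :: "'k::field_char_0"
  unfolding short_exact_def
proof (intro conjI L_module(1) ext_module(1))
  show "(\<lambda>f. (f, 0)) \<in> module_hom DJ (L n) (ext_module n gam)"
  proof (rule dj_module_homI[OF L_module(1) ext_module(1)])
    fix f c g assume "f \<in> carrier (L n :: ('k dj, _) module)"
    then have f: "f \<in> supp n" by (simp only: L_module(2))
    then have f0: "(f, 0) \<in> supp n \<times> supp n" by (simp add: supp_closed)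
    then show "(f, 0) \<in> carrier (ext_module n gam)" by (simp only: ext_module(2))
    show "(cact (L n) c f, 0) = cact (ext_module n gam) c (f, 0)"
      unfolding ext_module(6)[OF f0] L_module(6)[OF f] by (simp add: scale2_def scale1_def fun_eq_iff)
    show "(gact (L n) g f, 0) = gact (ext_module n gam) g (f, 0)"
      unfolding ext_module(5)[OF f0] L_module(5)[OF f] 
      by (cases g; simp add: ext_gen_action_def verma_ext_def; simp add: trunc_def fun_eq_iff)
  qed (simp add: ext_module(3) L_module(3))
  show "snd \<in> module_hom DJ (ext_module n gam) (L n)"
  proof (rule dj_module_homI[OF ext_module(1) L_module(1)])
    fix m and c :: 'k and g assume "m \<in> carrier (ext_module n gam)"
    then have m: "m \<in> supp n \<times> supp n" by (simp only: ext_module(2))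
    then have m2: "snd m \<in> supp n" by auto
    then show "snd m \<in> carrier (L n :: ('k dj, _) module)" by (simp only: L_module(2))
    show "snd (cact (ext_module n gam) c m) = cact (L n) c (snd m)"
      unfolding ext_module(6)[OF m] L_module(6)[OF m2] by (simp add: scale2_def)
    show "snd (gact (ext_module n gam) g m) = gact (L n) g (snd m)"
      unfolding ext_module(5)[OF m] L_module(5)[OF m2] by (simp add: ext_gen_action_def verma_ext_def)
  qed (simp add: ext_module(3) L_module(3))
  show "inj_on (\<lambda>f. (f, 0)) (carrier (L n))" by (simp add: inj_on_def)
  show "(\<lambda>f. (f, 0)) ` carrier (L n) = {t \<in> carrier (ext_module n gam). snd t = \<zero>\<^bsub>L n\<^esub>}"
    unfolding L_module(2,4) ext_module(2) using supp_closed(1)[of n] by auto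
  show "snd ` carrier (ext_module n gam) = carrier (L n)"
    unfolding L_module(2) ext_module(2) using supp_closed(1)[of n] by (metis empty_iff snd_image_times)
qed

lemma short_exact_transport:
  assumes "short_exact R M i T p P" and h: "h \<in> module_iso R T T'" and T': "left_module R T'"
  shows "short_exact R M (h \<circ> i) T' (p \<circ> inv_into (carrier T) h) P"
proof -
  have T: "left_module R T" and i: "i \<in> module_hom R M T" and p: "p \<in> module_hom R T P"
    and inj: "inj_on i (carrier M)" and ker: "i ` carrier M = {t \<in> carrier T. p t = \<zero>\<^bsub>P\<^esub>}"
    and surj: "p ` carrier T = carrier P"
    using assms by (auto simp: short_exact_def)
  let ?k = "inv_into (carrier T) h"
  have hh: "h \<in> module_hom R T T'" and bij: "bij_betw h (carrier T) (carrier T')"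
    using h by (auto simp: module_iso_def)
  have kh: "?k \<in> module_hom R T' T" and kbij: "bij_betw ?k (carrier T') (carrier T)"
    using module_iso_inv[OF T h] by (auto simp: module_iso_def)
  have iT: "i ` carrier M \<subseteq> carrier T" using module_hom_in[OF i] by blast
  have "(h \<circ> i) ` carrier M = h ` {t \<in> carrier T. p t = \<zero>\<^bsub>P\<^esub>}" by (simp only: image_comp[symmetric] ker)
  also have "\<dots> = {t \<in> carrier T'. (p \<circ> ?k) t = \<zero>\<^bsub>P\<^esub>}"
  proof (intro equalityI subsetI)
    fix t assume "t \<in> h ` {t \<in> carrier T. p t = \<zero>\<^bsub>P\<^esub>}"
    then show "t \<in> {t \<in> carrier T'. (p \<circ> ?k) t = \<zero>\<^bsub>P\<^esub>}" using bij by (auto simp: bij_betw_def)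
  next
    fix t assume t: "t \<in> {t \<in> carrier T'. (p \<circ> ?k) t = \<zero>\<^bsub>P\<^esub>}"
    then have "h (?k t) = t" "?k t \<in> carrier T"
      using bij by (auto simp: bij_betw_def f_inv_into_f inv_into_into)
    then show "t \<in> h ` {t \<in> carrier T. p t = \<zero>\<^bsub>P\<^esub>}" using t by (intro image_eqI[of _ _ "?k t"]) auto
  qed
  finally have ker': "(h \<circ> i) ` carrier M = {t \<in> carrier T'. (p \<circ> ?k) t = \<zero>\<^bsub>P\<^esub>}" .
  have "inj_on (h \<circ> i) (carrier M)"
    using inj bij iT by (intro comp_inj_on) (auto simp: bij_betw_def intro: inj_on_subset)
  moreover have "(p \<circ> ?k) ` carrier T' = carrier P"
    using kbij surj by (simp only: image_comp[symmetric] bij_betw_def)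
  ultimately show ?thesis
    using assms(1) T' ker' module_hom_comp[OF i hh] module_hom_comp[OF kh p] by (simp add: short_exact_def)
qed

subsection \<open>Every extension is equivalent to a model\<close>

lemma (in dj_module) xi_relations:
  assumes t: "t \<in> carrier T"
  shows "gact T Gxi (gact T Gu t) = gact T Gu (gact T Gxi t) \<oplus> cact T 2 (gact T Gu t)"
    "gact T Gxi (gact T Gv t) = gact T Gv (gact T Gxi t) \<oplus> cact T 2 (gact T Gv t)"
    "gact T Gxi (gact T Gx t) = gact T Gx (gact T Gxi t) \<oplus> cact T (- 2) (gact T Gx t)"
    "gact T Gxi (gact T Gg t) = gact T Gg (gact T Gxi t)"
proof -
  note rel = act_relation[OF _ t] and S = act_simps t cact_cact gact_cact
  have "act T (fa_gen Gu * fa_gen Gxi) t = act T (fa_gen Gxi * fa_gen Gu - 2 * fa_gen Gu) t"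
    by (rule rel) (simp add: dj_relators_def Let_def)
  then show "gact T Gxi (gact T Gu t) = gact T Gu (gact T Gxi t) \<oplus> cact T 2 (gact T Gu t)"
    by (simp add: S M.a_assoc cact_add_left[symmetric])
  have "act T (fa_gen Gv * fa_gen Gxi) t = act T (fa_gen Gxi * fa_gen Gv - 2 * fa_gen Gv) t"
    by (rule rel) (simp add: dj_relators_def Let_def)
  then show "gact T Gxi (gact T Gv t) = gact T Gv (gact T Gxi t) \<oplus> cact T 2 (gact T Gv t)"
    by (simp add: S M.a_assoc cact_add_left[symmetric])
  have "act T (fa_gen Gxi * fa_gen Gx) t = act T (fa_gen Gx * fa_gen Gxi - 2 * fa_gen Gx) t"
    by (rule rel) (simp add: dj_relators_def Let_def)
  then show "gact T Gxi (gact T Gx t) = gact T Gx (gact T Gxi t) \<oplus> cact T (- 2) (gact T Gx t)"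
    by (simp add: S)
  have "act T (fa_gen Gxi * fa_gen Gg) t = act T (fa_gen Gg * fa_gen Gxi) t"
    by (rule rel) (simp add: dj_relators_def Let_def)
  then show "gact T Gxi (gact T Gg t) = gact T Gg (gact T Gxi t)" by (simp add: S)
qed

text \<open>A lift \<open>w\<close> of the highest weight vector of the quotient can be corrected so that \<open>\<xi> w - n w\<close> is
  a multiple of \<open>s\<close>. Then \<open>u w\<close>, \<open>v w\<close> and \<open>y\<^sup>n\<^sup>+\<^sup>1 w\<close> lie in the submodule \<open>L n\<close> and have weights
  \<open>n + 2\<close>, \<open>n + 2\<close> and \<open>- n - 2\<close>, which do not occur there, so they vanish. The elements \<open>g w - w\<close> and
  \<open>x w\<close> have weights \<open>n\<close> and \<open>n - 2\<close>, so they are multiples of \<open>s\<close> and of \<open>y s\<close>. Thus \<open>s\<close> and \<open>w\<close>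
  satisfy the relations of some \<open>S n lam mu gam\<close>, and \<open>s \<noteq> 0\<close> makes the parameters admissible.\<close>

lemma extension_classification:
  fixes T :: "('k::field_char_0 dj, 't) module"
  assumes ex: "short_exact DJ (L n) i T p (L n)"
  obtains gam h where "h \<in> module_iso DJ (ext_module n gam) T"
    "\<And>f. f \<in> supp n \<Longrightarrow> h (f, 0) = i f" "\<And>m. m \<in> supp n \<times> supp n \<Longrightarrow> p (h m) = snd m"
proof -
  have T: "left_module DJ T" and i: "i \<in> module_hom DJ (L n) T" and p: "p \<in> module_hom DJ T (L n)"
    and inj: "inj_on i (supp n)" and ker: "i ` supp n = {t \<in> carrier T. p t = 0}"
    and surj: "p ` carrier T = supp n"
    using ex by (simp_all add: short_exact_def L_module(2,4))
  interpret dj_module T by (rule dj_module.intro) (rule T)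
  have i_closed [simp]: "i f \<in> carrier T" if "f \<in> supp n" for f
    using module_hom_in[OF i, of f] that by (simp add: L_module(2))
  have i_add: "i (f + f') = i f \<oplus>\<^bsub>T\<^esub> i f'" if "f \<in> supp n" "f' \<in> supp n" for f f'
    using module_hom_add[OF i, of f f'] that by (simp add: L_module(2,3))
  have i_scale: "i (scale1 c f) = cact T c (i f)" if "f \<in> supp n" for c f
    using module_hom_smult[OF i dj_const_simps(4), of f c] that by (simp add: L_module(2,6))
  have i_gact: "gact T g (i f) = i (trunc n (verma n g f))" if "f \<in> supp n" for g f
    using module_hom_smult[OF i dj_const_simps(5), of f g] that by (simp add: L_module(2,5))
  have i_0: "i 0 = \<zero>\<^bsub>T\<^esub>" using module_hom_zero[OF L_module(1) T i] by (simp add: L_module(4))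
  have p_closed: "p t \<in> supp n" if "t \<in> carrier T" for t
    using module_hom_in[OF p that] by (simp add: L_module(2))
  have p_add: "p (t \<oplus>\<^bsub>T\<^esub> t') = p t + p t'" if "t \<in> carrier T" "t' \<in> carrier T" for t t'
    using module_hom_add[OF p that] by (simp add: L_module(3))
  have p_scale: "p (cact T c t) = scale1 c (p t)" if "t \<in> carrier T" for c t
    using module_hom_smult[OF p dj_const_simps(4) that, of c] p_closed[OF that] by (simp add: L_module(6))
  have p_gact: "p (gact T g t) = trunc n (verma n g (p t))" if "t \<in> carrier T" for g t
    using module_hom_smult[OF p dj_const_simps(5) that, of g] p_closed[OF that] by (simp add: L_module(5))
  have p_i: "p (i f) = 0" if "f \<in> supp n" for f using ker that by blast
  have from_ker: "\<exists>f\<in>supp n. t = i f" if "t \<in> carrier T" "p t = 0" for t using ker that by blast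

  \<comment> \<open>A weight vector in the kernel of \<open>p\<close> only involves the basis vectors of its weight.\<close>
  have weight: "\<exists>f\<in>supp n. t = i f \<and> (\<forall>j\<le>n. (of_nat n - 2 * of_nat j - c) * f j = 0)"
    if t: "t \<in> carrier T" "p t = 0" and xi: "gact T Gxi t = cact T c t" for t and c :: 'k
  proof -
    obtain f where f: "f \<in> supp n" "t = i f" using from_ker[OF t] by blast
    have "i (trunc n (verma n Gxi f)) = i (scale1 c f)"
      using xi unfolding f(2) i_gact[OF f(1)] i_scale[OF f(1)] .
    then have eq: "trunc n (verma n Gxi f) = scale1 c f"
      using inj f(1) by (meson inj_onD supp_closed(3) trunc_in_supp)
    have "(of_nat n - 2 * of_nat j - c) * f j = 0" if "j \<le> n" for j
      using fun_cong[OF eq, of j] that by (simp add: trunc_def scale1_def algebra_simps)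
    with f show ?thesis by blast
  qed
  have weight_0: "t = \<zero>\<^bsub>T\<^esub>" if t: "t \<in> carrier T" "p t = 0" "gact T Gxi t = cact T c t"
    and ne: "\<And>j. j \<le> n \<Longrightarrow> of_nat n - 2 * of_nat j \<noteq> c" for t and c :: 'k
  proof -
    obtain f where f: "f \<in> supp n" "t = i f" "\<forall>j\<le>n. (of_nat n - 2 * of_nat j - c) * f j = 0"
      using weight[OF t] by blast
    have "f j = 0" for j
    proof (cases "j \<le> n")
      case True
      then show ?thesis using f(3) ne[OF True] True by auto
    qed (use f(1) in \<open>simp add: supp_def\<close>)
    then have "f = 0" by (simp add: fun_eq_iff)
    then show ?thesis using f(2) i_0 by simp
  qed

  define s where "s = i (unitv 0)"
  have s: "s \<in> carrier T" by (simp add: s_def unitv_supp)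
  obtain w0 where w0: "w0 \<in> carrier T" "p w0 = unitv 0"
    using surj unitv_supp[where 'k = 'k] by (metis imageE)
  have "p (gact T Gxi w0 \<oplus>\<^bsub>T\<^esub> cact T (- of_nat n) w0) = 0"
    using w0 by (simp add: p_add p_gact p_scale) (auto simp: trunc_def scale1_def unitv_def fun_eq_iff)
  then obtain f where f: "f \<in> supp n" "gact T Gxi w0 \<oplus>\<^bsub>T\<^esub> cact T (- of_nat n) w0 = i f"
    using from_ker w0(1) by (metis M.a_closed cact_closed gact_closed)
  \<comment> \<open>On degree \<open>j\<close> the operator \<open>\<xi> - n\<close> is \<open>- 2 j\<close>, so \<open>b\<close> removes all components but that of degree 0.\<close>
  define b where "b = (\<lambda>j. if j = 0 then 0 else f j / (2 * of_nat j))"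
  have b: "b \<in> supp n" using f(1) by (auto simp: supp_def b_def)
  define w where "w = w0 \<oplus>\<^bsub>T\<^esub> i b"
  have w: "w \<in> carrier T" using w0 b by (simp add: w_def)
  define mu where "mu = f 0"
  have p_w: "p w = unitv 0" using w0 b by (simp add: w_def p_add p_i)
  have xi_w: "gact T Gxi w = cact T (of_nat n) w \<oplus>\<^bsub>T\<^esub> cact T mu s"
  proof -
    have "gact T Gxi w0 = cact T (of_nat n) w0 \<oplus>\<^bsub>T\<^esub> i f"
      unfolding f(2)[symmetric] using w0(1)
      by (simp add: M.a_lcomm[of "cact T (of_nat n) w0"] cact_add_left[symmetric])
    then have "gact T Gxi w = cact T (of_nat n) w0 \<oplus>\<^bsub>T\<^esub> (i f \<oplus>\<^bsub>T\<^esub> i (trunc n (verma n Gxi b)))"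
      using w0(1) b f(1) by (simp add: w_def gact_add i_gact M.a_assoc del: verma.simps)
    also have "i f \<oplus>\<^bsub>T\<^esub> i (trunc n (verma n Gxi b)) = i (scale1 (of_nat n) b + scale1 mu (unitv 0))"
    proof -
      have "f + trunc n (verma n Gxi b) = scale1 (of_nat n) b + scale1 mu (unitv 0)"
        using f(1) by (auto simp: fun_eq_iff trunc_def scale1_def b_def mu_def unitv_def supp_def field_simps)
      then show ?thesis using f(1) by (simp add: i_add[symmetric])
    qed
    also have "\<dots> = cact T (of_nat n) (i b) \<oplus>\<^bsub>T\<^esub> cact T mu s"
      using b by (simp add: i_add i_scale supp_closed unitv_supp s_def)
    finally show ?thesis using w0(1) b s by (simp add: w_def cact_add M.a_assoc)
  qed
  have i_s: "gact T g s = i (trunc n (verma n g (unitv 0)))" for g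
    unfolding s_def by (rule i_gact[OF unitv_supp])
  have trunc_unit: "trunc n (unitv 0) = (unitv 0 :: nat \<Rightarrow> 'k)" by (rule trunc_id[OF unitv_supp])
  have s0: "gact T Gu s = \<zero>\<^bsub>T\<^esub>" "gact T Gv s = \<zero>\<^bsub>T\<^esub>" "gact T Gx s = \<zero>\<^bsub>T\<^esub>" "gact T Gg s = s"
    "gact T Gxi s = cact T (of_nat n) s" "gact T Gy s = i (trunc n (unitv 1))"
  proof -
    have "trunc n (verma n Gu (unitv 0)) = (0 :: nat \<Rightarrow> 'k)" "trunc n (verma n Gv (unitv 0)) = (0 :: nat \<Rightarrow> 'k)"
      "trunc n (verma n Gx (unitv 0)) = (0 :: nat \<Rightarrow> 'k)" "trunc n (verma n Gg (unitv 0)) = (unitv 0 :: nat \<Rightarrow> 'k)"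
      "trunc n (verma n Gxi (unitv 0)) = (scale1 (of_nat n) (unitv 0) :: nat \<Rightarrow> 'k)"
      by (auto simp: trunc_def scale1_def unitv_def fun_eq_iff)
    then show "gact T Gu s = \<zero>\<^bsub>T\<^esub>" "gact T Gv s = \<zero>\<^bsub>T\<^esub>" "gact T Gx s = \<zero>\<^bsub>T\<^esub>" "gact T Gg s = s"
      "gact T Gxi s = cact T (of_nat n) s"
      unfolding i_s by (simp_all only: i_0 s_def i_scale[OF unitv_supp])
    show "gact T Gy s = i (trunc n (unitv 1))" unfolding i_s by (simp add: shift_unitv)
  qed
  have ypow_s: "ypow s k = i (trunc n (unitv k))" for k
    by (induction k) (simp_all add: s_def trunc_unit i_gact trunc_shift shift_unitv)
  have p_ypow_w: "p (ypow w k) = trunc n (unitv k)" for k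
    using w by (induction k) (simp_all add: p_w trunc_unit p_gact trunc_shift shift_unitv)
  have trunc_top: "trunc n (unitv (Suc n)) = (0 :: nat \<Rightarrow> 'k)"
    by (auto simp: trunc_def unitv_def fun_eq_iff)
  have xi_ypow_w: "gact T Gxi (ypow w k) = cact T (of_nat n - 2 * of_nat k) (ypow w k) \<oplus>\<^bsub>T\<^esub> cact T mu (ypow s k)" for k
  proof (induction k)
    case (Suc k)
    have "gact T Gxi (ypow w (Suc k))
        = cact T (of_nat n - 2 * of_nat k) (ypow w (Suc k)) \<oplus>\<^bsub>T\<^esub> cact T mu (ypow s (Suc k)) \<oplus>\<^bsub>T\<^esub> cact T (- 2) (ypow w (Suc k))"
      using w s by (simp add: y_relations(3) Suc gact_add gact_cact)
    also have "\<dots> = (cact T (of_nat n - 2 * of_nat k) (ypow w (Suc k)) \<oplus>\<^bsub>T\<^esub> cact T (- 2) (ypow w (Suc k)))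
        \<oplus>\<^bsub>T\<^esub> cact T mu (ypow s (Suc k))"
      using w s by (simp add: M.a_ac del: ypow_simps)
    also have "\<dots> = cact T (of_nat n - 2 * of_nat k + - 2) (ypow w (Suc k)) \<oplus>\<^bsub>T\<^esub> cact T mu (ypow s (Suc k))"
      using cact_add_left[OF ypow_closed[OF w], of "of_nat n - 2 * of_nat k" "- 2" "Suc k"] by simp
    also have "of_nat n - 2 * of_nat k + - 2 = (of_nat n - 2 * of_nat (Suc k) :: 'k)" by simp
    finally show ?case .
  qed (simp add: xi_w)
  have y_w: "ypow w (Suc n) = \<zero>\<^bsub>T\<^esub>"
  proof (rule weight_0)
    show "gact T Gxi (ypow w (Suc n)) = cact T (of_nat n - 2 * of_nat (Suc n)) (ypow w (Suc n))"
      using w s unfolding xi_ypow_w ypow_s trunc_top i_0 by (simp del: ypow_simps of_nat_Suc)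
    show "of_nat n - 2 * of_nat j \<noteq> (of_nat n - 2 * of_nat (Suc n) :: 'k)" if "j \<le> n" for j
      using that by (simp del: of_nat_Suc)
  qed (use w in \<open>simp_all add: p_ypow_w trunc_top del: ypow_simps\<close>)
  have weight_ne: "of_nat n - 2 * of_nat j \<noteq> (of_nat n + 2 :: 'k)" for j
  proof
    assume "of_nat n - 2 * of_nat j = (of_nat n + 2 :: 'k)"
    then have "2 * of_nat (Suc j) = (0 :: 'k)" by (simp add: algebra_simps eq_neg_iff_add_eq_0)
    then show False by (simp del: of_nat_Suc)
  qed
  have u_w: "gact T Gu w = \<zero>\<^bsub>T\<^esub>"
  proof (rule weight_0)
    show "p (gact T Gu w) = 0" using w by (simp add: p_gact p_w) (simp add: trunc_def fun_eq_iff)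
    show "gact T Gxi (gact T Gu w) = cact T (of_nat n + 2) (gact T Gu w)"
      using w s by (simp add: xi_relations xi_w gact_add gact_cact s0 cact_add_left)
    show "of_nat n - 2 * of_nat j \<noteq> (of_nat n + 2 :: 'k)" for j by (rule weight_ne)
  qed (use w in simp)
  have v_w: "gact T Gv w = \<zero>\<^bsub>T\<^esub>"
  proof (rule weight_0)
    show "p (gact T Gv w) = 0" using w by (simp add: p_gact p_w) (auto simp: trunc_def unitv_def fun_eq_iff)
    show "gact T Gxi (gact T Gv w) = cact T (of_nat n + 2) (gact T Gv w)"
      using w s by (simp add: xi_relations xi_w gact_add gact_cact s0 cact_add_left)
    show "of_nat n - 2 * of_nat j \<noteq> (of_nat n + 2 :: 'k)" for j by (rule weight_ne)
  qed (use w in simp)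
  obtain lam where g_w: "gact T Gg w = w \<oplus>\<^bsub>T\<^esub> cact T lam s"
  proof -
    have "gact T Gxi (gact T Gg w \<oplus>\<^bsub>T\<^esub> cact T (- 1) w) = cact T (of_nat n) (gact T Gg w \<oplus>\<^bsub>T\<^esub> cact T (- 1) w)"
    proof -
      have "gact T Gxi (gact T Gg w) = cact T (of_nat n) (gact T Gg w) \<oplus>\<^bsub>T\<^esub> cact T mu s"
        using w s by (simp add: xi_relations xi_w gact_add gact_cact s0)
      moreover have "gact T Gxi (cact T (- 1) w) = cact T (- of_nat n) w \<oplus>\<^bsub>T\<^esub> cact T (- mu) s"
        using w s by (simp add: gact_cact xi_w cact_add cact_cact)
      moreover have "cact T mu s \<oplus>\<^bsub>T\<^esub> cact T (- mu) s = \<zero>\<^bsub>T\<^esub>"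
        using cact_add_left[OF s, of mu "- mu"] s by simp
      ultimately show ?thesis
        using w s M.a_lcomm[of "cact T mu s" "cact T (- of_nat n) w" "cact T (- mu) s"]
        by (simp add: gact_add cact_add cact_cact M.a_assoc)
    qed
    moreover have "p (gact T Gg w \<oplus>\<^bsub>T\<^esub> cact T (- 1) w) = 0"
      using w by (simp add: p_add p_gact p_scale p_w) (auto simp: trunc_def unitv_def scale1_def fun_eq_iff)
    ultimately obtain h where h: "h \<in> supp n" "gact T Gg w \<oplus>\<^bsub>T\<^esub> cact T (- 1) w = i h"
        "\<forall>j\<le>n. (of_nat n - 2 * of_nat j - of_nat n) * h j = 0"
      using weight[of "gact T Gg w \<oplus>\<^bsub>T\<^esub> cact T (- 1) w" "of_nat n"] w by auto
    have "h = scale1 (h 0) (unitv 0)"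
    proof
      fix j
      show "h j = scale1 (h 0) (unitv 0) j"
        using h(1) spec[OF h(3), of j] by (cases "j \<le> n") (auto simp: supp_def scale1_def unitv_def)
    qed
    then have "i h = cact T (h 0) s" unfolding s_def by (metis i_scale unitv_supp)
    then have "gact T Gg w = w \<oplus>\<^bsub>T\<^esub> cact T (h 0) s"
      using h(2) w by (metis M.a_lcomm M.r_neg M.r_zero cact_closed cact_uminus gact_closed)
    then show thesis by (rule that)
  qed
  obtain gam where x_w: "gact T Gx w = cact T gam (gact T Gy s)"
  proof -
    have "gact T Gxi (gact T Gx w) = cact T (of_nat n - 2) (gact T Gx w)"
      using w s cact_add_left[of "gact T Gx w" "of_nat n" "- 2"]
      by (simp add: xi_relations xi_w gact_add gact_cact s0)
    moreover have "p (gact T Gx w) = 0" using w by (simp add: p_gact p_w) (simp add: trunc_def fun_eq_iff)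
    ultimately obtain h where h: "h \<in> supp n" "gact T Gx w = i h"
        "\<forall>j\<le>n. (of_nat n - 2 * of_nat j - (of_nat n - 2)) * h j = 0"
      using weight[of "gact T Gx w" "of_nat n - 2"] w by auto
    have "h = scale1 (h 1) (trunc n (unitv 1))"
    proof
      fix j
      have "(of_nat n - 2 * of_nat j - (of_nat n - 2)) = (2 * (1 - of_nat j) :: 'k)" by (simp add: algebra_simps)
      then show "h j = scale1 (h 1) (trunc n (unitv 1)) j"
        using h(1) spec[OF h(3), of j]
        by (cases "j \<le> n") (auto simp: supp_def scale1_def unitv_def trunc_def)
    qed
    then have "i h = cact T (h 1) (gact T Gy s)" unfolding s0 by (metis i_scale trunc_in_supp)
    then show thesis using h(2) that by simp
  qed
  have "jordan_pair T n lam mu gam s w"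
    by unfold_locales (use s w s0 u_w v_w g_w xi_w x_w y_w ypow_s[of "Suc n"] trunc_top i_0 in \<open>simp_all del: ypow_simps\<close>)
  then interpret P: jordan_pair T n lam mu gam s w .
  have s_ne: "s \<noteq> \<zero>\<^bsub>T\<^esub>"
  proof
    assume "s = \<zero>\<^bsub>T\<^esub>"
    then have "unitv 0 = (0 :: nat \<Rightarrow> 'k)"
      using inj i_0 unitv_supp[where 'k = 'k, of n] supp_closed(1)[of n] unfolding s_def by (metis inj_onD)
    then show False by (simp add: unitv_def fun_eq_iff) (metis zero_neq_one)
  qed
  have E: "P.E \<in> module_hom DJ (ext_module n gam) T"
    using P.E_hom P.s_zero_or_parameters[OF s_ne] by blast
  have val: "P.E (fst m, 0) = i (trunc n (fst m)) \<and> p (P.E m) = trunc n (snd m)"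
    if m: "m \<in> finsupp \<times> finsupp" for m
    using m
  proof (induction rule: finsupp_pair_induct)
    case unit1
    have "p s = 0" unfolding s_def by (rule p_i[OF unitv_supp])
    then show ?case unfolding fst_conv snd_conv P.E_highest trunc_unit trunc_0 s_def[symmetric] by simp
  next
    case unit2
    show ?case unfolding fst_conv snd_conv P.E_highest p_w trunc_unit trunc_0 i_0 using P.E_0 by blast
  next
    case (add m m')
    have "(fst (m + m'), 0) = (fst m, 0) + (fst m', 0 :: nat \<Rightarrow> 'k)" by simp
    then show ?case
      using add by (simp only: P.E_add fst_add snd_add trunc_linear i_add[OF trunc_in_supp trunc_in_supp]
          p_add[OF P.E_closed P.E_closed])
  next
    case (scale c m)
    have "(fst (scale2 c m), 0) = scale2 c (fst m, 0 :: nat \<Rightarrow> 'k)"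
      by (simp add: scale2_def scale1_def zero_fun_def)
    moreover have "fst (scale2 c m) = scale1 c (fst m)" "snd (scale2 c m) = scale1 c (snd m)"
      by (simp_all add: scale2_def)
    ultimately show ?case
      using scale by (simp only: P.E_scale trunc_linear i_scale[OF trunc_in_supp] p_scale[OF P.E_closed])
  next
    case (y m)
    have 1: "P.E (shift (fst m), shift (snd m)) = gact T Gy (P.E m)" for m
      using P.E_y[of m] by (simp add: verma_ext_def zero_fun_def[symmetric])
    have "P.E (shift (fst m), 0) = i (trunc n (shift (fst m)))"
      using 1[of "(fst m, 0)"] conjunct1[OF y]
      by (simp only: fst_conv snd_conv shift_0 i_gact[OF trunc_in_supp] verma.simps trunc_shift)
    moreover have "p (P.E (shift (fst m), shift (snd m))) = trunc n (shift (snd m))"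
      unfolding 1 p_gact[OF P.E_closed] conjunct2[OF y] verma.simps trunc_shift ..
    ultimately show ?case by (simp only: fst_conv snd_conv)
  qed
  have Ei: "P.E (f, 0) = i f" if f: "f \<in> supp n" for f
  proof -
    have "(f, 0) \<in> supp n \<times> supp n" using f supp_closed(1) by blast
    from conjunct1[OF val[OF supp2_finsupp[OF this]]] show ?thesis by (simp only: fst_conv trunc_id[OF f])
  qed
  have pE: "p (P.E m) = snd m" if "m \<in> supp n \<times> supp n" for m
    using val[OF supp2_finsupp[OF that]] that by (auto simp: trunc_id)
  have "inj_on P.E (carrier (ext_module n gam))"
  proof (rule module_hom_inj_onI[OF ext_module(1) T E])
    fix m assume m: "m \<in> carrier (ext_module n gam)" and 0: "P.E m = \<zero>\<^bsub>T\<^esub>"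
    then have m': "m \<in> supp n \<times> supp n" by (simp only: ext_module(2))
    have "p \<zero>\<^bsub>T\<^esub> = 0" using p_i[OF supp_closed(1)] i_0 by simp
    then have snd: "snd m = 0" using pE[OF m'] 0 by simp
    then have "i (fst m) = i 0" using Ei[of "fst m"] m' 0 i_0 by (cases m) auto
    then have "fst m = 0" using inj m' supp_closed(1)[of n] by (auto dest: inj_onD)
    with snd show "m = \<zero>\<^bsub>ext_module n gam\<^esub>" by (simp add: ext_module(4) prod_eq_iff)
  qed
  moreover have "P.E ` carrier (ext_module n gam) = carrier T"
  proof
    show "carrier T \<subseteq> P.E ` carrier (ext_module n gam)"
    proof
      fix t assume t: "t \<in> carrier T"
      let ?a = "(0, p t)"
      have a: "?a \<in> supp n \<times> supp n" using p_closed[OF t] by (simp add: supp_closed)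
      have "p (t \<oplus>\<^bsub>T\<^esub> cact T (- 1) (P.E ?a)) = 0"
        using t pE[OF a] by (simp add: p_add p_scale) (simp add: scale1_def fun_eq_iff)
      then obtain f where f: "f \<in> supp n" "t \<oplus>\<^bsub>T\<^esub> cact T (- 1) (P.E ?a) = i f"
        using from_ker[of "t \<oplus>\<^bsub>T\<^esub> cact T (- 1) (P.E ?a)"] t by auto
      have "t = i f \<oplus>\<^bsub>T\<^esub> P.E ?a"
        unfolding f(2)[symmetric] using t by (simp add: cact_uminus M.a_assoc M.l_neg)
      also have "\<dots> = P.E ((f, 0) + ?a)" unfolding P.E_add Ei[OF f(1)] ..
      finally have "t = P.E (f, p t)" by simp
      then show "t \<in> P.E ` carrier (ext_module n gam)"
        using f(1) p_closed[OF t] by (intro image_eqI[of _ _ "(f, p t)"]) (simp_all add: ext_module(2))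
    qed
  qed (use module_hom_in[OF E] in blast)
  ultimately have "P.E \<in> module_iso DJ (ext_module n gam) T"
    using E by (simp add: module_iso_def bij_betw_def)
  then show thesis using Ei pE by (rule that)
qed

section \<open>Dimensions\<close>

lemma restrict_scalars_simps:
  "carrier (restrict_scalars \<iota> T) = carrier T" "add (restrict_scalars \<iota> T) = add T"
  "zero (restrict_scalars \<iota> T) = zero T" "c \<odot>\<^bsub>restrict_scalars \<iota> T\<^esub> t = \<iota> c \<odot>\<^bsub>T\<^esub> t"
  by (simp_all add: restrict_scalars_def)

lemma vectorspace_restrict_scalars:
  fixes T :: "('k::field_char_0 dj, 't) module"
  assumes "left_module DJ T"
  shows "vectorspace ring_of_type_algebra (restrict_scalars dj_const T)"
proof -
  interpret dj_module T by (rule dj_module.intro) (rule assms)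
  have "\<exists>y\<in>carrier T. y \<oplus>\<^bsub>T\<^esub> x = \<zero>\<^bsub>T\<^esub>" if "x \<in> carrier T" for x
    using that M.l_neg by blast
  then have "abelian_group (restrict_scalars dj_const T)"
    by (intro abelian_groupI) (simp_all add: restrict_scalars_def M.a_ac)
  then have "module ring_of_type_algebra (restrict_scalars dj_const T)"
    by (intro moduleI cring_from_type_algebra)
      (simp_all add: restrict_scalars_def cact_add_left cact_add cact_cact)
  then show ?thesis by (intro vectorspace.intro field_from_type_algebra)
qed

lemma finsum_in_span:
  assumes V: "vectorspace K V" and "finite I" and b: "\<And>i. i \<in> I \<Longrightarrow> b i \<in> carrier V" "b ` I \<subseteq> B"
    and "B \<subseteq> carrier V" and f: "\<And>i. i \<in> I \<Longrightarrow> f i \<in> carrier K"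
  shows "(\<Oplus>\<^bsub>V\<^esub>i\<in>I. f i \<odot>\<^bsub>V\<^esub> b i) \<in> module.span K V B"
proof -
  interpret vectorspace K V by fact
  interpret S: LinearCombinations.submodule K "span B" V by (rule span_is_submodule[OF assms(5)])
  have "B \<subseteq> span B" by (rule in_own_span[OF assms(5)])
  with assms(2) b f show ?thesis
    by (induction I rule: finite_induct) (auto simp: finsum_insert Pi_def smult_closed)
qed

text \<open>The family need not be injective, hence the bound by the number of indices rather than of vectors.\<close>

lemma has_dim_le_card:
  fixes V :: "('k::field, 'v) module"
  assumes dim: "has_dim V d" and I: "finite I" and b: "\<And>i. i \<in> I \<Longrightarrow> b i \<in> carrier V"
    and span: "\<And>v. v \<in> carrier V \<Longrightarrow> \<exists>f. v = (\<Oplus>\<^bsub>V\<^esub>i\<in>I. f i \<odot>\<^bsub>V\<^esub> b i)"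
  shows "d \<le> card I"
proof -
  interpret vectorspace ring_of_type_algebra V using dim by (simp add: has_dim_def)
  have B: "b ` I \<subseteq> carrier V" using b by blast
  have "carrier V \<subseteq> span (b ` I)"
    using span finsum_in_span[OF vectorspace_axioms I b order.refl B] by fastforce
  then have "gen_set (b ` I)" using span_is_subset2[OF B] by blast
  then have "dim \<le> card (b ` I)" using I B by (intro gen_ge_dim) auto
  also have "\<dots> \<le> card I" by (rule card_image_le[OF I])
  finally show ?thesis using dim by (simp add: has_dim_def)
qed

lemma has_dimI:
  fixes V :: "('k::field, 'v) module"
  assumes V: "vectorspace ring_of_type_algebra V"
    and I: "finite I" and b: "\<And>i. i \<in> I \<Longrightarrow> b i \<in> carrier V" and inj: "inj_on b I"
    and span: "\<And>v. v \<in> carrier V \<Longrightarrow> \<exists>f. v = (\<Oplus>\<^bsub>V\<^esub>i\<in>I. f i \<odot>\<^bsub>V\<^esub> b i)"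
    and indep: "\<And>f i. (\<Oplus>\<^bsub>V\<^esub>i\<in>I. f i \<odot>\<^bsub>V\<^esub> b i) = \<zero>\<^bsub>V\<^esub> \<Longrightarrow> i \<in> I \<Longrightarrow> f i = 0"
  shows "has_dim V (card I)"
proof -
  interpret vectorspace ring_of_type_algebra V by fact
  have B: "b ` I \<subseteq> carrier V" using b by blast
  have "carrier V \<subseteq> span (b ` I)"
    using span finsum_in_span[OF vectorspace_axioms I b order.refl B] by fastforce
  then have gen: "gen_set (b ` I)" using span_is_subset2[OF B] by blast
  have "lin_indpt (b ` I)"
  proof (rule finite_lin_indpt2[OF finite_imageI[OF I] B])
    fix a assume "lincomb a (b ` I) = \<zero>\<^bsub>V\<^esub>"
    then have "(\<Oplus>\<^bsub>V\<^esub>i\<in>I. a (b i) \<odot>\<^bsub>V\<^esub> b i) = \<zero>\<^bsub>V\<^esub>"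
      unfolding lincomb_def using b by (subst (asm) finsum_reindex[OF _ inj]) auto
    from indep[of "\<lambda>i. a (b i)", OF this] show "\<forall>v\<in>b ` I. a v = \<zero>\<^bsub>ring_of_type_algebra\<^esub>" by auto
  qed
  then have basis: "basis (b ` I)" using gen B by (simp add: basis_def)
  have "dim = card I" using dim_basis[OF finite_imageI[OF I] basis] card_image[OF inj] by simp
  moreover have fin_dim unfolding fin_dim_def using I B gen by blast
  ultimately show ?thesis using V by (simp add: has_dim_def)
qed

text \<open>The map \<open>E\<close> as a linear combination of one family, indexed by the disjoint union of two copies of
  \<open>{..n}\<close>.\<close>

lemma (in jordan_pair) E_finsum:
  "(\<Oplus>\<^bsub>restrict_scalars dj_const T\<^esub>x\<in>{..n} <+> {..n}. f x \<odot>\<^bsub>restrict_scalars dj_const T\<^esub> case_sum (ypow s) (ypow w) x)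
    = E (f \<circ> Inl, f \<circ> Inr)"
proof -
  interpret V: vectorspace ring_of_type_algebra "restrict_scalars dj_const T"
    by (rule vectorspace_restrict_scalars[OF left_module_axioms])
  have V: "finsum (restrict_scalars dj_const T) h A = finsum T h A"
    if "finite A" "h \<in> A \<rightarrow> carrier T" for h :: "'c \<Rightarrow> 't" and A
    using that by (induction A rule: finite_induct) (auto simp: restrict_scalars_simps Pi_def)
  have sum: "(\<Oplus>x\<in>{..n} <+> {..n}. cact T (f x) (case_sum (ypow s) (ypow w) x)) = E (f \<circ> Inl, f \<circ> Inr)"
  proof -
    let ?h = "\<lambda>x. cact T (f x) (case_sum (ypow s) (ypow w) x)"
    have "finsum T ?h ({..n} <+> {..n}) = finsum T ?h (Inl ` {..n}) \<oplus> finsum T ?h (Inr ` {..n})"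
      unfolding Plus_def by (intro M.finsum_Un_disjoint) auto
    also have "finsum T ?h (Inl ` {..n}) = lin n (ypow s) (f \<circ> Inl)"
      by (subst M.finsum_reindex) (auto simp: lin_def)
    also have "finsum T ?h (Inr ` {..n}) = lin n (ypow w) (f \<circ> Inr)"
      by (subst M.finsum_reindex) (auto simp: lin_def)
    finally show ?thesis by (simp add: E_def comp_def)
  qed
  have "(\<lambda>x. f x \<odot>\<^bsub>restrict_scalars dj_const T\<^esub> case_sum (ypow s) (ypow w) x)
      = (\<lambda>x. cact T (f x) (case_sum (ypow s) (ypow w) x))"
    by (simp add: restrict_scalars_simps)
  moreover have "(\<lambda>x. cact T (f x) (case_sum (ypow s) (ypow w) x)) \<in> {..n} <+> {..n} \<rightarrow> carrier T"
    by auto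
  ultimately show ?thesis using V[of "{..n} <+> {..n}"] sum by simp
qed

text \<open>For inadmissible parameters \<open>s = 0\<close>, and the \<open>n + 1\<close> vectors \<open>y\<^sup>i w\<close> span; otherwise \<open>E\<close> is an
  isomorphism from the model.\<close>

lemma S_dim:
  fixes lam mu gam :: "'k::field_char_0"
  shows "has_dim (restrict_scalars dj_const (S n lam mu gam)) (2 * (n + 1))
    \<longleftrightarrow> lam + of_nat n / 2 * gam = 0 \<and> mu = 0"
proof -
  let ?S = "S n lam mu gam"
  let ?V = "restrict_scalars dj_const ?S"
  interpret jordan_pair ?S n lam mu gam "S_class n lam mu gam free_s" "S_class n lam mu gam free_w"
    by (rule S_jordan_pair)
  let ?s = "S_class n lam mu gam free_s" and ?w = "S_class n lam mu gam free_w"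
  let ?I = "{..n} <+> {..n}" and ?b = "case_sum (ypow ?s) (ypow ?w)"
  have V: "vectorspace ring_of_type_algebra ?V" by (rule vectorspace_restrict_scalars[OF S_left_module])
  have carrier: "carrier ?S = E ` (finsupp \<times> finsupp)" by (rule E_surj) (rule S_generated)
  show ?thesis
  proof
    assume dim: "has_dim ?V (2 * (n + 1))"
    have "?s \<noteq> \<zero>\<^bsub>?S\<^esub>"
    proof
      assume s0: "?s = \<zero>\<^bsub>?S\<^esub>"
      have "2 * (n + 1) \<le> card (Inr ` {..n} :: (nat + nat) set)"
      proof (rule has_dim_le_card[OF dim, of _ ?b])
        fix v assume "v \<in> carrier ?V"
        then obtain m where m: "v = E m" using carrier by (auto simp: restrict_scalars_simps)
        have y0: "ypow ?s i = \<zero>\<^bsub>?S\<^esub>" for i by (induction i) (simp_all add: s0)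
        let ?f = "case_sum (\<lambda>_ :: nat. 0) (snd m)"
        interpret V: vectorspace ring_of_type_algebra ?V by (rule V)
        have "v = E (?f \<circ> Inl, ?f \<circ> Inr)"
          unfolding m E_def by (simp add: comp_def y0) (simp add: lin_def y0)
        also have "\<dots> = (\<Oplus>\<^bsub>?V\<^esub>x\<in>?I. ?f x \<odot>\<^bsub>?V\<^esub> ?b x)" by (rule E_finsum[symmetric])
        also have "\<dots> = (\<Oplus>\<^bsub>?V\<^esub>x\<in>Inr ` {..n}. ?f x \<odot>\<^bsub>?V\<^esub> ?b x)"
          by (rule V.add.finprod_mono_neutral_cong_right) (auto simp: restrict_scalars_simps)
        finally show "\<exists>f. v = (\<Oplus>\<^bsub>?V\<^esub>x\<in>Inr ` {..n}. f x \<odot>\<^bsub>?V\<^esub> ?b x)" by blast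
      qed (auto simp: restrict_scalars_simps)
      also have "\<dots> \<le> n + 1" using card_image_le[of "{..n}" "Inr :: nat \<Rightarrow> nat + nat"] by simp
      finally show False by simp
    qed
    then show "lam + of_nat n / 2 * gam = 0 \<and> mu = 0" by (rule s_zero_or_parameters)
  next
    assume par: "lam + of_nat n / 2 * gam = 0 \<and> mu = 0"
    then have lam: "lam = - (of_nat n / 2) * gam" and mu: "mu = 0" by (simp_all add: eq_neg_iff_add_eq_0)
    have iso: "E \<in> module_iso DJ (ext_module n gam) ?S"
      using ext_module_iso_S[of n gam] unfolding lam mu .
    then have inj: "inj_on E (supp n \<times> supp n)" by (simp add: module_iso_def bij_betw_def ext_module(2))
    have zero: "f i = 0 \<and> h i = 0" if "E (f, h) = \<zero>\<^bsub>?S\<^esub>" "i \<le> n" for f h i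
    proof -
      have "E (trunc n f, trunc n h) = E (0, 0)"
        using that(1) E_cong[of "(trunc n f, trunc n h)" "(f, h)"] E_0 by (simp add: trunc_def)
      then have "(trunc n f, trunc n h) = (0, 0)"
        by (rule inj_onD[OF inj]) (simp_all add: supp_closed)
      then have "trunc n f i = (0 :: nat \<Rightarrow> 'k) i" "trunc n h i = (0 :: nat \<Rightarrow> 'k) i"
        by (simp_all only: prod.inject)
      then show ?thesis using that(2) by (simp add: trunc_def)
    qed
    let ?e = "case_sum (\<lambda>i. (unitv i, 0)) (\<lambda>i. (0, unitv i)) :: nat + nat \<Rightarrow> 'k fpair"
    have e_supp: "?e x \<in> supp n \<times> supp n" if "x \<in> ?I" for x
      using that by (auto simp: supp_def unitv_def)
    have e_inj: "x = y" if "?e x = ?e y" for x y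
      using that by (cases x; cases y) (auto simp: unitv_def fun_eq_iff split: if_splits)
    have b_e: "?b x = E (?e x)" if "x \<in> ?I" for x
      using that by (auto simp: E_unit)
    have inj_b: "inj_on ?b ?I"
    proof (rule inj_onI)
      fix x y assume x: "x \<in> ?I" and y: "y \<in> ?I" and eq: "?b x = ?b y"
      from eq have "E (?e x) = E (?e y)" unfolding b_e[OF x] b_e[OF y] .
      then show "x = y" using e_inj inj_onD[OF inj _ e_supp[OF x] e_supp[OF y]] by blast
    qed
    have "has_dim ?V (card ?I)"
    proof (rule has_dimI[OF V, of _ ?b])
      fix v assume "v \<in> carrier ?V"
      then obtain m where m: "v = E m" using carrier by (auto simp: restrict_scalars_simps)
      have "v = (\<Oplus>\<^bsub>?V\<^esub>x\<in>?I. case_sum (fst m) (snd m) x \<odot>\<^bsub>?V\<^esub> ?b x)"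
        unfolding E_finsum m by (simp add: comp_def)
      then show "\<exists>f. v = (\<Oplus>\<^bsub>?V\<^esub>x\<in>?I. f x \<odot>\<^bsub>?V\<^esub> ?b x)" by blast
    next
      fix f x assume "(\<Oplus>\<^bsub>?V\<^esub>x\<in>?I. f x \<odot>\<^bsub>?V\<^esub> ?b x) = \<zero>\<^bsub>?V\<^esub>" and x: "x \<in> ?I"
      then have "E (f \<circ> Inl, f \<circ> Inr) = \<zero>\<^bsub>?S\<^esub>" unfolding E_finsum by (simp add: restrict_scalars_simps)
      from zero[OF this] x show "f x = 0" by auto
    qed (use inj_b in \<open>auto simp: restrict_scalars_simps\<close>)
    then show "has_dim ?V (2 * (n + 1))" by (simp add: card_Plus mult_2)
  qed
qed

section \<open>Isomorphisms between the models\<close>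

lemma cocycle_scalar: "cocycle n 0 0 gam g h = scale1 gam (cocycle n 0 0 1 g h)"
  for gam :: "'k::field_char_0"
  by (cases g) (simp_all del: verma.simps add: scale1_def fun_eq_iff field_simps)

lemma ext_gen_action_alt:
  "ext_gen_action n gam g (f, h)
    = (trunc n (verma n g f) + scale1 gam (trunc n (cocycle n 0 0 1 g h)), trunc n (verma n g h))"
  for gam :: "'k::field_char_0"
  using cocycle_scalar[of n gam g h] by (simp add: ext_gen_action_def verma_ext_def trunc_linear)

text \<open>Rescaling the quotient. The hypothesis is stated for the off-diagonal parts, in order to cover both
  \<open>gam = gam' * t\<close> and the case of \<open>L 0\<close>, where these parts are zero for all parameters.\<close>

lemma dj_module_iso_ext:
  fixes gam gam' :: "'k::field_char_0"
  assumes t: "t \<noteq> 0" and act: "\<And>g h. h \<in> supp n \<Longrightarrow>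
      scale1 gam (trunc n (cocycle n 0 0 1 g h)) = scale1 (gam' * t) (trunc n (cocycle n 0 0 1 g h))"
  shows "(\<lambda>m. (fst m, scale1 t (snd m))) \<in> module_iso DJ (ext_module n gam) (ext_module n gam')"
proof -
  let ?f = "\<lambda>m :: 'k fpair. (fst m, scale1 t (snd m))"
  have hom: "?f \<in> module_hom DJ (ext_module n gam) (ext_module n gam')"
  proof (rule dj_module_homI[OF ext_module(1) ext_module(1)])
    fix m m' :: "'k fpair" and c g
    show "?f (m \<oplus>\<^bsub>ext_module n gam\<^esub> m') = ?f m \<oplus>\<^bsub>ext_module n gam'\<^esub> ?f m'"
      by (simp only: ext_module(3) fst_add snd_add scale1_add add_Pair)
    assume "m \<in> carrier (ext_module n gam)"
    then have m: "m \<in> supp n \<times> supp n" by (simp only: ext_module(2))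
    then have fm: "?f m \<in> supp n \<times> supp n" by (auto simp: supp_closed)
    then show "?f m \<in> carrier (ext_module n gam')" by (simp only: ext_module(2))
    show "?f (cact (ext_module n gam) c m) = cact (ext_module n gam') c (?f m)"
      unfolding ext_module(6)[OF m] ext_module(6)[OF fm] by (simp add: scale2_def scale1_def mult.left_commute)
    obtain f h where m_eq: "m = (f, h)" and h: "h \<in> supp n" using m by (cases m) auto
    show "?f (gact (ext_module n gam) g m) = gact (ext_module n gam') g (?f m)"
      unfolding ext_module(5)[OF m] ext_module(5)[OF fm]
      unfolding m_eq fst_conv snd_conv ext_gen_action_alt act[OF h]
      by (simp add: cocycle_linear verma_linear trunc_linear scale_operators)
  qed
  have "bij_betw ?f (supp n \<times> supp n) (supp n \<times> supp n)"
    by (rule bij_betw_byWitness[where f' = "\<lambda>m. (fst m, scale1 (inverse t) (snd m))"])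
      (use t in \<open>auto simp: scale_operators supp_closed\<close>)
  with hom show ?thesis by (simp add: module_iso_def ext_module(2))
qed

text \<open>On \<open>L 0\<close> the generators \<open>y\<close>, \<open>v\<close> and \<open>\<xi>\<close> act by zero, so nothing depends on \<open>\<gamma>\<close>.\<close>

lemma cocycle_level_0:
  fixes h :: "nat \<Rightarrow> 'k::field"
  shows "h \<in> supp 0 \<Longrightarrow> trunc 0 (cocycle 0 0 0 1 g h) = 0"
  by (cases g) (auto simp: trunc_def fun_eq_iff supp_def)

lemma x_nonzero:
  fixes gam :: "'k::field_char_0"
  assumes "n \<noteq> 0" "gam \<noteq> 0"
  shows "gact (ext_module n gam) Gx (0, unitv 0) \<noteq> \<zero>\<^bsub>ext_module n gam\<^esub>"
proof
  assume "gact (ext_module n gam) Gx (0, unitv 0) = \<zero>\<^bsub>ext_module n gam\<^esub>"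
  moreover have w: "(0, unitv 0) \<in> supp n \<times> (supp n :: (nat \<Rightarrow> 'k) set)"
    by (simp add: unitv_supp supp_closed)
  ultimately have "ext_gen_action n gam Gx (0, unitv 0) = (0, 0)"
    unfolding ext_module(5)[OF w] ext_module(4) by simp
  then have "fst (ext_gen_action n gam Gx (0, unitv 0)) 1 = (0 :: nat \<Rightarrow> 'k) 1"
    by (simp only: fst_conv)
  then show False using assms by (simp add: ext_gen_action_def verma_ext_def trunc_def unitv_def)
qed

text \<open>The parameter vanishes if and only if \<open>x\<close> acts by zero, for positive \<open>n\<close>.\<close>

lemma iso_parameter_zero:
  fixes gam gam' :: "'k::field_char_0"
  assumes "modules_isomorphic DJ (ext_module n gam) (ext_module n gam')" and "n \<noteq> 0" and "gam = 0"
  shows "gam' = 0"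
proof (rule ccontr)
  assume ne: "gam' \<noteq> 0"
  obtain h where h: "h \<in> module_hom DJ (ext_module n gam) (ext_module n gam')"
    and surj: "h ` carrier (ext_module n gam) = carrier (ext_module n gam')"
    using assms(1) by (auto simp: modules_isomorphic_def module_iso_def bij_betw_def)
  have "(0, unitv 0) \<in> h ` carrier (ext_module n gam)" unfolding surj by (rule ext_units_closed(2))
  then obtain m where m: "m \<in> carrier (ext_module n gam)" "h m = (0, unitv 0)" by (elim imageE) simp
  have "gact (ext_module n gam) Gx m = \<zero>\<^bsub>ext_module n gam\<^esub>"
  proof -
    have m': "m \<in> supp n \<times> supp n" using m(1) by (simp only: ext_module(2))
    show ?thesis unfolding ext_module(4) ext_module(5)[OF m'] assms(3)
      by (simp add: ext_gen_action_def verma_ext_def trunc_def prod_eq_iff fun_eq_iff)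
  qed
  then have "gact (ext_module n gam') Gx (0, unitv 0) = \<zero>\<^bsub>ext_module n gam'\<^esub>"
    using module_hom_smult[OF h dj_const_simps(5) m(1), of Gx] module_hom_zero[OF ext_module(1) ext_module(1) h]
    unfolding m(2) by simp
  then show False using x_nonzero[OF assms(2) ne] by blast
qed

lemma S_gamma_left_module: "left_module DJ (S_gamma n gam)" for gam :: "'k::field_char_0"
  unfolding S_gamma_def by (rule S_left_module)

lemma S_gamma_iso_iff:
  fixes gam1 gam2 :: "'k::field_char_0"
  shows "modules_isomorphic DJ (S_gamma n gam1) (S_gamma n gam2) \<longleftrightarrow> n = 0 \<or> (\<exists>t. t \<noteq> 0 \<and> gam1 = t * gam2)"
proof -
  have "modules_isomorphic DJ (S_gamma n gam1) (S_gamma n gam2)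
      \<longleftrightarrow> modules_isomorphic DJ (ext_module n gam1) (ext_module n gam2)"
  proof
    assume "modules_isomorphic DJ (S_gamma n gam1) (S_gamma n gam2)"
    from modules_isomorphic_trans[OF modules_isomorphic_trans[OF S_gamma_isomorphic this]
        modules_isomorphic_sym[OF ext_module(1) S_gamma_isomorphic]]
    show "modules_isomorphic DJ (ext_module n gam1) (ext_module n gam2)" .
  next
    assume "modules_isomorphic DJ (ext_module n gam1) (ext_module n gam2)"
    from modules_isomorphic_trans[OF modules_isomorphic_trans[OF
        modules_isomorphic_sym[OF ext_module(1) S_gamma_isomorphic] this] S_gamma_isomorphic]
    show "modules_isomorphic DJ (S_gamma n gam1) (S_gamma n gam2)" .
  qed
  also have "\<dots> \<longleftrightarrow> n = 0 \<or> (\<exists>t. t \<noteq> 0 \<and> gam1 = t * gam2)"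
  proof
    assume iso: "modules_isomorphic DJ (ext_module n gam1) (ext_module n gam2)"
    show "n = 0 \<or> (\<exists>t. t \<noteq> 0 \<and> gam1 = t * gam2)"
    proof (cases "n = 0")
      case False
      have "gam1 = 0 \<longleftrightarrow> gam2 = 0"
        using iso_parameter_zero[OF iso False] iso_parameter_zero[OF modules_isomorphic_sym[OF ext_module(1) iso] False]
        by blast
      then have "\<exists>t. t \<noteq> 0 \<and> gam1 = t * gam2"
        by (intro exI[of _ "if gam2 = 0 then 1 else gam1 / gam2"]) auto
      then show ?thesis ..
    qed simp
  next
    assume "n = 0 \<or> (\<exists>t. t \<noteq> 0 \<and> gam1 = t * gam2)"
    then show "modules_isomorphic DJ (ext_module n gam1) (ext_module n gam2)"
    proof
      assume "n = 0"
      then have "(\<lambda>m. (fst m, scale1 1 (snd m))) \<in> module_iso DJ (ext_module n gam1) (ext_module n gam2)"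
        by (intro dj_module_iso_ext) (simp_all add: cocycle_level_0, simp add: scale1_def)
      then show ?thesis by (auto simp: modules_isomorphic_def)
    next
      assume "\<exists>t. t \<noteq> 0 \<and> gam1 = t * gam2"
      then obtain t where "t \<noteq> 0" "gam1 = t * gam2" by blast
      then have "(\<lambda>m. (fst m, scale1 t (snd m))) \<in> module_iso DJ (ext_module n gam1) (ext_module n gam2)"
        by (intro dj_module_iso_ext) (simp_all add: mult.commute)
      then show ?thesis by (auto simp: modules_isomorphic_def)
    qed
  qed
  finally show ?thesis .
qed

section \<open>The space of extensions\<close>

lemma ext_equiv_iff:
  "ext_equiv R M (T, i, p) (T', i', p') \<longleftrightarrow>
    (\<exists>h\<in>module_iso R T T'. (\<forall>m\<in>carrier M. h (i m) = i' m) \<and> (\<forall>t\<in>carrier T. p' (h t) = p t))"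
  by (simp add: ext_equiv_def)

lemma ext_equiv_trans:
  assumes "ext_equiv R M E E'" "ext_equiv R M E' E''" shows "ext_equiv R M E E''"
proof -
  obtain T i p T' i' p' T'' i'' p'' where E: "E = (T, i, p)" "E' = (T', i', p')" "E'' = (T'', i'', p'')"
    by (metis prod_cases3)
  obtain h where h: "h \<in> module_iso R T T'" "\<forall>m\<in>carrier M. h (i m) = i' m" "\<forall>t\<in>carrier T. p' (h t) = p t"
    using assms(1) unfolding E ext_equiv_iff by blast
  obtain k where k: "k \<in> module_iso R T' T''" "\<forall>m\<in>carrier M. k (i' m) = i'' m" "\<forall>t\<in>carrier T'. p'' (k t) = p' t"
    using assms(2) unfolding E ext_equiv_iff by blast
  have hT: "h t \<in> carrier T'" if "t \<in> carrier T" for t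
    using h(1) that by (auto simp: module_iso_def module_hom_def)
  show ?thesis unfolding E ext_equiv_iff
    by (rule bexI[OF _ module_iso_comp[OF h(1) k(1)]]) (use h k hT in auto)
qed

lemma ext_equiv_sym:
  assumes eq: "ext_equiv R M (T, i, p) (T', i', p')" and T: "left_module R T" and i: "i ` carrier M \<subseteq> carrier T"
  shows "ext_equiv R M (T', i', p') (T, i, p)"
proof -
  obtain h where h: "h \<in> module_iso R T T'" "\<forall>m\<in>carrier M. h (i m) = i' m" "\<forall>t\<in>carrier T. p' (h t) = p t"
    using eq unfolding ext_equiv_iff by blast
  let ?k = "inv_into (carrier T) h"
  have bij: "bij_betw h (carrier T) (carrier T')" using h(1) by (simp add: module_iso_def)
  show ?thesis unfolding ext_equiv_iff
  proof (intro bexI[OF _ module_iso_inv[OF T h(1)]] conjI ballI)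
    fix m assume m: "m \<in> carrier M"
    then have "i m \<in> carrier T" using i by blast
    then have "?k (h (i m)) = i m" using bij by (simp add: bij_betw_def)
    then show "?k (i' m) = i m" using h(2) m by simp
  next
    fix t assume "t \<in> carrier T'"
    then have "?k t \<in> carrier T" "h (?k t) = t"
      using bij by (auto simp: bij_betw_def inv_into_into f_inv_into_f)
    then show "p (?k t) = p' t" using h(3) by metis
  qed
qed

abbreviation model_ext :: "nat \<Rightarrow> 'k::field_char_0 \<Rightarrow> ('k dj, nat \<Rightarrow> 'k, nat \<Rightarrow> 'k, 'k fpair) ext"
  where "model_ext n gam \<equiv> (ext_module n gam, (\<lambda>f. (f, 0)), snd)"

lemma model_ext_in: "model_ext n gam \<in> extensions DJ (L n) (L n)" for gam :: "'k::field_char_0"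
  using ext_module_short_exact[of n gam] by (simp add: extensions_def)

lemma short_exact_equiv_model:
  assumes "short_exact DJ (L n) i T p (L n)"
  obtains gam where "ext_equiv DJ (L n) (model_ext n gam) (T, i, p)"
proof (rule extension_classification[OF assms])
  fix gam h
  assume h: "h \<in> module_iso DJ (ext_module n gam) T" "\<And>f. f \<in> supp n \<Longrightarrow> h (f, 0) = i f"
    "\<And>m. m \<in> supp n \<times> supp n \<Longrightarrow> p (h m) = snd m"
  have "ext_equiv DJ (L n) (model_ext n gam) (T, i, p)"
    unfolding ext_equiv_iff L_module(2) ext_module(2) using h by blast
  then show thesis by (rule that)
qed

text \<open>An equivalence fixes the submodule and moves \<open>w\<close> by an element of it, which \<open>x\<close> annihilates. So
  \<open>x w = \<gamma> y s\<close> determines \<open>\<gamma>\<close>, unless \<open>y s = 0\<close>, that is \<open>n = 0\<close>.\<close>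

lemma model_ext_equiv_iff:
  fixes gam gam' :: "'k::field_char_0"
  shows "ext_equiv DJ (L n) (model_ext n gam) (model_ext n gam') \<longleftrightarrow> n = 0 \<or> gam = gam'"
proof
  assume "ext_equiv DJ (L n) (model_ext n gam) (model_ext n gam')"
  then obtain h where h: "h \<in> module_iso DJ (ext_module n gam) (ext_module n gam')"
    "\<forall>f\<in>supp n. h (f, 0) = (f, 0)" "\<forall>m\<in>supp n \<times> supp n. snd (h m) = snd m"
    unfolding ext_equiv_iff L_module(2) ext_module(2) by blast
  then have hom: "h \<in> module_hom DJ (ext_module n gam) (ext_module n gam')" by (simp add: module_iso_def)
  let ?w = "(0, unitv 0) :: 'k fpair"
  have w: "?w \<in> supp n \<times> supp n" by (simp add: unitv_supp supp_closed)
  have hw: "h ?w \<in> supp n \<times> supp n" "snd (h ?w) = unitv 0"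
    using module_hom_in[OF hom ext_units_closed(2)] h(3) w by (simp_all only: ext_module(2) snd_conv)
  have x: "gact (ext_module n c) Gx m = (scale1 c (trunc n (shift (snd m))), 0)"
    if "m \<in> supp n \<times> supp n" for c and m :: "'k fpair"
    unfolding ext_module(5)[OF that]
    by (simp add: ext_gen_action_def verma_ext_def trunc_def scale1_def prod_eq_iff fun_eq_iff)
  have "h (gact (ext_module n gam) Gx ?w) = gact (ext_module n gam') Gx (h ?w)"
    by (rule module_hom_smult[OF hom dj_const_simps(5) ext_units_closed(2)])
  then have "h (scale1 gam (trunc n (unitv 1)), 0) = (scale1 gam' (trunc n (unitv 1)), 0)"
    unfolding x[OF w] x[OF hw(1)] hw(2) snd_conv shift_unitv by simp
  then have "scale1 gam (trunc n (unitv 1)) = scale1 gam' (trunc n (unitv 1))"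
    using h(2) supp_closed(3)[OF trunc_in_supp] by (metis prod.inject)
  from fun_cong[OF this, of 1] show "n = 0 \<or> gam = gam'"
    by (cases "n = 0") (simp_all add: scale1_def trunc_def unitv_def)
next
  assume "n = 0 \<or> gam = gam'"
  then have "scale1 gam (trunc n (cocycle n 0 0 1 g h)) = scale1 (gam' * 1) (trunc n (cocycle n 0 0 1 g h))"
    if "h \<in> supp n" for g and h :: "nat \<Rightarrow> 'k"
    using that cocycle_level_0 by (auto simp: scale1_def fun_eq_iff)
  then have "(\<lambda>m. (fst m, scale1 1 (snd m))) \<in> module_iso DJ (ext_module n gam) (ext_module n gam')"
    by (intro dj_module_iso_ext) auto
  then show "ext_equiv DJ (L n) (model_ext n gam) (model_ext n gam')"
    unfolding ext_equiv_iff by (rule bexI[rotated]) (simp add: scale1_def zero_fun_def)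
qed

definition ext_class :: "nat \<Rightarrow> 'k::field_char_0
    \<Rightarrow> ('k dj, nat \<Rightarrow> 'k, nat \<Rightarrow> 'k, 'k fpair) ext set"
  where "ext_class n gam = {E \<in> extensions DJ (L n) (L n). ext_equiv DJ (L n) E (model_ext n gam)}"

text \<open>The middle term of \<open>F\<close> may live in any type, as it does for a Baer sum or a pushout.\<close>

lemma ext_class_eq:
  fixes F :: "('k::field_char_0 dj, nat \<Rightarrow> 'k, nat \<Rightarrow> 'k, 't) ext"
  assumes F: "ext_equiv DJ (L n) (model_ext n gam) F"
  shows "{E \<in> extensions DJ (L n) (L n). ext_equiv DJ (L n) E F} = ext_class n gam"
proof -
  obtain T i p where F_eq: "F = (T, i, p)" by (metis prod_cases3)
  have "(\<lambda>f. (f, 0)) ` carrier (L n) \<subseteq> carrier (ext_module n gam)"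
    unfolding L_module(2) ext_module(2) using supp_closed(1) by blast
  from ext_equiv_sym[OF F[unfolded F_eq] ext_module(1) this]
  have "ext_equiv DJ (L n) F (model_ext n gam)" unfolding F_eq .
  then show ?thesis using ext_equiv_trans[OF _ F] ext_equiv_trans[of DJ "L n" _ F "model_ext n gam"]
    unfolding ext_class_def by blast
qed

lemma ext_class_in: "model_ext n gam \<in> ext_class n gam" for gam :: "'k::field_char_0"
  unfolding ext_class_def using model_ext_in model_ext_equiv_iff by blast

lemma ext_class_eq_iff: "ext_class n gam = ext_class n gam' \<longleftrightarrow> n = 0 \<or> gam = gam'"
  for gam gam' :: "'k::field_char_0"
proof
  assume "ext_class n gam = ext_class n gam'"
  then have "model_ext n gam \<in> ext_class n gam'" using ext_class_in by blast
  then show "n = 0 \<or> gam = gam'" unfolding ext_class_def using model_ext_equiv_iff by blast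
next
  assume "n = 0 \<or> gam = gam'"
  then have "ext_equiv DJ (L n) (model_ext n gam') (model_ext n gam)" unfolding model_ext_equiv_iff by blast
  from ext_class_eq[OF this] show "ext_class n gam = ext_class n gam'" unfolding ext_class_def[of n gam] .
qed

lemma ext_class_exhaustive:
  fixes E :: "('k::field_char_0 dj, nat \<Rightarrow> 'k, nat \<Rightarrow> 'k, 'k fpair) ext"
  assumes "E \<in> extensions DJ (L n) (L n)"
  obtains gam where "ext_equiv DJ (L n) (model_ext n gam) E" "ext_equiv DJ (L n) E (model_ext n gam)"
proof -
  obtain T i p where E: "E = (T, i, p)" by (metis prod_cases3)
  have se: "short_exact DJ (L n) i T p (L n)" using assms by (simp add: E extensions_def)
  obtain gam where gam: "ext_equiv DJ (L n) (model_ext n gam) E"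
    unfolding E by (rule short_exact_equiv_model[OF se])
  have "id \<in> module_iso DJ T T" by (auto simp: module_iso_def module_hom_def)
  then have "ext_equiv DJ (L n) E E" unfolding E ext_equiv_iff by (rule bexI[rotated]) simp
  then have "E \<in> ext_class n gam" unfolding ext_class_eq[OF gam, symmetric] using assms by blast
  then show thesis using gam that by (auto simp: ext_class_def)
qed

lemma Ext1_carrier:
  "carrier (Ext1 DJ dj_const (L n :: ('k::field_char_0 dj, nat \<Rightarrow> 'k) module) (L n)) = range (ext_class n)"
proof -
  let ?X = "extensions DJ (L n) (L n) :: ('k dj, nat \<Rightarrow> 'k, nat \<Rightarrow> 'k, 'k fpair) ext set"
  have cls: "ext_rel DJ (L n) (L n) `` {E} = ext_class n gam"
    if E: "E \<in> ?X" and 1: "ext_equiv DJ (L n) (model_ext n gam) E" and 2: "ext_equiv DJ (L n) E (model_ext n gam)" for E gam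
  proof -
    have "ext_equiv DJ (L n) E E'" if E': "E' \<in> ext_class n gam" for E'
    proof -
      obtain T i p where E'_eq: "E' = (T, i, p)" by (metis prod_cases3)
      have se: "short_exact DJ (L n) i T p (L n)" and eq: "ext_equiv DJ (L n) (T, i, p) (model_ext n gam)"
        using E' by (auto simp: E'_eq ext_class_def extensions_def)
      have "left_module DJ T" "i ` carrier (L n) \<subseteq> carrier T" using se by (auto simp: short_exact_def)
      from ext_equiv_trans[OF 2 ext_equiv_sym[OF eq this]] show ?thesis unfolding E'_eq .
    qed
    moreover have "E' \<in> ext_class n gam" if "E' \<in> ?X" "ext_equiv DJ (L n) E E'" for E'
    proof -
      obtain T i p where E_eq: "E = (T, i, p)" by (metis prod_cases3)
      have "left_module DJ T" "i ` carrier (L n) \<subseteq> carrier T"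
        using E by (auto simp: E_eq extensions_def short_exact_def)
      obtain T' i' p' where E'_eq: "E' = (T', i', p')" by (metis prod_cases3)
      from ext_equiv_sym[OF that(2)[unfolded E_eq E'_eq] \<open>left_module DJ T\<close> \<open>i ` carrier (L n) \<subseteq> carrier T\<close>]
      have "ext_equiv DJ (L n) E' E" unfolding E_eq E'_eq .
      from ext_equiv_trans[OF this 2] that(1) show ?thesis unfolding ext_class_def by blast
    qed
    ultimately show ?thesis using E by (auto simp: ext_rel_def ext_class_def)
  qed
  show ?thesis
  proof
    show "carrier (Ext1 DJ dj_const (L n :: ('k dj, nat \<Rightarrow> 'k) module) (L n)) \<subseteq> range (ext_class n)"
    proof
      fix A assume "A \<in> carrier (Ext1 DJ dj_const (L n :: ('k dj, nat \<Rightarrow> 'k) module) (L n))"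
      then obtain E where E: "E \<in> ?X" "A = ext_rel DJ (L n) (L n) `` {E}"
        by (auto simp: Ext1_def elim: quotientE)
      obtain gam where "ext_equiv DJ (L n) (model_ext n gam) E" "ext_equiv DJ (L n) E (model_ext n gam)"
        by (rule ext_class_exhaustive[OF E(1)])
      then show "A \<in> range (ext_class n)" using cls[OF E(1)] E(2) by blast
    qed
    show "range (ext_class n) \<subseteq> carrier (Ext1 DJ dj_const (L n :: ('k dj, nat \<Rightarrow> 'k) module) (L n))"
    proof
      fix A :: "('k dj, nat \<Rightarrow> 'k, nat \<Rightarrow> 'k, 'k fpair) ext set"
      assume "A \<in> range (ext_class n)"
      then obtain gam where A: "A = ext_class n gam" by blast
      have "ext_equiv DJ (L n) (model_ext n gam) (model_ext n gam)" unfolding model_ext_equiv_iff by blast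
      from cls[OF model_ext_in this this] have "A = ext_rel DJ (L n) (L n) `` {model_ext n gam}" by (simp only: A)
      then have "A \<in> ?X // ext_rel DJ (L n) (L n)" unfolding Equiv_Relations.quotient_def using model_ext_in by blast
      then show "A \<in> carrier (Ext1 DJ dj_const (L n :: ('k dj, nat \<Rightarrow> 'k) module) (L n))"
        by (simp add: Ext1_def)
    qed
  qed
qed

text \<open>Both the Baer sum and the pushout are quotients of a module \<open>P\<close>. To identify such an extension with a
  model it suffices to map \<open>P\<close> onto the model with the given kernel.\<close>

lemma quotient_ext_equiv:
  fixes P :: "('k::field_char_0 dj, 'p) module"
  assumes P: "left_module DJ P" and f: "f \<in> module_hom DJ P (ext_module n gam)"
    and surj: "\<And>m. m \<in> supp n \<times> supp n \<Longrightarrow> m \<in> f ` carrier P"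
    and K: "K = {q \<in> carrier P. f q = (0, 0)}"
    and j: "\<And>m. m \<in> supp n \<Longrightarrow> j m \<in> carrier P \<and> f (j m) = (m, 0)"
    and pr: "\<And>q. q \<in> carrier P \<Longrightarrow> pr q = snd (f q)"
  shows "ext_equiv DJ (L n) (model_ext n gam)
    (quotient_module P K, (\<lambda>m. K +>\<^bsub>P\<^esub> j m), (\<lambda>Y. the_elem (pr ` Y)))"
proof -
  have surj': "f ` carrier P = carrier (ext_module n gam)"
    using surj module_hom_in[OF f] unfolding ext_module(2) by blast
  have K': "K = {q \<in> carrier P. f q = \<zero>\<^bsub>ext_module n gam\<^esub>}" unfolding ext_module(4) by (rule K)
  note iso = first_isomorphism[OF P ext_module(1) f surj', folded K']
  let ?h = "\<lambda>Y. the_elem (f ` Y)"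
  have pr_val: "the_elem (pr ` Y) = snd (?h Y)" if Y: "Y \<in> carrier (quotient_module P K)" for Y
  proof -
    obtain q where q: "q \<in> carrier P" "Y = K +>\<^bsub>P\<^esub> q" using Y left_module.quotient_carrier[OF P iso(1)] by auto
    have "Y \<subseteq> carrier P"
      using abelian_subgroup.a_rcosets_carrier[OF left_module.submodule_abelian_subgroup[OF P iso(1)]] Y
      by (simp add: quotient_module_def)
    then have "pr ` Y = snd ` (f ` Y)" unfolding image_image using pr by (intro image_cong) auto
    moreover have "f ` Y = {f q}" unfolding q(2) K' by (rule hom_image_coset[OF P ext_module(1) f q(1)])
    ultimately show ?thesis by simp
  qed
  have "ext_equiv DJ (L n) (quotient_module P K, (\<lambda>m. K +>\<^bsub>P\<^esub> j m), (\<lambda>Y. the_elem (pr ` Y))) (model_ext n gam)"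
    unfolding ext_equiv_iff
  proof (rule bexI[OF _ iso(3)], intro conjI ballI)
    fix m assume "m \<in> carrier (L n :: ('k dj, _) module)"
    then have "j m \<in> carrier P" "f (j m) = (m, 0)" using j by (simp_all add: L_module(2))
    then show "?h (K +>\<^bsub>P\<^esub> j m) = (m, 0)" using iso(4) by simp
  qed (use pr_val in simp)
  then show ?thesis
  proof (rule ext_equiv_sym[OF _ iso(2)])
    show "(\<lambda>m. K +>\<^bsub>P\<^esub> j m) ` carrier (L n) \<subseteq> carrier (quotient_module P K)"
      unfolding left_module.quotient_carrier[OF P iso(1)] L_module(2) using j by blast
  qed
qed


lemma ext_classE:
  fixes E :: "('k::field_char_0 dj, nat \<Rightarrow> 'k, nat \<Rightarrow> 'k, 'k fpair) ext"
  assumes "E \<in> ext_class n gam"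
  obtains T i p k where "E = (T, i, p)" "left_module DJ T" "i \<in> module_hom DJ (L n) T"
    "k \<in> module_iso DJ T (ext_module n gam)"
    "\<And>f. f \<in> supp n \<Longrightarrow> i f \<in> carrier T \<and> k (i f) = (f, 0)" "\<And>t. t \<in> carrier T \<Longrightarrow> p t = snd (k t)"
proof -
  obtain T i p where E: "E = (T, i, p)" by (metis prod_cases3)
  have se: "short_exact DJ (L n) i T p (L n)" and eq: "ext_equiv DJ (L n) (T, i, p) (model_ext n gam)"
    using assms by (auto simp: E ext_class_def extensions_def)
  then obtain k where k: "k \<in> module_iso DJ T (ext_module n gam)" "\<forall>f\<in>supp n. k (i f) = (f, 0)"
    "\<forall>t\<in>carrier T. snd (k t) = p t"
    unfolding ext_equiv_iff L_module(2) by blast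
  have i: "i \<in> module_hom DJ (L n) T" and T: "left_module DJ T" using se by (simp_all add: short_exact_def)
  have "i f \<in> carrier T" if "f \<in> supp n" for f using module_hom_in[OF i, of f] that by (simp add: L_module(2))
  then show thesis using k by (intro that[OF E T i k(1)]) auto
qed

text \<open>An element of \<open>T\<close> that is zero in the quotient comes from \<open>L n\<close>, and \<open>k\<close> shows from where.\<close>

lemma ext_kernel:
  fixes T :: "('k::field_char_0 dj, 't) module"
  assumes k: "k \<in> module_iso DJ T (ext_module n gam)" and t: "t \<in> carrier T" "snd (k t) = 0"
    and i: "\<And>f. f \<in> supp n \<Longrightarrow> i f \<in> carrier T \<and> k (i f) = (f, 0)"
  shows "t = i (fst (k t)) \<and> fst (k t) \<in> supp n"
proof -
  have inj: "inj_on k (carrier T)" and "k t \<in> supp n \<times> supp n"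
    using k t module_hom_in[of k DJ T "ext_module n gam" t] by (auto simp: module_iso_def bij_betw_def ext_module(2))
  then have f: "fst (k t) \<in> supp n" by auto
  have "k t = k (i (fst (k t)))" using i[OF f] t(2) by (simp add: prod_eq_iff)
  then show ?thesis using inj_onD[OF inj _ t(1)] i[OF f] f by blast
qed

lemma supp_uminus: "f \<in> supp n \<Longrightarrow> - f \<in> supp n" for f :: "nat \<Rightarrow> 'k::field"
  by (simp add: supp_def fun_Compl_def)

lemma ext_hom_rules:
  fixes T :: "('k::field_char_0 dj, 't) module"
  assumes T: "left_module DJ T" and k: "k \<in> module_hom DJ T (ext_module n a)"
  shows "t \<in> carrier T \<Longrightarrow> k t \<in> supp n \<times> supp n"
    "t \<in> carrier T \<Longrightarrow> t' \<in> carrier T \<Longrightarrow> k (t \<oplus>\<^bsub>T\<^esub> t') = k t + k t'"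
    "t \<in> carrier T \<Longrightarrow> k (cact T c t) = scale2 c (k t)"
    "t \<in> carrier T \<Longrightarrow> k (gact T g t) = ext_gen_action n a g (k t)"
    "k \<zero>\<^bsub>T\<^esub> = (0, 0)"
proof -
  show "k \<zero>\<^bsub>T\<^esub> = (0, 0)" using module_hom_zero[OF T ext_module(1) k] by (simp only: ext_module(4))
  assume t: "t \<in> carrier T"
  show kt: "k t \<in> supp n \<times> supp n" using module_hom_in[OF k t] by (simp only: ext_module(2))
  show "k (cact T c t) = scale2 c (k t)"
    using module_hom_smult[OF k dj_const_simps(4) t] by (simp only: ext_module(6)[OF kt])
  show "k (gact T g t) = ext_gen_action n a g (k t)"
    using module_hom_smult[OF k dj_const_simps(5) t] by (simp only: ext_module(5)[OF kt])
  assume "t' \<in> carrier T"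
  from module_hom_add[OF k t this] show "k (t \<oplus>\<^bsub>T\<^esub> t') = k t + k t'" by (simp only: ext_module(3))
qed

text \<open>In coordinates the pullback consists of the \<open>((f, h), (f', h))\<close>, and \<open>(f + f', h)\<close> is a map to the
  model of parameter \<open>a + b\<close>, because the off-diagonal parts are linear in the parameter and the
  diagonal parts do not depend on it.\<close>

lemma baer_sum_model:
  fixes a b :: "'k::field_char_0"
  assumes "E1 \<in> ext_class n a" "E2 \<in> ext_class n b"
  shows "ext_equiv DJ (L n) (model_ext n (a + b)) (baer_sum (L n) E1 E2)"
proof -
  obtain T i p k where E1: "E1 = (T, i, p)" and T: "left_module DJ T" and ih: "i \<in> module_hom DJ (L n) T"
    and k: "k \<in> module_iso DJ T (ext_module n a)"
    and i: "\<And>f. f \<in> supp n \<Longrightarrow> i f \<in> carrier T \<and> k (i f) = (f, 0)" and p: "\<And>t. t \<in> carrier T \<Longrightarrow> p t = snd (k t)"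
    by (rule ext_classE[OF assms(1)]) blast
  obtain T' i' p' k' where E2: "E2 = (T', i', p')" and T': "left_module DJ T'" and ih': "i' \<in> module_hom DJ (L n) T'"
    and k': "k' \<in> module_iso DJ T' (ext_module n b)"
    and i': "\<And>f. f \<in> supp n \<Longrightarrow> i' f \<in> carrier T' \<and> k' (i' f) = (f, 0)" and p': "\<And>t. t \<in> carrier T' \<Longrightarrow> p' t = snd (k' t)"
    by (rule ext_classE[OF assms(2)]) blast
  interpret T: dj_module T by (rule dj_module.intro) (rule T)
  interpret T': dj_module T' by (rule dj_module.intro) (rule T')
  have kh: "k \<in> module_hom DJ T (ext_module n a)" and kh': "k' \<in> module_hom DJ T' (ext_module n b)"
    using k k' by (simp_all add: module_iso_def)
  note kr = ext_hom_rules[OF T kh] and kr' = ext_hom_rules[OF T' kh']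
  let ?D = "direct_sum T T'"
  let ?C = "{(t, t') \<in> carrier T \<times> carrier T'. p t = p' t'}"
  let ?P = "?D\<lparr>carrier := ?C\<rparr>"
  let ?f = "\<lambda>q. (fst (k (fst q)) + fst (k' (snd q)), snd (k (fst q)))"
  have D: "left_module DJ ?D" by (rule left_module_direct_sum[OF T T'])
  interpret D: dj_module ?D by (rule dj_module.intro) (rule D)
  have C: "q \<in> ?C \<longleftrightarrow> fst q \<in> carrier T \<and> snd q \<in> carrier T' \<and> snd (k (fst q)) = snd (k' (snd q))" for q
    by (cases q) (auto simp: p p')
  have D_simps: "q \<oplus>\<^bsub>?D\<^esub> r = (fst q \<oplus>\<^bsub>T\<^esub> fst r, snd q \<oplus>\<^bsub>T'\<^esub> snd r)"
    "A \<odot>\<^bsub>?D\<^esub> q = (A \<odot>\<^bsub>T\<^esub> fst q, A \<odot>\<^bsub>T'\<^esub> snd q)" "\<zero>\<^bsub>?D\<^esub> = (\<zero>\<^bsub>T\<^esub>, \<zero>\<^bsub>T'\<^esub>)" for q r A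
    by (simp_all add: direct_sum_def)
  have snd_gen: "snd (ext_gen_action n c g m) = trunc n (verma n g (snd m))" for c g and m :: "'k fpair"
    by (cases m) (simp add: ext_gen_action_alt)
  have sub: "Module.submodule ?C DJ ?D"
  proof (rule D.dj_submoduleI)
    show "?C \<subseteq> carrier ?D" by (auto simp: direct_sum_def)
    show "\<zero>\<^bsub>?D\<^esub> \<in> ?C" unfolding C D_simps by (simp add: kr(5) kr'(5))
    fix q assume "q \<in> ?C"
    then have q: "fst q \<in> carrier T" "snd q \<in> carrier T'" "snd (k (fst q)) = snd (k' (snd q))" by (simp_all only: C)
    show "cact ?D c q \<in> ?C" for c unfolding C D_simps using q by (simp add: kr(3) kr'(3) scale2_def)
    show "gact ?D g q \<in> ?C" for g unfolding C D_simps using q by (simp add: kr(4) kr'(4) snd_gen)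
    fix r assume "r \<in> ?C"
    then have "fst r \<in> carrier T" "snd r \<in> carrier T'" "snd (k (fst r)) = snd (k' (snd r))" by (simp_all only: C)
    then show "q \<oplus>\<^bsub>?D\<^esub> r \<in> ?C" unfolding C D_simps using q by (simp add: kr(2) kr'(2))
  qed
  have P: "left_module DJ ?P" by (rule D.submodule_left_module[OF sub])
  have P_simps: "carrier ?P = ?C" "q \<oplus>\<^bsub>?P\<^esub> r = q \<oplus>\<^bsub>?D\<^esub> r" "A \<odot>\<^bsub>?P\<^esub> q = A \<odot>\<^bsub>?D\<^esub> q" for q r A
    by simp_all
  have hom: "?f \<in> module_hom DJ ?P (ext_module n (a + b))"
  proof (rule dj_module_homI[OF P ext_module(1)])
    fix q c g assume "q \<in> carrier ?P"
    then have q: "fst q \<in> carrier T" "snd q \<in> carrier T'" "snd (k (fst q)) = snd (k' (snd q))"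
      by (simp_all only: P_simps C)
    have fq: "?f q \<in> supp n \<times> supp n"
      using kr(1)[OF q(1)] kr'(1)[OF q(2)] by (auto simp: supp_closed)
    then show "?f q \<in> carrier (ext_module n (a + b))" by (simp only: ext_module(2))
    show "?f (cact ?P c q) = cact (ext_module n (a + b)) c (?f q)"
      unfolding P_simps D_simps ext_module(6)[OF fq] fst_conv snd_conv kr(3)[OF q(1)] kr'(3)[OF q(2)]
      by (simp only: scale2_def fst_conv snd_conv scale1_add)
    obtain f h where kf: "k (fst q) = (f, h)" by (cases "k (fst q)")
    obtain f' where kf': "k' (snd q) = (f', h)" using q(3) kf by (cases "k' (snd q)") simp
    show "?f (gact ?P g q) = gact (ext_module n (a + b)) g (?f q)"
      unfolding P_simps D_simps ext_module(5)[OF fq] fst_conv snd_conv kr(4)[OF q(1)] kr'(4)[OF q(2)]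
      unfolding kf kf' fst_conv snd_conv ext_gen_action_alt verma_linear trunc_linear scale_operators
      by (simp only: add_ac)
    fix r assume "r \<in> carrier ?P"
    then have r: "fst r \<in> carrier T" "snd r \<in> carrier T'" by (simp_all only: P_simps C)
    show "?f (q \<oplus>\<^bsub>?P\<^esub> r) = ?f q \<oplus>\<^bsub>ext_module n (a + b)\<^esub> ?f r"
      unfolding P_simps D_simps ext_module(3) fst_conv snd_conv kr(2)[OF q(1) r(1)] kr'(2)[OF q(2) r(2)]
      by (simp only: fst_add snd_add add_Pair add_ac)
  qed
  let ?K = "(\<lambda>m. (i m, \<ominus>\<^bsub>T'\<^esub> i' m)) ` supp n"
  have neg: "\<ominus>\<^bsub>T'\<^esub> i' f = i' (- f)" if f: "f \<in> supp n" for f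
  proof -
    have "k' (\<ominus>\<^bsub>T'\<^esub> i' f) = scale2 (- 1) (k' (i' f))"
      using kr'(3)[of "i' f" "- 1"] i'[OF f] by (simp add: T'.cact_uminus)
    also have "\<dots> = (- f, 0)" using i'[OF f] by (simp add: scale2_def scale1_def fun_eq_iff)
    also have "\<dots> = k' (i' (- f))" using i'[OF supp_uminus[OF f]] by simp
    finally have "k' (\<ominus>\<^bsub>T'\<^esub> i' f) = k' (i' (- f))" .
    moreover have "inj_on k' (carrier T')" using k' by (simp add: module_iso_def bij_betw_def)
    moreover have "\<ominus>\<^bsub>T'\<^esub> i' f \<in> carrier T'" using i'[OF f] by simp
    ultimately show ?thesis using i'[OF supp_uminus[OF f]] by (blast dest: inj_onD)
  qed
  have K: "?K = {q \<in> carrier ?P. ?f q = (0, 0)}"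
  proof (intro equalityI subsetI)
    fix q assume "q \<in> ?K"
    then obtain m where m: "m \<in> supp n" "q = (i m, i' (- m))" using neg by auto
    show "q \<in> {q \<in> carrier ?P. ?f q = (0, 0)}"
      unfolding mem_Collect_eq P_simps C m(2) using i[OF m(1)] i'[OF supp_uminus[OF m(1)]] by (simp add: p p')
  next
    fix q assume "q \<in> {q \<in> carrier ?P. ?f q = (0, 0)}"
    then have "q \<in> ?C" and f: "fst (k (fst q)) + fst (k' (snd q)) = 0" "snd (k (fst q)) = 0"
      by simp_all
    then have q: "fst q \<in> carrier T" "snd q \<in> carrier T'" "snd (k (fst q)) = snd (k' (snd q))"
      by (simp_all only: C)
    have 1: "fst q = i (fst (k (fst q))) \<and> fst (k (fst q)) \<in> supp n" by (rule ext_kernel[OF k q(1) f(2) i])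
    have 2: "snd q = i' (fst (k' (snd q))) \<and> fst (k' (snd q)) \<in> supp n"
      by (rule ext_kernel[OF k' q(2) _ i']) (use q(3) f(2) in simp)
    have "fst (k' (snd q)) = - fst (k (fst q))" using f(1) by (simp only: eq_neg_iff_add_eq_0 add.commute)
    then have "q = (i (fst (k (fst q))), \<ominus>\<^bsub>T'\<^esub> i' (fst (k (fst q))))"
      using 1 2 neg by (simp add: prod_eq_iff)
    then show "q \<in> ?K" using 1 by blast
  qed
  have "ext_equiv DJ (L n) (model_ext n (a + b))
    (quotient_module ?P ?K, (\<lambda>m. ?K +>\<^bsub>?P\<^esub> (i m, \<zero>\<^bsub>T'\<^esub>)), (\<lambda>Y. the_elem ((\<lambda>(t, t'). p t) ` Y)))"
  proof (rule quotient_ext_equiv[OF P hom _ K])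
    fix m :: "nat \<Rightarrow> 'k" assume m: "m \<in> supp n"
    show "(i m, \<zero>\<^bsub>T'\<^esub>) \<in> carrier ?P \<and> ?f (i m, \<zero>\<^bsub>T'\<^esub>) = (m, 0)"
      unfolding P_simps C using i[OF m] kr(5) kr'(5) by (simp add: p p')
  next
    fix q assume "q \<in> carrier ?P"
    then show "(case q of (t, t') \<Rightarrow> p t) = snd (?f q)" by (cases q) (auto simp: p)
  next
    fix m :: "'k fpair" assume m: "m \<in> supp n \<times> supp n"
    have surj: "k ` carrier T = supp n \<times> supp n" "k' ` carrier T' = supp n \<times> supp n"
      using k k' by (simp_all add: module_iso_def bij_betw_def ext_module(2))
    have "m \<in> k ` carrier T" "(0, snd m) \<in> k' ` carrier T'"
      unfolding surj using m by (auto simp: supp_closed)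
    then obtain t t' where t: "t \<in> carrier T" "k t = m" "t' \<in> carrier T'" "k' t' = (0, snd m)" by (elim imageE) simp
    show "m \<in> ?f ` carrier ?P"
    proof (rule image_eqI)
      show "m = ?f (t, t')" using t by simp
      show "(t, t') \<in> carrier ?P" unfolding P_simps C using t by simp
    qed
  qed
  then show ?thesis by (simp add: E1 E2 baer_sum_def Let_def L_module(2))
qed

text \<open>In coordinates the map to the model is \<open>(m, (f, h)) \<mapsto> (m + c f, h)\<close>.\<close>

lemma pushout_model:
  fixes a c :: "'k::field_char_0"
  assumes "E1 \<in> ext_class n a"
  shows "ext_equiv DJ (L n) (model_ext n (c * a)) (pushout_ext (L n) (\<lambda>m. dj_const c \<odot>\<^bsub>L n\<^esub> m) E1)"
proof -
  obtain T i p k where E1: "E1 = (T, i, p)" and T: "left_module DJ T" and ih: "i \<in> module_hom DJ (L n) T"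
    and k: "k \<in> module_iso DJ T (ext_module n a)"
    and i: "\<And>f. f \<in> supp n \<Longrightarrow> i f \<in> carrier T \<and> k (i f) = (f, 0)" and p: "\<And>t. t \<in> carrier T \<Longrightarrow> p t = snd (k t)"
    by (rule ext_classE[OF assms(1)]) blast
  interpret T: dj_module T by (rule dj_module.intro) (rule T)
  have kh: "k \<in> module_hom DJ T (ext_module n a)" using k by (simp add: module_iso_def)
  note kr = ext_hom_rules[OF T kh]
  let ?P = "direct_sum (L n) T"
  let ?f = "\<lambda>q. (fst q + scale1 c (fst (k (snd q))), snd (k (snd q)))"
  have P: "left_module DJ ?P" by (rule left_module_direct_sum[OF L_module(1) T])
  have P_iff: "q \<in> carrier ?P \<longleftrightarrow> fst q \<in> supp n \<and> snd q \<in> carrier T" for q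
    by (simp add: direct_sum_def L_module(2) mem_Times_iff)
  have P_simps: "q \<oplus>\<^bsub>?P\<^esub> r = (fst q + fst r, snd q \<oplus>\<^bsub>T\<^esub> snd r)"
    "A \<odot>\<^bsub>?P\<^esub> q = (A \<odot>\<^bsub>L n\<^esub> fst q, A \<odot>\<^bsub>T\<^esub> snd q)" for q r A
    by (simp_all add: direct_sum_def L_module(3))
  have hom: "?f \<in> module_hom DJ ?P (ext_module n (c * a))"
  proof (rule dj_module_homI[OF P ext_module(1)])
    fix q d g assume "q \<in> carrier ?P"
    then have q: "fst q \<in> supp n" "snd q \<in> carrier T" by (simp_all only: P_iff)
    have fq: "?f q \<in> supp n \<times> supp n"
      using q(1) kr(1)[OF q(2)] by (auto simp: supp_closed)
    then show "?f q \<in> carrier (ext_module n (c * a))" by (simp only: ext_module(2))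
    show "?f (cact ?P d q) = cact (ext_module n (c * a)) d (?f q)"
      unfolding P_simps ext_module(6)[OF fq] L_module(6)[OF q(1)] fst_conv snd_conv kr(3)[OF q(2)]
      by (simp only: scale2_def fst_conv snd_conv scale_operators mult.commute)
    obtain f h where kf: "k (snd q) = (f, h)" by (cases "k (snd q)")
    show "?f (gact ?P g q) = gact (ext_module n (c * a)) g (?f q)"
      unfolding P_simps ext_module(5)[OF fq] L_module(5)[OF q(1)] fst_conv snd_conv kr(4)[OF q(2)]
      unfolding kf fst_conv snd_conv ext_gen_action_alt verma_linear trunc_linear scale_operators
      by (simp only: add_ac)
    fix r assume "r \<in> carrier ?P"
    then have r: "fst r \<in> supp n" "snd r \<in> carrier T" by (simp_all only: P_iff)
    show "?f (q \<oplus>\<^bsub>?P\<^esub> r) = ?f q \<oplus>\<^bsub>ext_module n (c * a)\<^esub> ?f r"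
      unfolding P_simps ext_module(3) fst_conv snd_conv kr(2)[OF q(2) r(2)]
      by (simp only: fst_add snd_add add_Pair scale_operators add_ac)
  qed
  let ?K = "(\<lambda>m. (dj_const c \<odot>\<^bsub>L n\<^esub> m, \<ominus>\<^bsub>T\<^esub> i m)) ` supp n"
  have neg: "\<ominus>\<^bsub>T\<^esub> i f = i (- f)" if f: "f \<in> supp n" for f
  proof -
    have "\<ominus>\<^bsub>L n\<^esub> f = - f"
      using abelian_group.minus_equality[of "L n" "- f" f] L_module(1)[where 'k = 'k and n = n] f supp_uminus[OF f]
      by (simp add: left_module_def L_module(2,3,4))
    then show ?thesis using module_hom_minus[OF L_module(1) T ih, of f] f by (simp add: L_module(2))
  qed
  have K: "?K = {q \<in> carrier ?P. ?f q = (0, 0)}"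
  proof (intro equalityI subsetI)
    fix q assume "q \<in> ?K"
    then obtain m where m: "m \<in> supp n" "q = (dj_const c \<odot>\<^bsub>L n\<^esub> m, \<ominus>\<^bsub>T\<^esub> i m)" by blast
    from m(2) have m2: "q = (scale1 c m, i (- m))" unfolding neg[OF m(1)] L_module(6)[OF m(1)] .
    have "scale1 c m + scale1 c (- m) = 0" by (simp add: scale1_def fun_eq_iff)
    then show "q \<in> {q \<in> carrier ?P. ?f q = (0, 0)}"
      unfolding mem_Collect_eq P_iff m2 fst_conv snd_conv using i[OF supp_uminus[OF m(1)]] supp_closed(3)[OF m(1)]
      by simp
  next
    fix q assume "q \<in> {q \<in> carrier ?P. ?f q = (0, 0)}"
    then have q: "fst q \<in> supp n" "snd q \<in> carrier T"
      and f: "fst q + scale1 c (fst (k (snd q))) = 0" "snd (k (snd q)) = 0"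
      by (simp_all only: mem_Collect_eq P_iff prod.inject)
    have 1: "snd q = i (fst (k (snd q))) \<and> fst (k (snd q)) \<in> supp n" by (rule ext_kernel[OF k q(2) f(2) i])
    let ?m = "- fst (k (snd q))"
    have m: "?m \<in> supp n" using supp_uminus 1 by blast
    have "fst q = - scale1 c (fst (k (snd q)))" using f(1) by (simp only: eq_neg_iff_add_eq_0)
    also have "\<dots> = scale1 c ?m" by (simp add: scale1_def fun_eq_iff)
    finally have "q = (dj_const c \<odot>\<^bsub>L n\<^esub> ?m, \<ominus>\<^bsub>T\<^esub> i ?m)"
      unfolding neg[OF m] L_module(6)[OF m] using 1 by (simp only: prod_eq_iff fst_conv snd_conv minus_minus)
    then show "q \<in> ?K" using m by blast
  qed
  have "ext_equiv DJ (L n) (model_ext n (c * a))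
    (quotient_module ?P ?K, (\<lambda>m. ?K +>\<^bsub>?P\<^esub> (m, \<zero>\<^bsub>T\<^esub>)), (\<lambda>Y. the_elem ((\<lambda>(m, t). p t) ` Y)))"
  proof (rule quotient_ext_equiv[OF P hom _ K])
    fix m :: "nat \<Rightarrow> 'k" assume m: "m \<in> supp n"
    have "scale1 c 0 = (0 :: nat \<Rightarrow> 'k)" by (simp add: scale1_def zero_fun_def)
    then show "(m, \<zero>\<^bsub>T\<^esub>) \<in> carrier ?P \<and> ?f (m, \<zero>\<^bsub>T\<^esub>) = (m, 0)"
      unfolding P_iff fst_conv snd_conv kr(5) using m by (simp only: add_0_right T.M.zero_closed)
  next
    fix q assume "q \<in> carrier ?P"
    then show "(case q of (m, t) \<Rightarrow> p t) = snd (?f q)" unfolding P_iff by (cases q) (auto simp: p)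
  next
    fix m :: "'k fpair" assume m: "m \<in> supp n \<times> supp n"
    have surj: "k ` carrier T = supp n \<times> supp n"
      using k by (simp add: module_iso_def bij_betw_def ext_module(2))
    have "(0, snd m) \<in> k ` carrier T" unfolding surj using m by (auto simp: supp_closed)
    then obtain t where t: "t \<in> carrier T" "k t = (0, snd m)" by (elim imageE) simp
    have "scale1 c 0 = (0 :: nat \<Rightarrow> 'k)" by (simp add: scale1_def zero_fun_def)
    then have "m = ?f (fst m, t)" using t by (simp only: fst_conv snd_conv add_0_right prod.collapse)
    moreover have "(fst m, t) \<in> carrier ?P" unfolding P_iff using m t by auto
    ultimately show "m \<in> ?f ` carrier ?P" by (rule image_eqI)
  qed
  then show ?thesis by (simp add: E1 pushout_ext_def Let_def L_module(2))
qed

lemma split_model: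
  "ext_equiv DJ (L n) (model_ext n 0) (split_ext (L n) (L n :: ('k::field_char_0 dj, nat \<Rightarrow> 'k) module))"
proof -
  let ?L = "L n :: ('k dj, nat \<Rightarrow> 'k) module"
  have D: "left_module DJ (direct_sum ?L ?L)" by (rule left_module_direct_sum[OF L_module(1) L_module(1)])
  have D_simps: "carrier (direct_sum ?L ?L) = supp n \<times> supp n" "m \<oplus>\<^bsub>direct_sum ?L ?L\<^esub> m' = m + m'"
    "A \<odot>\<^bsub>direct_sum ?L ?L\<^esub> m = (A \<odot>\<^bsub>?L\<^esub> fst m, A \<odot>\<^bsub>?L\<^esub> snd m)" for m m' A
    by (simp_all add: direct_sum_def L_module(2,3) plus_prod_def)
  have "(\<lambda>m. m) \<in> module_hom DJ (ext_module n 0) (direct_sum ?L ?L)"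
  proof (rule dj_module_homI[OF ext_module(1) D])
    fix m :: "'k fpair" and c g assume "m \<in> carrier (ext_module n 0)"
    then have m: "m \<in> supp n \<times> supp n" by (simp only: ext_module(2))
    then have m12: "fst m \<in> supp n" "snd m \<in> supp n" by auto
    show "m \<in> carrier (direct_sum ?L ?L)" using m by (simp only: D_simps)
    show "cact (ext_module n 0) c m = cact (direct_sum ?L ?L) c m"
      unfolding ext_module(6)[OF m] D_simps L_module(6)[OF m12(1)] L_module(6)[OF m12(2)] scale2_def ..
    show "gact (ext_module n 0) g m = gact (direct_sum ?L ?L) g m"
      unfolding ext_module(5)[OF m] D_simps L_module(5)[OF m12(1)] L_module(5)[OF m12(2)]
      using ext_gen_action_alt[of n 0 g "fst m" "snd m"] by (simp add: scale1_def fun_eq_iff)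
  qed (simp only: ext_module(3) D_simps)
  then have "(\<lambda>m. m) \<in> module_iso DJ (ext_module n 0) (direct_sum ?L ?L)"
    by (simp add: module_iso_def ext_module(2) D_simps bij_betw_def)
  then show ?thesis unfolding split_ext_def ext_equiv_iff
    by (rule bexI[rotated]) (simp add: L_module(4))
qed

lemma Ext1_operations:
  fixes a b c :: "'k::field_char_0" and n :: nat
  defines "V \<equiv> Ext1 DJ dj_const (L n :: ('k dj, nat \<Rightarrow> 'k) module) (L n)"
  shows "ext_class n a \<oplus>\<^bsub>V\<^esub> ext_class n b = ext_class n (a + b)" "c \<odot>\<^bsub>V\<^esub> ext_class n a = ext_class n (c * a)"
    "\<zero>\<^bsub>V\<^esub> = ext_class n 0"
proof -
  let ?X = "extensions DJ (L n) (L n) :: ('k dj, nat \<Rightarrow> 'k, nat \<Rightarrow> 'k, 'k fpair) ext set"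
  have baer: "E \<in> ?X \<and> ext_equiv DJ (L n) E (baer_sum (L n) E1 E2) \<longleftrightarrow> E \<in> ext_class n (a + b)"
    if "E1 \<in> ext_class n a" "E2 \<in> ext_class n b" for E E1 E2
    using ext_class_eq[OF baer_sum_model[OF that]] by blast
  have "ext_class n a \<oplus>\<^bsub>V\<^esub> ext_class n b
      = {E \<in> ?X. \<exists>E1\<in>ext_class n a. \<exists>E2\<in>ext_class n b. ext_equiv DJ (L n) E (baer_sum (L n) E1 E2)}"
    by (simp add: V_def Ext1_def)
  also have "\<dots> = ext_class n (a + b)" using baer ext_class_in[of n a] ext_class_in[of n b] by blast
  finally show "ext_class n a \<oplus>\<^bsub>V\<^esub> ext_class n b = ext_class n (a + b)" .
  have push: "E \<in> ?X \<and> ext_equiv DJ (L n) E (pushout_ext (L n) (\<lambda>m. dj_const c \<odot>\<^bsub>L n\<^esub> m) E1) \<longleftrightarrow> E \<in> ext_class n (c * a)"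
    if "E1 \<in> ext_class n a" for E E1
    using ext_class_eq[OF pushout_model[OF that]] by blast
  have "c \<odot>\<^bsub>V\<^esub> ext_class n a
      = {E \<in> ?X. \<exists>E1\<in>ext_class n a. ext_equiv DJ (L n) E (pushout_ext (L n) (\<lambda>m. dj_const c \<odot>\<^bsub>L n\<^esub> m) E1)}"
    by (simp add: V_def Ext1_def)
  also have "\<dots> = ext_class n (c * a)" using push ext_class_in[of n a] by blast
  finally show "c \<odot>\<^bsub>V\<^esub> ext_class n a = ext_class n (c * a)" .
  show "\<zero>\<^bsub>V\<^esub> = ext_class n 0" using ext_class_eq[OF split_model] by (simp add: V_def Ext1_def)
qed

text \<open>The laws of a vector space are inherited by the image of a linear map; this way they need not be
  verified on Baer sums.\<close>

lemma vectorspace_image: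
  fixes V :: "('k::field, 'v) module"
  assumes carrier: "carrier V = range f" and add: "\<And>a b. f a \<oplus>\<^bsub>V\<^esub> f b = f (a + b)"
    and smult: "\<And>c a. c \<odot>\<^bsub>V\<^esub> f a = f (c * a)" and zero: "\<zero>\<^bsub>V\<^esub> = f 0"
  shows "vectorspace ring_of_type_algebra V"
proof (intro vectorspace.intro field_from_type_algebra moduleI cring_from_type_algebra abelian_groupI)
  fix x assume "x \<in> carrier V"
  then obtain a where "x = f a" by (auto simp: carrier)
  then show "\<exists>y\<in>carrier V. y \<oplus>\<^bsub>V\<^esub> x = \<zero>\<^bsub>V\<^esub>"
    by (intro bexI[of _ "f (- a)"]) (simp_all add: carrier add zero)
qed (auto simp: carrier add smult zero algebra_simps)

text \<open>By \<open>Ext1_operations\<close> the class is a linear function of the parameter. It is onto, and it is injective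
  for positive \<open>n\<close> and zero for \<open>n = 0\<close>.\<close>

lemma Ext1_dim:
  "has_dim (Ext1 DJ dj_const (L n :: ('k::field_char_0 dj, nat \<Rightarrow> 'k) module) (L n)) (if n = 0 then 0 else 1)"
proof -
  let ?V = "Ext1 DJ dj_const (L n :: ('k dj, nat \<Rightarrow> 'k) module) (L n)"
  have V: "vectorspace ring_of_type_algebra ?V"
    by (rule vectorspace_image[OF Ext1_carrier Ext1_operations])
  interpret vectorspace ring_of_type_algebra ?V by (rule V)
  show ?thesis
  proof (cases "n = 0")
    case True
    have "has_dim ?V (card ({} :: unit set))"
    proof (rule has_dimI[OF V, of _ "\<lambda>_. undefined"])
      fix v assume "v \<in> carrier ?V"
      then have "v = \<zero>\<^bsub>?V\<^esub>" using True ext_class_eq_iff[of n] by (auto simp: Ext1_carrier Ext1_operations(3))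
      then show "\<exists>f. v = (\<Oplus>\<^bsub>?V\<^esub>i\<in>{}. f i \<odot>\<^bsub>?V\<^esub> undefined)" by simp
    qed simp_all
    then show ?thesis using True by simp
  next
    case False
    have sum: "(\<Oplus>\<^bsub>?V\<^esub>i\<in>{()}. f i \<odot>\<^bsub>?V\<^esub> ext_class n 1) = ext_class n (f ())" for f :: "unit \<Rightarrow> 'k"
    proof -
      have "ext_class n c \<in> carrier ?V" for c :: 'k by (simp add: Ext1_carrier)
      then show ?thesis using finsum_insert[of "{}" "()" "\<lambda>i. f i \<odot>\<^bsub>?V\<^esub> ext_class n 1"] by (simp add: Ext1_operations(2))
    qed
    have "has_dim ?V (card {()})"
    proof (rule has_dimI[OF V, of _ "\<lambda>_. ext_class n 1"])
      fix v assume "v \<in> carrier ?V"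
      then obtain c :: 'k where "v = ext_class n c" by (auto simp: Ext1_carrier)
      then have "v = (\<Oplus>\<^bsub>?V\<^esub>i\<in>{()}. (\<lambda>_. c) i \<odot>\<^bsub>?V\<^esub> ext_class n 1)" using sum[of "\<lambda>_. c"] by simp
      then show "\<exists>f. v = (\<Oplus>\<^bsub>?V\<^esub>i\<in>{()}. f i \<odot>\<^bsub>?V\<^esub> ext_class n 1)" by (rule exI[of _ "\<lambda>_. c"])
    next
      fix f :: "unit \<Rightarrow> 'k" and i
      assume "(\<Oplus>\<^bsub>?V\<^esub>i\<in>{()}. f i \<odot>\<^bsub>?V\<^esub> ext_class n 1) = \<zero>\<^bsub>?V\<^esub>"
      then have "ext_class n (f ()) = ext_class n 0" by (simp only: sum Ext1_operations(3))
      then show "f i = 0" using False ext_class_eq_iff[of n "f ()" 0] by simp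
    qed (simp_all add: Ext1_carrier)
    then show ?thesis using False by simp
  qed
qed

theorem proposition5p2:
  fixes n :: nat
    and lam mu gam :: "'k::{alg_closed_field, field_char_0}"
  shows
    "(has_dim (restrict_scalars dj_const (S n lam mu gam)) (2 * (n + 1))
        \<longleftrightarrow> lam + of_nat n / 2 * gam = 0 \<and> mu = 0)
     \<and>
     (\<forall>gam1 gam2 :: 'k.
        modules_isomorphic DJ (S_gamma n gam1) (S_gamma n gam2)
          \<longleftrightarrow> n = 0 \<or> (\<exists>t. t \<noteq> 0 \<and> gam1 = t * gam2))
     \<and>
     (\<forall>gam1 :: 'k. \<exists>i p. short_exact DJ (L n) i (S_gamma n gam1) p (L n))
     \<and>
     (\<forall>(T :: ('k dj, 't) module) i p. short_exact DJ (L n) i T p (L n)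
        \<longrightarrow> (\<exists>gam1. modules_isomorphic DJ T (S_gamma n gam1)))
     \<and>
     has_dim (Ext1 DJ dj_const (L n :: ('k dj, nat \<Rightarrow> 'k) module) (L n)) (if n = 0 then 0 else 1)"
proof (intro conjI allI impI)
  show "has_dim (restrict_scalars dj_const (S n lam mu gam)) (2 * (n + 1))
      \<longleftrightarrow> lam + of_nat n / 2 * gam = 0 \<and> mu = 0"
    by (rule S_dim)
  show "modules_isomorphic DJ (S_gamma n gam1) (S_gamma n gam2) \<longleftrightarrow> n = 0 \<or> (\<exists>t. t \<noteq> 0 \<and> gam1 = t * gam2)"
    for gam1 gam2 :: 'k
    by (rule S_gamma_iso_iff)
  show "\<exists>i p. short_exact DJ (L n) i (S_gamma n gam1) p (L n)" for gam1 :: 'k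
  proof -
    obtain h where "h \<in> module_iso DJ (ext_module n gam1) (S_gamma n gam1)"
      using S_gamma_isomorphic[of n gam1] by (auto simp: modules_isomorphic_def)
    from short_exact_transport[OF ext_module_short_exact this S_gamma_left_module] show ?thesis by blast
  qed
  show "\<exists>gam1. modules_isomorphic DJ T (S_gamma n gam1)" if "short_exact DJ (L n) i T p (L n)"
    for T :: "('k dj, 't) module" and i p
  proof (rule extension_classification[OF that])
    fix gam1 h assume "h \<in> module_iso DJ (ext_module n gam1) T"
    then have "modules_isomorphic DJ (ext_module n gam1) T" by (auto simp: modules_isomorphic_def)
    from modules_isomorphic_trans[OF modules_isomorphic_sym[OF ext_module(1) this] S_gamma_isomorphic]
    show ?thesis by blast
  qed
qed (rule Ext1_dim)

end
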